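(* Let $T>0$, let $\phi:\mathbb{R}^n\to[0,+\infty)$ be differentiable, and let $F:[0,T]\times\mathbb{R}^n\to\mathbb{R}$ be such that $F(\cdot,x)$ is measurable for every $x\in\mathbb{R}^n$. Assume: (1) $\phi$ is a strictly convex $G$-function, and both $\phi$ and its conjugate $\phi^\star$ satisfy the $\Delta_2$-condition; moreover $\phi$ is an $N$-function. (2) For a.e. $t\in[0,T]$, the function $F(t,\cdot)$ is locally Lipschitz and regular on $\mathbb{R}^n$. (3) There exist $b\in L^1([0,T];[0,\infty))$ and $c:\mathbb{R}^n\to\mathbb{R}$, with $c$ bounded on bounded subsets, such that for every $x\in\mathbb{R}^n$, for a.e. $t\in[0,T]$ and for every $\xi_t\in\partial F(t,x)$, $$|F(t,x)|+|\xi_t|\le c(x)\,b(t).$$ (4) $$\lim_{|x|\to\infty}\int_0^TF(t,x)\,dt=\infty.$$ (5) There exists $b_1\in L^1([0,T],\mathbb{R})$ such that $[F(t,\cdot)]_{\mathcal{BO}}\le b_1(t)$ for a.e. $t\in[0,T]$, where $$[f]_{\mathcal{BO}}:=\sup_{x,y\in\mathbb{R}^n}\frac{|f(x)-f(y)|}{1+|x-y|}.$$ Then the functional $$\mathcal{I}(u)=\int_0^T\phi(u'(t))\,dt+\int_0^TF(t,u(t))\,dt$$ has a minimum at some $u\in W^1L^\phi_T$, and $u$ solves the problem $$\frac{d}{dt}\nabla\phi(u'(t))\in\partial F(t,u(t))\ \text{ for a.e. } t\in(0,T),\qquad u(0)-u(T)=u'(0)-u'(T)=0.$$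
   Context: $|\cdot|$ is the Euclidean norm on $\mathbb{R}^n$. A function $\phi:\mathbb{R}^n\to[0,+\infty]$ is a $G$-function if it is convex, lower semicontinuous, bounded in some neighborhood of $0$, $\phi(0)=0$, $\phi(-x)=\phi(x)$, and $\lim_{|x|\to\infty}\phi(x)=\infty$. A $G$-function $\phi:\mathbb{R}^n\to[0,\infty)$ is an $N$-function if $\phi(x)=0$ iff $x=0$, $\lim_{|x|\to0}\phi(x)/|x|=0$ and $\lim_{|x|\to\infty}\phi(x)/|x|=\infty$. The conjugate (complementary function) is $\phi^\star(\xi)=\sup_{x\in\mathbb{R}^n}\big(\langle\xi,x\rangle-\phi(x)\big)$. A $G$-function $\phi:\mathbb{R}^n\to[0,+\infty)$ satisfies the $\Delta_2$-condition if there is $C>0$ with $\phi(2x)\le C\phi(x)+1$ for all $x$ (in particular, to say that $\phi^\star$ satisfies it includes that $\phi^\star$ is finite-valued). For a locally Lipschitz $f:\mathbb{R}^n\to\mathbb{R}$, $f^0(x;v)=\limsup_{y\to x,\ \lambda\searrow0}\frac{f(y+\lambda v)-f(y)}{\lambda}$ and the Clarke generalized gradient is $\partial f(x)=\{\xi: f^0(x;v)\ge\langle\xi,v\rangle\ \forall v\}$. $f$ is regular if the usual (one-sided) directional derivative exists and equals $f^0(x;v)$ for all $x,v$. $\partial F(t,x)$ denotes the Clarke generalized gradient of $F(t,\cdot)$ at $x$. $L^\phi=L^\phi([0,T],\mathbb{R}^n)$ is the set of measurable $u:[0,T]\to\mathbb{R}^n$ with $\int_0^T\phi(\lambda u)\,dt<\infty$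 for some $\lambda>0$, with Luxemburg norm $\|u\|_{L^\phi}=\inf\{\lambda>0:\int_0^T\phi(u/\lambda)\,dt\le1\}$. $W^1L^\phi$ is the space of absolutely continuous $u:[0,T]\to\mathbb{R}^n$ with $u'\in L^\phi$, normed by $\|u\|_{L^\phi}+\|u'\|_{L^\phi}$, and $W^1L^\phi_T=\{u\in W^1L^\phi:u(0)=u(T)\}$. Solving the problem means: after modification of $u'$ on a null set, $t\mapsto\nabla\phi(u'(t))$ is absolutely continuous on $[0,T]$, the inclusion holds a.e., and the boundary conditions hold (for this representative of $u'$). *)

theory Defs
  imports "HOL-Analysis.Analysis"
begin

section \<open>Convex functions\<close>

text \<open>Values in \<open>[0,\<infinity>]\<close> are rendered in \<^typ>\<open>ereal\<close>, where \<open>0 * \<infinity> = 0\<close>, so the convexity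
  inequality is the usual one also at the endpoints \<open>s = 0\<close> and \<open>s = 1\<close>. The conjunct after
  convexity is lower semicontinuity; \<open>nhds x\<close> rather than \<open>at x\<close> makes no difference there.\<close>

definition G_function :: "('a::euclidean_space \<Rightarrow> ereal) \<Rightarrow> bool" where
  "G_function \<phi> \<longleftrightarrow>
     (\<forall>x. 0 \<le> \<phi> x) \<and>
     (\<forall>x y. \<forall>s\<in>{0..1}. \<phi> ((1 - s) *\<^sub>R x + s *\<^sub>R y) \<le> ereal (1 - s) * \<phi> x + ereal s * \<phi> y) \<and>
     (\<forall>x. \<phi> x \<le> Liminf (nhds x) \<phi>) \<and>
     (\<exists>r>0. \<exists>M::real. \<forall>x\<in>ball 0 r. \<phi> x \<le> ereal M) \<and>
     \<phi> 0 = 0 \<and>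
     (\<forall>x. \<phi> (- x) = \<phi> x) \<and>
     (\<phi> \<longlongrightarrow> \<infinity>) at_infinity"

definition N_function :: "('a::euclidean_space \<Rightarrow> real) \<Rightarrow> bool" where
  "N_function \<phi> \<longleftrightarrow>
     G_function (\<lambda>x. ereal (\<phi> x)) \<and>
     (\<forall>x. \<phi> x = 0 \<longleftrightarrow> x = 0) \<and>
     ((\<lambda>x. \<phi> x / norm x) \<longlongrightarrow> 0) (at 0) \<and>
     filterlim (\<lambda>x. \<phi> x / norm x) at_top at_infinity"

definition conjugate_fun :: "('a::euclidean_space \<Rightarrow> ereal) \<Rightarrow> 'a \<Rightarrow> ereal" where
  "conjugate_fun \<phi> \<xi> = (SUP x. ereal (\<xi> \<bullet> x) - \<phi> x)"

definition Delta2 :: "('a::euclidean_space \<Rightarrow> ereal) \<Rightarrow> bool" where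
  "Delta2 \<phi> \<longleftrightarrow>
     (\<forall>x. \<bar>\<phi> x\<bar> \<noteq> \<infinity>) \<and> (\<exists>C::real. C > 0 \<and> (\<forall>x. \<phi> (2 *\<^sub>R x) \<le> ereal C * \<phi> x + 1))"

definition strictly_convex :: "('a::euclidean_space \<Rightarrow> real) \<Rightarrow> bool" where
  "strictly_convex \<phi> \<longleftrightarrow>
     (\<forall>x y. x \<noteq> y \<longrightarrow> (\<forall>s\<in>{0<..<1}. \<phi> ((1 - s) *\<^sub>R x + s *\<^sub>R y) < (1 - s) * \<phi> x + s * \<phi> y))"

definition grad :: "('a::euclidean_space \<Rightarrow> real) \<Rightarrow> 'a \<Rightarrow> 'a" where
  "grad f x = (THE D. GDERIV f x :> D)"

section \<open>Clarke's calculus and the BO seminorm\<close>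

definition locally_lipschitz :: "('a::euclidean_space \<Rightarrow> real) \<Rightarrow> bool" where
  "locally_lipschitz f \<longleftrightarrow> (\<forall>x. \<exists>r>0. \<exists>L. L-lipschitz_on (ball x r) f)"

definition clarke_deriv :: "('a::euclidean_space \<Rightarrow> real) \<Rightarrow> 'a \<Rightarrow> 'a \<Rightarrow> ereal" where
  "clarke_deriv f x v =
     Limsup (nhds x \<times>\<^sub>F at_right 0) (\<lambda>(y, l). ereal ((f (y + l *\<^sub>R v) - f y) / l))"

definition clarke_gradient :: "('a::euclidean_space \<Rightarrow> real) \<Rightarrow> 'a \<Rightarrow> 'a set" where
  "clarke_gradient f x = {\<xi>. \<forall>v. clarke_deriv f x v \<ge> ereal (\<xi> \<bullet> v)}"

definition clarke_regular :: "('a::euclidean_space \<Rightarrow> real) \<Rightarrow> bool" where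
  "clarke_regular f \<longleftrightarrow>
     (\<forall>x v. \<exists>d. ((\<lambda>l. (f (x + l *\<^sub>R v) - f x) / l) \<longlongrightarrow> d) (at_right 0) \<and>
                clarke_deriv f x v = ereal d)"

definition BO_seminorm :: "('a::euclidean_space \<Rightarrow> real) \<Rightarrow> ereal" where
  "BO_seminorm f = (SUP (x, y). ereal (\<bar>f x - f y\<bar> / (1 + norm (x - y))))"

section \<open>Absolutely continuous functions and Orlicz--Sobolev spaces\<close>

text \<open>A function on \<open>[0,T]\<close> is represented by a total function on \<^typ>\<open>real\<close>; only its values on
  \<open>[0,T]\<close> are ever used.\<close>

definition absolutely_continuous_on :: "real set \<Rightarrow> (real \<Rightarrow> 'a::euclidean_space) \<Rightarrow> bool" where
  "absolutely_continuous_on S f \<longleftrightarrow>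
     (\<forall>e>0. \<exists>d>0. \<forall>D. finite D \<and>
        (\<forall>(a, b)\<in>D. a \<le> b \<and> {a..b} \<subseteq> S) \<and>
        pairwise (\<lambda>p q. disjnt {fst p<..<snd p} {fst q<..<snd q}) D \<and>
        (\<Sum>(a, b)\<in>D. b - a) < d
        \<longrightarrow> (\<Sum>(a, b)\<in>D. norm (f b - f a)) < e)"

definition deriv_on :: "real \<Rightarrow> (real \<Rightarrow> 'a::euclidean_space) \<Rightarrow> real \<Rightarrow> 'a" where
  "deriv_on T u t = vector_derivative u (at t within {0..T})"

definition orlicz_space :: "real \<Rightarrow> ('a::euclidean_space \<Rightarrow> real) \<Rightarrow> (real \<Rightarrow> 'a) set" where
  "orlicz_space T \<phi> =
     {u \<in> borel_measurable (lebesgue_on {0..T}).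
        \<exists>l>0. (\<integral>\<^sup>+ t. ennreal (\<phi> (l *\<^sub>R u t)) \<partial>lebesgue_on {0..T}) < \<infinity>}"

definition W1_orlicz :: "real \<Rightarrow> ('a::euclidean_space \<Rightarrow> real) \<Rightarrow> (real \<Rightarrow> 'a) set" where
  "W1_orlicz T \<phi> = {u. absolutely_continuous_on {0..T} u \<and> deriv_on T u \<in> orlicz_space T \<phi>}"

definition W1_orlicz_per :: "real \<Rightarrow> ('a::euclidean_space \<Rightarrow> real) \<Rightarrow> (real \<Rightarrow> 'a) set" where
  "W1_orlicz_per T \<phi> = {u \<in> W1_orlicz T \<phi>. u 0 = u T}"

section \<open>The functional and the inclusion\<close>

text \<open>The Bochner integral of a non-integrable function is \<open>0\<close>. This convention plays no role on
  \<open>W1_orlicz_per T \<phi>\<close>: \<open>\<phi> (u')\<close> is integrable by the \<open>\<Delta>\<^sub>2\<close>-condition for \<open>\<phi>\<close>, and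
  \<open>F t (u t)\<close> is integrable because \<open>F\<close> is a Caratheodory function which, for almost every \<open>t\<close>, is
  bounded by a constant times \<open>b t\<close> on the (bounded) range of \<open>u\<close>.\<close>

definition action ::
  "real \<Rightarrow> ('a::euclidean_space \<Rightarrow> real) \<Rightarrow> (real \<Rightarrow> 'a \<Rightarrow> real) \<Rightarrow> (real \<Rightarrow> 'a) \<Rightarrow> real" where
  "action T \<phi> F u =
     (LINT t|lebesgue_on {0..T}. \<phi> (deriv_on T u t)) + (LINT t|lebesgue_on {0..T}. F t (u t))"

text \<open>\<open>w\<close> is the representative of \<open>u'\<close> obtained by modification on a null set.\<close>

definition solves_inclusion ::
  "real \<Rightarrow> ('a::euclidean_space \<Rightarrow> real) \<Rightarrow> (real \<Rightarrow> 'a \<Rightarrow> real) \<Rightarrow> (real \<Rightarrow> 'a) \<Rightarrow> bool" where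
  "solves_inclusion T \<phi> F u \<longleftrightarrow>
     (\<exists>w. (AE t in lebesgue_on {0..T}. (u has_vector_derivative w t) (at t within {0..T})) \<and>
          absolutely_continuous_on {0..T} (\<lambda>t. grad \<phi> (w t)) \<and>
          (AE t in lebesgue_on {0..T}. \<exists>p \<in> clarke_gradient (F t) (u t).
             ((\<lambda>s. grad \<phi> (w s)) has_vector_derivative p) (at t within {0..T})) \<and>
          u 0 - u T = 0 \<and> w 0 - w T = 0)"

end

theory Submission
  imports Defs "HOL-Complex_Analysis.Great_Picard"
begin

text \<open>
  An absolutely continuous function is the indefinite integral of its derivative: its total
  variation defines a measure that is absolutely continuous with respect to Lebesgue measure, and
  Radon-Nikodym applies. The minimiser is found by the direct method. By the bound on the
  seminorm, replacing \<open>u t\<close> by \<open>u 0\<close> in the potential costs at most a multiple of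
  \<open>1 + \<integral>|u'|\<close>, which the superlinear kinetic term absorbs; superlinearity also makes a minimising
  sequence equi-absolutely continuous, so that Arzela-Ascoli and lower semicontinuity give a
  minimiser \<open>u\<close>. With \<open>P = grad \<phi> (u')\<close>, nonnegative scalar variations in a direction \<open>e\<close> yield
  \<open>(P r - P s) \<bullet> e \<le> \<integral>_s^r F\<^sup>0(t, u; e) dt\<close> at Lebesgue points \<open>s < r\<close>. Hence \<open>P\<close> has an absolutely
  continuous, periodic representative, and differentiating this inequality places its derivative in
  the Clarke gradient.
\<close>

section \<open>Families of non-overlapping intervals\<close>

text \<open>The potential is only locally Lipschitz in \<open>u\<close>, so the first variation
  gives no equation: the one-sided derivative \<open>G t (u t) v\<close> is sublinear in
  \<open>v\<close>, not linear. It is positively homogeneous, however, and this dictates variations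
  of the form \<theta>(t) e with \<theta> nonnegative and \<open>e\<close> a fixed vector: the
  factor \<theta> comes out of the derivative, and the inequality can be localised.

  The bound on the Clarke gradient holds for each \<open>x\<close> outside a null set of times that
  depends on \<open>x\<close>, so at a given time it is available on a countable dense set of points
  only. Carrying it to all points is where regularity is decisive: the ordinary directional
  derivative is then upper semicontinuous in the point. The outcome is a bound on \<open>F t\<close>
  and on its Lipschitz constant over each ball, with a weight integrable in time, and the
  variational argument works with this bound alone.

  Superlinear growth of \<phi> has one more task: it makes \<open>grad \<phi>\<close> surjective, so
  that the continuous momentum is a gradient at every time, the exceptional times and both end
  points included.\<close>

definition interval_family :: "real set \<Rightarrow> (real \<times> real) set \<Rightarrow> bool" where
  "interval_family S D \<longleftrightarrow> finite D \<and> (\<forall>(a, b)\<in>D. a \<le> b \<and> {a..b} \<subseteq> S) \<and>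
     pairwise (\<lambda>p q. disjnt {fst p<..<snd p} {fst q<..<snd q}) D"

text \<open>Applied to the identity, this is the total length of the family
  (\<open>vsum_ident\<close>), so one function expresses both the smallness condition and the
  conclusion in the definition of absolute continuity.\<close>

definition vsum :: "(real \<Rightarrow> 'a::real_normed_vector) \<Rightarrow> (real \<times> real) set \<Rightarrow> real" where
  "vsum f D = (\<Sum>(a, b)\<in>D. norm (f b - f a))"

lemma interval_familyI:
  assumes "finite D" "\<And>p. p \<in> D \<Longrightarrow> fst p \<le> snd p" "\<And>p. p \<in> D \<Longrightarrow> {fst p..snd p} \<subseteq> S"
    and "\<And>p q. p \<in> D \<Longrightarrow> q \<in> D \<Longrightarrow> p \<noteq> q \<Longrightarrow> disjnt {fst p<..<snd p} {fst q<..<snd q}"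
  shows "interval_family S D"
  using assms unfolding interval_family_def pairwise_def by (simp add: split_beta)

lemma interval_familyD:
  assumes "interval_family S D" "p \<in> D"
  shows "fst p \<le> snd p" "{fst p..snd p} \<subseteq> S"
    "\<And>q. q \<in> D \<Longrightarrow> p \<noteq> q \<Longrightarrow> disjnt {fst p<..<snd p} {fst q<..<snd q}"
  using assms unfolding interval_family_def pairwise_def by (simp_all add: split_beta)

lemma interval_family_finite: "interval_family S D \<Longrightarrow> finite D"
  by (simp add: interval_family_def)

lemma vsum_nonneg: "0 \<le> vsum f D"
  unfolding vsum_def by (auto intro: sum_nonneg)

lemma vsum_ident:
  assumes "interval_family S D"
  shows "vsum (\<lambda>x. x) D = (\<Sum>(a, b)\<in>D. b - a)"
  using assms unfolding vsum_def interval_family_def by (intro sum.cong) auto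

lemma absolutely_continuous_on_vsum:
  "absolutely_continuous_on S f \<longleftrightarrow>
     (\<forall>e>0. \<exists>d>0. \<forall>D. interval_family S D \<and> vsum (\<lambda>x. x) D < d \<longrightarrow> vsum f D < e)"
proof -
  have "(interval_family S D \<and> vsum (\<lambda>x. x) D < d \<longrightarrow> vsum f D < e) \<longleftrightarrow>
     (finite D \<and> (\<forall>(a, b)\<in>D. a \<le> b \<and> {a..b} \<subseteq> S) \<and>
        pairwise (\<lambda>p q. disjnt {fst p<..<snd p} {fst q<..<snd q}) D \<and>
        (\<Sum>(a, b)\<in>D. b - a) < d
        \<longrightarrow> (\<Sum>(a, b)\<in>D. norm (f b - f a)) < e)" for D d e
    using vsum_ident[of S D] unfolding interval_family_def vsum_def by auto
  then show ?thesis unfolding absolutely_continuous_on_def by presburger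
qed

lemma interval_family_subset:
  assumes "interval_family S D" "S \<subseteq> S'"
  shows "interval_family S' D"
  using assms unfolding interval_family_def by fastforce

lemma interval_family_singleton:
  assumes "a \<le> b"
  shows "interval_family {a..b} {(a, b)}"
  using assms by (auto simp: interval_family_def)

text \<open>The map \<open>h\<close> will be clipping at a point, \<open>min _ y\<close> or
  \<open>max _ y\<close>; the assumption \<open>sub\<close> keeps each open image interval inside
  the original one, whence disjointness. Distinct members may have the same image, but then
  disjointness forces this image to be degenerate, so the term lost by taking the image as a set is
  0.\<close>

lemma sum_interval_family_image:
  fixes h :: "real \<Rightarrow> real"
  assumes D: "interval_family S D" and mono: "\<And>a b. a \<le> b \<Longrightarrow> h a \<le> h b"
    and sub: "\<And>a b s. h a < s \<Longrightarrow> s < h b \<Longrightarrow> a < s \<and> s < b"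
    and S': "\<And>a b. (a, b) \<in> D \<Longrightarrow> {h a..h b} \<subseteq> S'"
  shows "interval_family S' ((\<lambda>(a, b). (h a, h b)) ` D)"
    and "vsum f ((\<lambda>(a, b). (h a, h b)) ` D) = (\<Sum>(a, b)\<in>D. norm (f (h b) - f (h a)))"
proof -
  let ?k = "\<lambda>(a, b). (h a, h b)"
  have fin: "finite D" using D by (auto simp: interval_family_def)
  have disj: "disjnt {h (fst p)<..<h (snd p)} {h (fst q)<..<h (snd q)}" if "p \<in> D" "q \<in> D" "p \<noteq> q" for p q
  proof -
    have "disjnt {fst p<..<snd p} {fst q<..<snd q}"
      using D that by (auto simp: interval_family_def pairwise_def)
    moreover have "{h (fst p)<..<h (snd p)} \<subseteq> {fst p<..<snd p}" "{h (fst q)<..<h (snd q)} \<subseteq> {fst q<..<snd q}"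
      by (meson greaterThanLessThan_iff sub subsetI)+
    ultimately show ?thesis unfolding disjnt_def by blast
  qed
  show "interval_family S' (?k ` D)"
  proof (rule interval_familyI)
    show "finite (?k ` D)" using fin by simp
    fix p' assume "p' \<in> ?k ` D"
    then obtain p where p: "p \<in> D" "fst p' = h (fst p)" "snd p' = h (snd p)" by (auto simp: split_beta)
    show "fst p' \<le> snd p'" unfolding p using interval_familyD(1)[OF D p(1)] by (rule mono)
    show "{fst p'..snd p'} \<subseteq> S'" using p S'[of "fst p" "snd p"] by simp
    fix q' assume "q' \<in> ?k ` D" and ne: "p' \<noteq> q'"
    then obtain q where q: "q \<in> D" "fst q' = h (fst q)" "snd q' = h (snd q)" by (auto simp: split_beta)
    have "p \<noteq> q" using ne p q by (metis prod.expand)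
    then show "disjnt {fst p'<..<snd p'} {fst q'<..<snd q'}" using disj[OF p(1) q(1)] p q by simp
  qed
  have "vsum f (?k ` D) = (\<Sum>p\<in>D. (\<lambda>(a, b). norm (f b - f a)) (?k p))"
    unfolding vsum_def
  proof (subst sum.reindex_nontrivial[OF fin])
    fix p q assume pq: "p \<in> D" "q \<in> D" "p \<noteq> q" "?k p = ?k q"
    then have "disjnt {h (fst p)<..<h (snd p)} {h (fst p)<..<h (snd p)}"
      using disj[OF pq(1-3)] pq(4) by (simp add: split_beta)
    then have "\<not> h (fst p) < h (snd p)" by (simp add: disjnt_def)
    moreover have "h (fst p) \<le> h (snd p)" using interval_familyD(1)[OF D pq(1)] mono by blast
    ultimately show "(\<lambda>(a, b). norm (f b - f a)) (?k p) = 0" by (simp add: split_beta)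
  qed (simp add: o_def)
  then show "vsum f (?k ` D) = (\<Sum>(a, b)\<in>D. norm (f (h b) - f (h a)))"
    by (simp add: split_beta)
qed

text \<open>Every interval is clipped at \<open>y\<close> from both sides. One that straddles
  \<open>y\<close> is cut in two and the triangle inequality applies; any other leaves a degenerate
  interval on the far side, which contributes 0.\<close>

lemma interval_family_split:
  assumes D: "interval_family {x..z} D" and xyz: "x \<le> y" "y \<le> z"
  obtains D1 D2 where "interval_family {x..y} D1" "interval_family {y..z} D2"
    "\<And>f::real \<Rightarrow> 'a::real_normed_vector. vsum f D \<le> vsum f D1 + vsum f D2"
proof
  let ?D1 = "(\<lambda>(a, b). (min a y, min b y)) ` D" and ?D2 = "(\<lambda>(a, b). (max a y, max b y)) ` D"
  have mem: "x \<le> a" "a \<le> b" "b \<le> z" if "(a, b) \<in> D" for a b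
    using D that unfolding interval_family_def by auto
  have 1: "{min a y..min b y} \<subseteq> {x..y}" if "(a, b) \<in> D" for a b
    using mem[OF that] xyz by auto
  have 2: "{max a y..max b y} \<subseteq> {y..z}" if "(a, b) \<in> D" for a b
    using mem[OF that] xyz by auto
  show "interval_family {x..y} ?D1"
    by (rule sum_interval_family_image(1)[OF D, where h = "\<lambda>a. min a y"]) (use 1 in auto)
  show "interval_family {y..z} ?D2"
    by (rule sum_interval_family_image(1)[OF D, where h = "\<lambda>a. max a y"]) (use 2 in auto)
  fix f :: "real \<Rightarrow> 'a"
  have "vsum f ?D1 = (\<Sum>(a, b)\<in>D. norm (f (min b y) - f (min a y)))"
    by (rule sum_interval_family_image(2)[OF D, where h = "\<lambda>a. min a y"]) (use 1 in auto)
  moreover have "vsum f ?D2 = (\<Sum>(a, b)\<in>D. norm (f (max b y) - f (max a y)))"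
    by (rule sum_interval_family_image(2)[OF D, where h = "\<lambda>a. max a y"]) (use 2 in auto)
  moreover have "vsum f D \<le> (\<Sum>(a, b)\<in>D. norm (f (min b y) - f (min a y)) + norm (f (max b y) - f (max a y)))"
    unfolding vsum_def
  proof (rule sum_mono, safe)
    fix a b assume "(a, b) \<in> D"
    then have "a \<le> b" using mem by simp
    moreover have "norm (f b - f a) \<le> norm (f y - f a) + norm (f b - f y)"
      using norm_triangle_ineq[of "f y - f a" "f b - f y"] by simp
    ultimately show "norm (f b - f a) \<le> norm (f (min b y) - f (min a y)) + norm (f (max b y) - f (max a y))"
      by (auto simp: min_def max_def)
  qed
  ultimately show "vsum f D \<le> vsum f ?D1 + vsum f ?D2"
    by (simp add: sum.distrib split_beta)
qed

text \<open>The union of the \<open>E p\<close> is taken after degenerate intervals are discarded: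
  they add nothing to the sums, and without them the families of different \<open>p\<close> are
  disjoint as sets, so the sum over the union splits. The identity is listed separately because the
  type of \<open>f\<close> is fixed in an \<open>obtains\<close>, and its values need not be
  real.\<close>

lemma interval_family_refine:
  assumes D: "interval_family S D" and E: "\<And>p. p \<in> D \<Longrightarrow> interval_family {fst p..snd p} (E p)"
  obtains D' where "interval_family S D'"
    "\<And>f::real \<Rightarrow> 'a::real_normed_vector. vsum f D' = (\<Sum>p\<in>D. vsum f (E p))"
    "vsum (\<lambda>x::real. x) D' = (\<Sum>p\<in>D. vsum (\<lambda>x. x) (E p))"
proof
  define G where "G p = {q \<in> E p. fst q < snd q}" for p
  have fin: "finite D" using D by (auto simp: interval_family_def)
  have G: "interval_family {fst p..snd p} (G p)" if "p \<in> D" for p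
  proof (rule interval_familyI)
    show "finite (G p)" using interval_family_finite[OF E[OF that]] by (simp add: G_def)
    fix q assume q: "q \<in> G p"
    show "fst q \<le> snd q" using q by (simp add: G_def)
    show "{fst q..snd q} \<subseteq> {fst p..snd p}" using q interval_familyD(2)[OF E[OF that]] by (simp add: G_def)
    fix q' assume "q' \<in> G p" "q \<noteq> q'"
    then show "disjnt {fst q<..<snd q} {fst q'<..<snd q'}"
      using q interval_familyD(3)[OF E[OF that]] by (simp add: G_def)
  qed
  have finG: "finite (G p)" if "p \<in> D" for p using G[OF that] by (auto simp: interval_family_def)
  have Gsub: "{fst q<..<snd q} \<subseteq> {fst p<..<snd p}" "fst q < snd q" "{fst q..snd q} \<subseteq> {fst p..snd p}"
    if "p \<in> D" "q \<in> G p" for p q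
  proof -
    show *: "{fst q..snd q} \<subseteq> {fst p..snd p}" using interval_familyD(2)[OF G[OF that(1)] that(2)] .
    show **: "fst q < snd q" using that(2) by (simp add: G_def)
    have "fst p \<le> fst q" "snd q \<le> snd p" using * ** by auto
    then show "{fst q<..<snd q} \<subseteq> {fst p<..<snd p}" by auto
  qed
  have disj: "disjnt {fst q<..<snd q} {fst q'<..<snd q'}"
    if "p \<in> D" "p' \<in> D" "p \<noteq> p'" "q \<in> G p" "q' \<in> G p'" for p p' q q'
  proof -
    have "disjnt {fst p<..<snd p} {fst p'<..<snd p'}" using D that(1-3) by (auto simp: interval_family_def pairwise_def)
    then show ?thesis using Gsub[OF that(1,4)] Gsub[OF that(2,5)] unfolding disjnt_def by blast
  qed
  have disjG: "G p \<inter> G p' = {}" if "p \<in> D" "p' \<in> D" "p \<noteq> p'" for p p'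
  proof (rule ccontr)
    assume "G p \<inter> G p' \<noteq> {}"
    then obtain q where "q \<in> G p" "q \<in> G p'" by blast
    then have "disjnt {fst q<..<snd q} {fst q<..<snd q}" "fst q < snd q"
      using disj[OF that] Gsub(2)[OF that(1)] by blast+
    then show False by (simp add: disjnt_def)
  qed
  show "interval_family S (\<Union>p\<in>D. G p)"
  proof (rule interval_familyI)
    show "finite (\<Union>p\<in>D. G p)" using fin finG by auto
    fix q assume "q \<in> (\<Union>p\<in>D. G p)"
    then obtain p where p: "p \<in> D" "q \<in> G p" by blast
    show "fst q \<le> snd q" using Gsub(2)[OF p] by simp
    show "{fst q..snd q} \<subseteq> S" using Gsub(3)[OF p] interval_familyD(2)[OF D p(1)] by blast
    fix q' assume "q' \<in> (\<Union>p\<in>D. G p)" and "q \<noteq> q'"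
    then obtain p' where p': "p' \<in> D" "q' \<in> G p'" by blast
    show "disjnt {fst q<..<snd q} {fst q'<..<snd q'}"
    proof (cases "p = p'")
      case True
      then show ?thesis using interval_familyD(3)[OF G[OF p(1)] p(2)] p' \<open>q \<noteq> q'\<close> by blast
    next
      case False
      then show ?thesis using disj p p' by blast
    qed
  qed
  have *: "vsum f (\<Union>p\<in>D. G p) = (\<Sum>p\<in>D. vsum f (E p))" for f :: "real \<Rightarrow> 'c::real_normed_vector"
  proof -
    have "vsum f (G p) = vsum f (E p)" if "p \<in> D" for p
      unfolding vsum_def
    proof (rule sum.mono_neutral_left)
      show "finite (E p)" using E[OF that] by (auto simp: interval_family_def)
      show "G p \<subseteq> E p" by (auto simp: G_def)
      show "\<forall>q\<in>E p - G p. (case q of (a, b) \<Rightarrow> norm (f b - f a)) = 0"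
      proof
        fix q assume "q \<in> E p - G p"
        then have "fst q = snd q" using interval_familyD(1)[OF E[OF that], of q] by (simp add: G_def)
        then show "(case q of (a, b) \<Rightarrow> norm (f b - f a)) = 0" by (simp add: split_beta)
      qed
    qed
    moreover have "vsum f (\<Union>p\<in>D. G p) = (\<Sum>p\<in>D. vsum f (G p))"
      unfolding vsum_def by (rule sum.UNION_disjoint) (use fin finG disjG in auto)
    ultimately show ?thesis by (simp cong: sum.cong)
  qed
  show "vsum f (\<Union>p\<in>D. G p) = (\<Sum>p\<in>D. vsum f (E p))" for f :: "real \<Rightarrow> 'a" by (rule *)
  show "vsum (\<lambda>x::real. x) (\<Union>p\<in>D. G p) = (\<Sum>p\<in>D. vsum (\<lambda>x. x) (E p))" by (rule *)
qed

lemma sum_integral_interval_family_le: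
  fixes h :: "real \<Rightarrow> real"
  assumes D: "interval_family {x..y} D" and h: "h integrable_on {x..y}"
    and nonneg: "\<And>t. t \<in> {x..y} \<Longrightarrow> 0 \<le> h t"
  shows "(\<Sum>(a, b)\<in>D. integral {a..b} h) \<le> integral {x..y} h"
proof -
  \<comment> \<open>With open intervals at most one summand is nonzero at each point, so the sum is
    bounded by \<open>h\<close>; closed intervals could share end points. The integrals are the
    same.\<close>
  let ?g = "\<lambda>p t. if t \<in> {fst p<..<snd p} then h t else 0"
  have fin: "finite D" using D by (auto simp: interval_family_def)
  have sub: "fst p \<le> snd p" "{fst p..snd p} \<subseteq> {x..y}" "{fst p<..<snd p} \<subseteq> {x..y}" if "p \<in> D" for p
  proof -
    show *: "fst p \<le> snd p" "{fst p..snd p} \<subseteq> {x..y}" using D that by (force simp: interval_family_def)+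
    show "{fst p<..<snd p} \<subseteq> {x..y}" using greaterThanLessThan_subseteq_atLeastAtMost_iff * by auto
  qed
  have int: "h integrable_on {fst p<..<snd p}" if "p \<in> D" for p
    using sub(2)[OF that] h integrable_on_subinterval integrable_on_open_interval_real by blast
  have g: "?g p integrable_on {x..y}" "integral {x..y} (?g p) = integral {fst p..snd p} h" if "p \<in> D" for p
  proof -
    have e: "{fst p<..<snd p} \<inter> {x..y} = {fst p<..<snd p}" using sub(3)[OF that] by blast
    show "?g p integrable_on {x..y}" unfolding integrable_restrict_Int e by (rule int[OF that])
    show "integral {x..y} (?g p) = integral {fst p..snd p} h"
      unfolding integral_restrict_Int e by (rule integral_open_interval_real[symmetric])
  qed
  have "(\<Sum>(a, b)\<in>D. integral {a..b} h) = (\<Sum>p\<in>D. integral {x..y} (?g p))"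
  proof (rule sum.cong)
    fix p assume "p \<in> D"
    from g(2)[OF this] show "(case p of (a, b) \<Rightarrow> integral {a..b} h) = integral {x..y} (?g p)"
      unfolding split_beta by (rule sym)
  qed simp
  also have "\<dots> = integral {x..y} (\<lambda>t. \<Sum>p\<in>D. ?g p t)"
    using fin g(1) by (simp add: integral_sum)
  also have "\<dots> \<le> integral {x..y} h"
  proof (rule integral_le)
    show "(\<lambda>t. \<Sum>p\<in>D. ?g p t) integrable_on {x..y}" using fin g(1) by (intro integrable_sum) auto
    fix t assume t: "t \<in> {x..y}"
    show "(\<Sum>p\<in>D. ?g p t) \<le> h t"
    proof (cases "\<exists>p\<in>D. t \<in> {fst p<..<snd p}")
      case True
      then obtain p where p: "p \<in> D" "t \<in> {fst p<..<snd p}" by blast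
      have uniq: "q = p" if "q \<in> D" "t \<in> {fst q<..<snd q}" for q
        using D p that unfolding interval_family_def pairwise_def disjnt_def by (metis IntI empty_iff)
      have "(\<Sum>q\<in>D. ?g q t) = (\<Sum>q\<in>{p}. ?g q t)"
      proof (rule sum.mono_neutral_right[OF fin])
        show "\<forall>q\<in>D - {p}. ?g q t = 0"
        proof
          fix q assume "q \<in> D - {p}"
          then have "t \<notin> {fst q<..<snd q}" using uniq by blast
          then show "?g q t = 0" by (rule if_not_P)
        qed
      qed (use p in simp)
      also have "\<dots> = h t" using p(2) by simp
      finally show ?thesis by simp
    next
      case False
      then have "(\<Sum>p\<in>D. ?g p t) = 0" by (intro sum.neutral) auto
      then show ?thesis using nonneg t by simp
    qed
  qed (use h in auto)
  finally show ?thesis .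
qed

lemma interval_family_length_le:
  assumes "interval_family {x..y} D" "x \<le> y"
  shows "vsum (\<lambda>x. x) D \<le> y - x"
proof -
  have "vsum (\<lambda>x. x) D = (\<Sum>(a, b)\<in>D. integral {a..b} (\<lambda>_. 1))"
    unfolding vsum_ident[OF assms(1)]
    using assms(1) by (intro sum.cong) (auto simp: interval_family_def)
  also have "\<dots> \<le> integral {x..y} (\<lambda>_. 1)"
    by (rule sum_integral_interval_family_le[OF assms(1)]) auto
  finally show ?thesis using assms(2) by simp
qed

section \<open>Total variation of absolutely continuous functions\<close>

text \<open>The total variation, with the supremum over families that may leave gaps instead of
  partitions: these are the families on which absolute continuity is tested, and the supremum is the
  same.\<close>

definition variation :: "(real \<Rightarrow> 'a::real_normed_vector) \<Rightarrow> real \<Rightarrow> real \<Rightarrow> real" where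
  "variation f x y = (SUP D\<in>{D. interval_family {x..y} D}. vsum f D)"

lemma vsum_degenerate:
  assumes "interval_family {x..x} D"
  shows "vsum f D = 0"
  unfolding vsum_def
proof (rule sum.neutral, rule ballI)
  fix p assume "p \<in> D"
  then have "{fst p..snd p} \<subseteq> {x..x}" "fst p \<le> snd p" using interval_familyD[OF assms] by blast+
  then have "fst p \<in> {x..x}" "snd p \<in> {x..x}" by (meson atLeastAtMost_iff order_refl subsetD)+
  then have "fst p = snd p" by simp
  then show "(case p of (a, b) \<Rightarrow> norm (f b - f a)) = 0" by (simp add: split_beta)
qed

lemma interval_family_empty: "interval_family S {}"
  by (simp add: interval_family_def)

text \<open>Cut \<open>{x..y}\<close> into \<open>n\<close> pieces shorter than the \<delta> that
  belongs to \<epsilon> = 1. Each piece contributes less than 1, and splitting a family at the cut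
  points bounds its sum by \<open>n\<close>.\<close>

lemma bdd_above_vsum:
  fixes f :: "real \<Rightarrow> 'a::euclidean_space"
  assumes f: "absolutely_continuous_on {x..y} f" and "x \<le> y"
  shows "bdd_above (vsum f ` {D. interval_family {x..y} D})"
proof -
  obtain d where d: "d > 0" "\<And>D. interval_family {x..y} D \<Longrightarrow> vsum (\<lambda>x. x) D < d \<Longrightarrow> vsum f D < 1"
    using f unfolding absolutely_continuous_on_vsum by (meson zero_less_one)
  obtain n :: nat where n: "n > 0" "(y - x) / n < d"
  proof -
    obtain n where "(y - x) / d < real n" using reals_Archimedean2 by blast
    moreover have "0 \<le> (y - x) / d" using d(1) \<open>x \<le> y\<close> by simp
    ultimately have "0 < real n" by linarith
    then show thesis using d(1) \<open>(y - x) / d < real n\<close> by (intro that[of n]) (auto simp: field_simps)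
  qed
  define s where "s k = x + real k * ((y - x) / n)" for k :: nat
  have s_mono: "s k \<le> s m" if "k \<le> m" for k m
    using that \<open>x \<le> y\<close> unfolding s_def by (intro add_left_mono mult_right_mono) auto
  have sn: "s n = y" "s 0 = x" using n unfolding s_def by auto
  have "vsum f D \<le> real k" if "k \<le> n" "interval_family {x..s k} D" for k D
    using that
  proof (induction k arbitrary: D)
    case 0
    then show ?case using vsum_degenerate[of x D f] sn by simp
  next
    case (Suc k)
    have "x \<le> s k" using s_mono[of 0 k] sn by simp
    moreover have "s k \<le> s (Suc k)" by (rule s_mono) simp
    ultimately obtain D1 D2 where D: "interval_family {x..s k} D1" "interval_family {s k..s (Suc k)} D2"
      "vsum f D \<le> vsum f D1 + vsum f D2"
      using interval_family_split[OF Suc.prems(2)] by metis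
    have "vsum (\<lambda>x. x) D2 \<le> s (Suc k) - s k" by (rule interval_family_length_le[OF D(2)]) (rule s_mono, simp)
    also have "\<dots> = (y - x) / n" by (simp add: s_def add_divide_distrib distrib_right)
    finally have "vsum (\<lambda>x. x) D2 < d" using n(2) by simp
    moreover have "{s k..s (Suc k)} \<subseteq> {x..y}"
      using s_mono[of 0 k] s_mono[of "Suc k" n] sn Suc.prems(1) by auto
    ultimately have "vsum f D2 < 1" using d(2) interval_family_subset D(2) by blast
    moreover have "vsum f D1 \<le> real k" using Suc D(1) by simp
    ultimately show ?case using D(3) by simp
  qed
  from this[of n] show ?thesis using sn unfolding bdd_above_def by auto
qed

lemma vsum_le_variation:
  assumes "bdd_above (vsum f ` {D. interval_family {x..y} D})" "interval_family {x..y} D"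
  shows "vsum f D \<le> variation f x y"
  unfolding variation_def using assms by (intro cSUP_upper) auto

lemma variation_least:
  assumes "\<And>D. interval_family {x..y} D \<Longrightarrow> vsum f D \<le> B"
  shows "variation f x y \<le> B"
  unfolding variation_def using assms interval_family_empty by (intro cSUP_least) auto

lemma bdd_above_vsum_subset:
  assumes "bdd_above (vsum f ` {D. interval_family {x..y} D})" "{x'..y'} \<subseteq> {x..y}"
  shows "bdd_above (vsum f ` {D. interval_family {x'..y'} D})"
  by (rule bdd_above_mono[OF assms(1)]) (use interval_family_subset[OF _ assms(2)] in auto)

lemma variation_combine:
  fixes f :: "real \<Rightarrow> 'a::real_normed_vector"
  assumes "x \<le> y" "y \<le> z" and bdd: "bdd_above (vsum f ` {D. interval_family {x..z} D})"
  shows "variation f x z = variation f x y + variation f y z"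
proof (rule antisym)
  have bdd1: "bdd_above (vsum f ` {D. interval_family {x..y} D})"
    and bdd2: "bdd_above (vsum f ` {D. interval_family {y..z} D})"
    by (rule bdd_above_vsum_subset[OF bdd]; use assms in auto)+
  show "variation f x z \<le> variation f x y + variation f y z"
  proof (rule variation_least)
    fix D assume "interval_family {x..z} D"
    then obtain D1 D2 where D: "interval_family {x..y} D1" "interval_family {y..z} D2"
      "vsum f D \<le> vsum f D1 + vsum f D2"
      using interval_family_split[OF _ assms(1,2)] by metis
    then show "vsum f D \<le> variation f x y + variation f y z"
      using vsum_le_variation[OF bdd1] vsum_le_variation[OF bdd2] by (smt (verit))
  qed
  have *: "vsum f D1 + vsum f D2 \<le> variation f x z"
    if D1: "interval_family {x..y} D1" and D2: "interval_family {y..z} D2" for D1 D2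
  proof -
    have D1': "interval_family {x..z} D1" and D2': "interval_family {x..z} D2"
      using interval_family_subset[OF D1] interval_family_subset[OF D2] assms by auto
    consider "x = y" | "y = z" | "x < y" "y < z" using assms by linarith
    then show ?thesis
    proof cases
      case 1
      then show ?thesis using vsum_degenerate[of x D1 f] D1 vsum_le_variation[OF bdd D2'] by simp
    next
      case 2
      then show ?thesis using vsum_degenerate[of z D2 f] D2 vsum_le_variation[OF bdd D1'] by simp
    next
      case 3
      have P: "interval_family {x..z} {(x, y), (y, z)}"
        by (rule interval_familyI) (use 3 in \<open>auto simp: disjnt_def\<close>)
      define E where "E p = (if p = (x, y) then D1 else D2)" for p
      have "interval_family {fst p..snd p} (E p)" if "p \<in> {(x, y), (y, z)}" for p
        using that D1 D2 3 by (auto simp: E_def)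
      from interval_family_refine[OF P this] obtain D' where
        "interval_family {x..z} D'" "vsum f D' = (\<Sum>p\<in>{(x, y), (y, z)}. vsum f (E p))" by metis
      moreover have "(\<Sum>p\<in>{(x, y), (y, z)}. vsum f (E p)) = vsum f D1 + vsum f D2"
        using 3 by (simp add: E_def)
      ultimately show ?thesis using vsum_le_variation[OF bdd] by metis
    qed
  qed
  have "variation f x y \<le> variation f x z - vsum f D2" if "interval_family {y..z} D2" for D2
    by (rule variation_least) (use *[OF _ that] in \<open>simp add: algebra_simps\<close>)
  then have "vsum f D2 \<le> variation f x z - variation f x y" if "interval_family {y..z} D2" for D2
    using that by (simp add: algebra_simps)
  then have "variation f y z \<le> variation f x z - variation f x y" by (rule variation_least)
  then show "variation f x y + variation f y z \<le> variation f x z" by simp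
qed

text \<open>\<open>V\<close> is the variation from \<open>x\<close>; additivity identifies its
  increments with variations. It inherits absolute continuity because each interval of a family can
  be replaced by a family nearly attaining the variation on it: the refinement is no longer in total
  length, so its \<open>f\<close>-sum is small too.\<close>

lemma absolutely_continuous_monotone_majorant:
  fixes f :: "real \<Rightarrow> 'a::euclidean_space"
  assumes f: "absolutely_continuous_on {x..y} f" and "x \<le> y"
  obtains V :: "real \<Rightarrow> real" where "absolutely_continuous_on {x..y} V"
    "\<And>s t. x \<le> s \<Longrightarrow> s \<le> t \<Longrightarrow> t \<le> y \<Longrightarrow> norm (f t - f s) \<le> V t - V s"
proof
  let ?V = "\<lambda>t. variation f x t"
  have bdd: "bdd_above (vsum f ` {D. interval_family {s..t} D})" if "x \<le> s" "t \<le> y" for s t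
    by (rule bdd_above_vsum_subset[OF bdd_above_vsum[OF assms]]) (use that in auto)
  have V: "?V t - ?V s = variation f s t" if "x \<le> s" "s \<le> t" "t \<le> y" for s t
    using variation_combine[of x s t f] that bdd[of x t] by simp
  show "norm (f t - f s) \<le> ?V t - ?V s" if "x \<le> s" "s \<le> t" "t \<le> y" for s t
  proof -
    have "vsum f {(s, t)} \<le> variation f s t"
      by (rule vsum_le_variation[OF bdd interval_family_singleton]) (use that in auto)
    then show ?thesis using V[OF that] by (simp add: vsum_def)
  qed
  show "absolutely_continuous_on {x..y} ?V"
    unfolding absolutely_continuous_on_vsum
  proof (intro allI impI)
    fix e :: real assume "e > 0"
    then obtain d where d: "d > 0" "\<And>D. interval_family {x..y} D \<Longrightarrow> vsum (\<lambda>x. x) D < d \<Longrightarrow> vsum f D < e / 2"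
      using f unfolding absolutely_continuous_on_vsum by (meson half_gt_zero)
    have "vsum ?V D \<le> e / 2" if D: "interval_family {x..y} D" "vsum (\<lambda>x. x) D < d" for D
    proof (rule ccontr)
      assume contr: "\<not> vsum ?V D \<le> e / 2"
      \<comment> \<open>The excess over \<open>e / 2\<close> is shared among
        \<open>card D + 1\<close> parts, so the total error \<open>card D * \<eta>\<close> stays
        strictly below the excess; this also covers empty \<open>D\<close>.\<close>
      define \<eta> where "\<eta> = (vsum ?V D - e / 2) / (card D + 1)"
      have \<eta>: "\<eta> > 0" using contr unfolding \<eta>_def by (intro divide_pos_pos) auto
      have p: "x \<le> fst p" "fst p \<le> snd p" "snd p \<le> y" if "p \<in> D" for p
        using interval_familyD(1,2)[OF D(1) that] by auto
      have "\<exists>E. interval_family {fst p..snd p} E \<and> variation f (fst p) (snd p) - \<eta> < vsum f E" if "p \<in> D" for p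
      proof (rule ccontr)
        assume "\<not> ?thesis"
        then have "variation f (fst p) (snd p) \<le> variation f (fst p) (snd p) - \<eta>"
          by (intro variation_least) (meson not_less)
        then show False using \<eta> by simp
      qed
      then obtain E where E: "\<And>p. p \<in> D \<Longrightarrow> interval_family {fst p..snd p} (E p)"
        "\<And>p. p \<in> D \<Longrightarrow> variation f (fst p) (snd p) - \<eta> < vsum f (E p)"
        by metis
      from interval_family_refine[OF D(1) E(1)] obtain D' where D':
        "interval_family {x..y} D'" "vsum f D' = (\<Sum>p\<in>D. vsum f (E p))"
        "vsum (\<lambda>x::real. x) D' = (\<Sum>p\<in>D. vsum (\<lambda>x. x) (E p))" by metis
      have "vsum (\<lambda>x. x) D' \<le> (\<Sum>p\<in>D. snd p - fst p)"
        unfolding D'(3) using interval_family_length_le[OF E(1)] p by (intro sum_mono) auto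
      also have "\<dots> = vsum (\<lambda>x. x) D" by (simp add: vsum_ident[OF D(1)] split_beta)
      finally have "vsum f D' < e / 2" using d(2)[OF D'(1)] D(2) by simp
      moreover have "vsum ?V D - card D * \<eta> \<le> vsum f D'"
      proof -
        have "vsum ?V D = (\<Sum>p\<in>D. variation f (fst p) (snd p))"
          unfolding vsum_def
        proof (rule sum.cong)
          fix p assume "p \<in> D"
          then have "?V (snd p) - ?V (fst p) = variation f (fst p) (snd p)" using V p by blast
          moreover have "0 \<le> variation f (fst p) (snd p)"
            using vsum_le_variation[OF bdd[OF p(1,3)[OF \<open>p \<in> D\<close>]] interval_family_empty] by (simp add: vsum_def)
          ultimately show "(case p of (a, b) \<Rightarrow> norm (?V b - ?V a)) = variation f (fst p) (snd p)"
            by (simp add: split_beta)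
        qed simp
        then have "vsum ?V D - card D * \<eta> = (\<Sum>p\<in>D. variation f (fst p) (snd p) - \<eta>)"
          by (simp add: sum_subtractf)
        also have "\<dots> \<le> vsum f D'" unfolding D'(2) using E(2) by (intro sum_mono less_imp_le) auto
        finally show ?thesis .
      qed
      moreover have "vsum ?V D - e / 2 = (card D + 1) * \<eta>" unfolding \<eta>_def by simp
      ultimately show False using \<eta> by (simp add: algebra_simps)
    qed
    then have "\<forall>D. interval_family {x..y} D \<and> vsum (\<lambda>x. x) D < d \<longrightarrow> vsum ?V D < e"
      using \<open>e > 0\<close> by fastforce
    then show "\<exists>d>0. \<forall>D. interval_family {x..y} D \<and> vsum (\<lambda>x. x) D < d \<longrightarrow> vsum ?V D < e"
      using d(1) by blast
  qed
qed

section \<open>Absolutely continuous functions are indefinite integrals\<close>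

lemma absolutely_continuous_on_imp_continuous_on:
  fixes f :: "real \<Rightarrow> 'a::euclidean_space"
  assumes "absolutely_continuous_on {x..y} f"
  shows "continuous_on {x..y} f"
  unfolding continuous_on_iff
proof (intro ballI allI impI)
  fix s e :: real assume s: "s \<in> {x..y}" and "e > 0"
  then obtain d where d: "d > 0" "\<And>D. interval_family {x..y} D \<Longrightarrow> vsum (\<lambda>x. x) D < d \<Longrightarrow> vsum f D < e"
    using assms unfolding absolutely_continuous_on_vsum by meson
  have *: "norm (f b - f a) < e" if "a \<in> {x..y}" "b \<in> {x..y}" "a \<le> b" "b - a < d" for a b
    using d(2)[OF interval_family_subset[OF interval_family_singleton[of a b]]] that
    by (simp add: vsum_def)
  show "\<exists>d>0. \<forall>x'\<in>{x..y}. dist x' s < d \<longrightarrow> dist (f x') (f s) < e"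
  proof (intro exI conjI ballI impI)
    fix t assume t: "t \<in> {x..y}" "dist t s < d"
    show "dist (f t) (f s) < e"
    proof (cases "s \<le> t")
      case True
      then show ?thesis using *[of s t] s t by (simp add: dist_norm)
    next
      case False
      then show ?thesis using *[of t s] s t by (simp add: dist_norm norm_minus_commute)
    qed
  qed (rule d(1))
qed

text \<open>Enclose the null set in an open set of length below \<delta> and cover it by countably
  many non-overlapping compact intervals inside that set. Finite subfamilies are admissible in the
  definition of absolute continuity and so have mass below \<open>e\<close>; continuity from below
  gives the bound for the whole cover. Continuity of \<open>m\<close> makes the mass of a closed
  interval equal to the increment of \<open>m\<close>.\<close>

lemma absolutely_continuous_measure:
  fixes m :: "real \<Rightarrow> real"
  assumes ac: "absolutely_continuous_on {a..b} m" and "a < b"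
    and M: "\<And>x y. x \<le> y \<Longrightarrow> m x \<le> m y" "continuous_on UNIV m"
    and N: "N \<in> null_sets lborel" "N \<subseteq> {a..b}"
  shows "emeasure (interval_measure m) N = 0"
proof -
  let ?\<mu> = "interval_measure m"
  have N_sets: "N \<in> sets borel" using N(1) by auto
  have "emeasure ?\<mu> N \<le> ennreal e" if "e > 0" for e
  proof -
    obtain d where d: "d > 0" "\<And>D. interval_family {a..b} D \<Longrightarrow> vsum (\<lambda>x. x) D < d \<Longrightarrow> vsum m D < e"
      using ac \<open>e > 0\<close> unfolding absolutely_continuous_on_vsum by meson
    obtain U where U: "open U" "N \<subseteq> U" "emeasure lborel (U - N) < ennreal d"
      by (rule outer_regular_lborel[OF N_sets d(1)])
    have "emeasure lborel (U - N) = emeasure lborel U"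
      using U(1) N(1) by (intro emeasure_Diff_null_set) auto
    then have U_less: "emeasure lborel U < ennreal d" using U(3) by simp
    \<comment> \<open>Each interval of the cover contains a point of \<open>N\<close> whose gauge
      set contains the interval; with this gauge it must lie in \<open>U\<close>.\<close>
    define g where "g x = (if x \<in> N then U else UNIV)" for x
    have "gauge g" using U unfolding gauge_def g_def by auto
    have "N \<subseteq> cbox a b" "box a b \<noteq> {}" using N(2) \<open>a < b\<close> by (auto simp: box_real)
    obtain \<D> where cD: "countable \<D>" and Dab: "\<Union>\<D> \<subseteq> cbox a b" and
      DK: "\<And>K. K \<in> \<D> \<Longrightarrow> interior K \<noteq> {} \<and> (\<exists>c d. K = cbox c d)" and
      Dd: "pairwise (\<lambda>A B. interior A \<inter> interior B = {}) \<D>" and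
      Dg: "\<And>K. K \<in> \<D> \<Longrightarrow> \<exists>x \<in> N \<inter> K. K \<subseteq> g x" and
      Dn: "\<And>u v. cbox u v \<in> \<D> \<Longrightarrow> \<exists>n. \<forall>i \<in> Basis. v \<bullet> i - u \<bullet> i = (b \<bullet> i - a \<bullet> i) / 2^n" and
      DN: "N \<subseteq> \<Union>\<D>"
    proof (rule covering_lemma[OF \<open>N \<subseteq> cbox a b\<close> \<open>box a b \<noteq> {}\<close> \<open>gauge g\<close>], goal_cases)
      case (1 \<D>)
      show thesis by (rule 1(1)) (fact 1)+
    qed
    have DU: "K \<subseteq> U" if "K \<in> \<D>" for K using Dg[OF that] by (auto simp: g_def)
    have fin: "(\<Sum>K\<in>F. emeasure ?\<mu> K) \<le> ennreal e" if F: "F \<subseteq> \<D>" "finite F" for F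
    proof -
      have "\<exists>c d. K = {c..d} \<and> c < d" if K: "K \<in> \<D>" for K
      proof -
        obtain c d where cd: "K = {c..d}" "interior K \<noteq> {}" using DK[OF K] by auto
        then have "c < d" by (simp add: interior_atLeastAtMost_real)
        then show ?thesis using cd(1) by blast
      qed
      then obtain l r where lr: "\<And>K. K \<in> \<D> \<Longrightarrow> K = {l K..r K}" "\<And>K. K \<in> \<D> \<Longrightarrow> l K < r K" by metis
      define D where "D = (\<lambda>K. (l K, r K)) ` F"
      have inj: "inj_on (\<lambda>K. (l K, r K)) F"
      proof (rule inj_onI)
        fix K J assume *: "K \<in> F" "J \<in> F" "(l K, r K) = (l J, r J)"
        have "K = {l K..r K}" by (rule lr(1)) (use * F in blast)
        also have "\<dots> = {l J..r J}" using *(3) by simp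
        also have "\<dots> = J" by (rule lr(1)[symmetric]) (use * F in blast)
        finally show "K = J" .
      qed
      have int: "interior K = {l K<..<r K}" if "K \<in> \<D>" for K
        by (subst lr(1)[OF that]) (rule interior_atLeastAtMost_real)
      have D: "interval_family {a..b} D"
      proof (rule interval_familyI)
        show "finite D" using F(2) by (simp add: D_def)
        fix p assume "p \<in> D"
        then obtain K where K: "K \<in> F" "p = (l K, r K)" by (auto simp: D_def)
        then have K': "K \<in> \<D>" using F(1) by blast
        show "fst p \<le> snd p" using K lr(2)[OF K'] by simp
        have "K \<subseteq> {a..b}" using Dab K' by auto
        moreover have "{fst p..snd p} = K" unfolding K(2) fst_conv snd_conv by (rule lr(1)[OF K', symmetric])
        ultimately show "{fst p..snd p} \<subseteq> {a..b}" by simp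
        fix q assume "q \<in> D" "p \<noteq> q"
        then obtain J where J: "J \<in> F" "q = (l J, r J)" "J \<noteq> K" using K by (auto simp: D_def)
        then have J': "J \<in> \<D>" using F(1) by blast
        then have "interior K \<inter> interior J = {}" using Dd K' J(3) by (auto simp: pairwise_def)
        then show "disjnt {fst p<..<snd p} {fst q<..<snd q}"
          using int[OF K'] int[OF J'] K(2) J(2) by (simp add: disjnt_def)
      qed
      have vs: "vsum h D = (\<Sum>K\<in>F. norm (h (r K) - h (l K)))" for h :: "real \<Rightarrow> real"
        unfolding vsum_def D_def using inj by (simp add: sum.reindex)
      have "ennreal (vsum (\<lambda>x. x) D) = (\<Sum>K\<in>F. emeasure lborel (interior K))"
        unfolding vs
      proof (subst sum_ennreal[symmetric])
        show "(\<Sum>K\<in>F. ennreal (norm (r K - l K))) = (\<Sum>K\<in>F. emeasure lborel (interior K))"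
        proof (rule sum.cong)
          fix K assume "K \<in> F"
          then have "K \<in> \<D>" using F(1) by blast
          then show "ennreal (norm (r K - l K)) = emeasure lborel (interior K)"
            using lr(2)[of K] unfolding int[OF \<open>K \<in> \<D>\<close>] by simp
        qed simp
      qed simp
      also have "\<dots> = emeasure lborel (\<Union>K\<in>F. interior K)"
        using F Dd by (intro sum_emeasure) (auto simp: disjoint_family_on_def pairwise_def)
      also have "\<dots> \<le> emeasure lborel U"
        using DU F interior_subset U(1) by (intro emeasure_mono) (blast, simp)
      also have "\<dots> < ennreal d" by (rule U_less)
      finally have "vsum (\<lambda>x. x) D < d" by (simp add: ennreal_less_iff vsum_nonneg)
      then have "vsum m D < e" using d(2) D by blast
      moreover have "(\<Sum>K\<in>F. emeasure ?\<mu> K) = ennreal (vsum m D)"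
      proof -
        have "emeasure ?\<mu> K = ennreal (norm (m (r K) - m (l K)))" if "K \<in> F" for K
        proof -
          have K: "K \<in> \<D>" using that F by blast
          have "emeasure ?\<mu> {l K..r K} = ennreal (m (r K) - m (l K))"
            using lr(2)[OF K] M by (intro emeasure_interval_measure_Icc) auto
          also have "\<dots> = ennreal (norm (m (r K) - m (l K)))" using M(1)[of "l K" "r K"] lr(2)[OF K] by simp
          finally show ?thesis using arg_cong[OF lr(1)[OF K], of "emeasure ?\<mu>"] by (rule trans[rotated])
        qed
        then show ?thesis unfolding vs by (subst sum_ennreal[symmetric]) auto
      qed
      ultimately show ?thesis by (simp add: ennreal_leI)
    qed
    show ?thesis
    proof (cases "\<D> = {}")
      case True
      then show ?thesis using DN by simp
    next
      case False
      \<comment> \<open>The enumeration may repeat members. Taking the image of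
        \<open>{..<n}\<close> as a set counts each member once, which is the form of the bound
        \<open>fin\<close> on finite subfamilies.\<close>
      define A where "A n = (\<Union>K\<in>from_nat_into \<D> ` {..<n}. K)" for n :: nat
      have in_D: "from_nat_into \<D> ` {..<n} \<subseteq> \<D>" for n using from_nat_into[OF False] by auto
      have bor: "K \<in> sets borel" if "K \<in> \<D>" for K using DK[OF that] by auto
      have A_sets: "A n \<in> sets borel" for n unfolding A_def using in_D[of n] bor by (intro sets.finite_UN) auto
      have "N \<subseteq> (\<Union>n. A n)"
      proof
        fix x assume "x \<in> N"
        then obtain K where "K \<in> \<D>" "x \<in> K" using DN by auto
        moreover obtain n where "from_nat_into \<D> n = K" using from_nat_into_surj[OF cD \<open>K \<in> \<D>\<close>] by blast
        ultimately have "x \<in> A (Suc n)" unfolding A_def by auto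
        then show "x \<in> (\<Union>n. A n)" by blast
      qed
      then have "emeasure ?\<mu> N \<le> emeasure ?\<mu> (\<Union>n. A n)"
        using A_sets by (intro emeasure_mono) auto
      also have "\<dots> = (SUP n. emeasure ?\<mu> (A n))"
      proof (rule SUP_emeasure_incseq[symmetric])
        show "incseq A" unfolding A_def incseq_def by (intro allI impI UN_mono image_mono) auto
      qed (use A_sets in auto)
      also have "\<dots> \<le> ennreal e"
      proof (rule SUP_least)
        fix n
        have "emeasure ?\<mu> (A n) \<le> (\<Sum>K\<in>from_nat_into \<D> ` {..<n}. emeasure ?\<mu> K)"
          unfolding A_def using in_D[of n] bor by (intro emeasure_subadditive_finite) auto
        also have "\<dots> \<le> ennreal e" by (rule fin) (use in_D in auto)
        finally show "emeasure ?\<mu> (A n) \<le> ennreal e" .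
      qed
      finally show ?thesis .
    qed
  qed
  then have "emeasure ?\<mu> N \<le> 0 + ennreal e" if "e > 0" for e using that by simp
  then have "emeasure ?\<mu> N \<le> 0" by (rule ennreal_le_epsilon)
  then show ?thesis by simp
qed

lemma monotone_absolutely_continuous_integral:
  fixes m :: "real \<Rightarrow> real"
  assumes ac: "absolutely_continuous_on {a..b} m" and "a < b"
    and mono: "\<And>x y. a \<le> x \<Longrightarrow> x \<le> y \<Longrightarrow> y \<le> b \<Longrightarrow> m x \<le> m y"
  obtains g where "\<And>t. 0 \<le> g t" "\<And>t. t \<in> {a..b} \<Longrightarrow> (g has_integral (m t - m a)) {a..t}"
proof -
  \<comment> \<open>Freezing \<open>m\<close> outside \<open>{a..b}\<close> gives a monotone
    continuous function on the whole line whose measure puts no mass outside the interval, so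
    absolute continuity holds with respect to all of \<open>lborel\<close>.\<close>
  define M where "M x = m (max a (min b x))" for x
  have M_eq: "M x = m x" if "x \<in> {a..b}" for x
  proof -
    have "max a (min b x) = x" using that by auto
    then show ?thesis by (simp add: M_def)
  qed
  have M_mono: "M x \<le> M y" if "x \<le> y" for x y
    unfolding M_def using that \<open>a < b\<close> by (intro mono) auto
  have M_cont: "continuous_on UNIV M"
    unfolding M_def
    by (rule continuous_on_compose2[OF absolutely_continuous_on_imp_continuous_on[OF ac]])
       (use \<open>a < b\<close> in \<open>auto intro!: continuous_intros\<close>)
  have M_ac: "absolutely_continuous_on {a..b} M"
  proof -
    have "vsum M D = vsum m D" if "interval_family {a..b} D" for D
      unfolding vsum_def
    proof (rule sum.cong)
      fix p assume "p \<in> D"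
      then have "fst p \<in> {a..b}" "snd p \<in> {a..b}" using interval_familyD(1,2)[OF that \<open>p \<in> D\<close>] by auto
      then show "(case p of (a, b) \<Rightarrow> norm (M b - M a)) = (case p of (a, b) \<Rightarrow> norm (m b - m a))"
        by (simp add: M_eq split_beta)
    qed simp
    then show ?thesis using ac unfolding absolutely_continuous_on_vsum by metis
  qed
  let ?\<mu> = "interval_measure M"
  have Icc: "emeasure ?\<mu> {x..y} = ennreal (M y - M x)" if "x \<le> y" for x y
    using emeasure_interval_measure_Icc[OF that M_mono M_cont] by simp
  have "absolutely_continuous lborel ?\<mu>"
    unfolding absolutely_continuous_def
  proof
    fix N :: "real set" assume N: "N \<in> null_sets lborel"
    then have N_sets: "N \<in> sets borel" by auto
    have 1: "emeasure ?\<mu> (N \<inter> {a..b}) = 0"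
      using absolutely_continuous_measure[OF M_ac \<open>a < b\<close> M_mono M_cont, of "N \<inter> {a..b}"]
        null_set_Int2[OF N, of "{a..b}"] by simp
    have 2: "emeasure ?\<mu> (\<Union>n::nat. {a - real n..a}) = 0"
      by (rule emeasure_UN_eq_0) (use \<open>a < b\<close> in \<open>auto simp: Icc M_def max_def min_def\<close>)
    have 3: "emeasure ?\<mu> (\<Union>n::nat. {b..b + real n}) = 0"
      by (rule emeasure_UN_eq_0) (use \<open>a < b\<close> in \<open>auto simp: Icc M_def max_def min_def\<close>)
    \<comment> \<open>These countably many massless intervals cover everything outside the open
      interval from \<open>a\<close> to \<open>b\<close>.\<close>
    let ?C = "(\<Union>n::nat. {a - real n..a}) \<union> (\<Union>n::nat. {b..b + real n})"
    have null: "N \<inter> {a..b} \<in> null_sets ?\<mu>" "?C \<in> null_sets ?\<mu>"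
    proof -
      show "N \<inter> {a..b} \<in> null_sets ?\<mu>" using 1 N_sets by (intro null_setsI) auto
      show "?C \<in> null_sets ?\<mu>" using 2 3 by (intro null_sets.Un null_setsI) auto
    qed
    have "N \<subseteq> N \<inter> {a..b} \<union> ?C"
    proof
      fix x assume "x \<in> N"
      obtain n :: nat where "\<bar>x - a\<bar> + \<bar>x - b\<bar> < real n" using reals_Archimedean2 by blast
      then have "x \<in> {a..b} \<or> x \<in> {a - real n..a} \<or> x \<in> {b..b + real n}" by auto
      then show "x \<in> N \<inter> {a..b} \<union> ?C" using \<open>x \<in> N\<close> by blast
    qed
    then show "N \<in> null_sets ?\<mu>"
      using null_sets_subset[OF null_sets.Un[OF null]] N_sets by simp
  qed
  then obtain f where f: "f \<in> borel_measurable lborel" "density lborel f = ?\<mu>"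
    using sigma_finite_measure.Radon_Nikodym[OF sigma_finite_lborel, of ?\<mu>] by auto
  have f_int: "(\<integral>\<^sup>+s. f s * indicator {a..t} s \<partial>lborel) = ennreal (m t - m a)" if "t \<in> {a..b}" for t
  proof -
    have "(\<integral>\<^sup>+s. f s * indicator {a..t} s \<partial>lborel) = emeasure (density lborel f) {a..t}"
      using f(1) by (simp add: emeasure_density)
    also have "\<dots> = ennreal (M t - M a)" unfolding f(2) by (rule Icc) (use that in auto)
    finally show ?thesis using that \<open>a < b\<close> by (simp add: M_eq)
  qed
  \<comment> \<open>The Radon-Nikodym density has values in \<open>ennreal\<close>. Its integral
    over \<open>{a..b}\<close> is finite, hence so is the density almost everywhere there, and
    \<open>enn2real\<close> loses nothing.\<close>
  have AE: "AE s in lborel. f s * indicator {a..b} s \<noteq> \<infinity>"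
    by (rule nn_integral_PInf_AE) (use f(1) f_int[of b] \<open>a < b\<close> in auto)
  show thesis
  proof
    show "0 \<le> enn2real (f t)" for t by (rule enn2real_nonneg)
    fix t assume t: "t \<in> {a..b}"
    let ?h = "\<lambda>s. if s \<in> {a..t} then enn2real (f s) else 0"
    have "(?h has_integral (m t - m a)) UNIV"
    proof (rule nn_integral_has_integral)
      show "?h \<in> borel_measurable borel" using f(1) by measurable
      have "(\<integral>\<^sup>+ x. ennreal (?h x) \<partial>lborel) = (\<integral>\<^sup>+s. f s * indicator {a..t} s \<partial>lborel)"
      proof (rule nn_integral_cong_AE, use AE in eventually_elim)
        case (elim s)
        then show ?case using t by (auto simp: indicator_def less_top)
      qed
      then show "(\<integral>\<^sup>+ x. ennreal (?h x) \<partial>lborel) = ennreal (m t - m a)" using f_int[OF t] by simp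
      show "0 \<le> m t - m a" using mono[of a t] t by auto
    qed auto
    then show "((\<lambda>t. enn2real (f t)) has_integral (m t - m a)) {a..t}"
      by (subst (asm) has_integral_restrict_UNIV)
  qed
qed

section \<open>Null sets, closure properties, and vector-valued densities\<close>

lemma AE_lebesgue_onI:
  assumes "negligible N" "\<And>t. t \<in> S \<Longrightarrow> t \<notin> N \<Longrightarrow> P t" "S \<in> sets lebesgue"
  shows "AE t in lebesgue_on S. P t"
proof -
  have "N \<in> null_sets lebesgue" using assms(1) by (simp add: negligible_iff_null_sets)
  then have "AE t in lebesgue. t \<notin> N" by (rule AE_not_in)
  then show ?thesis using assms(2,3) by (subst AE_restrict_space_iff) auto
qed

lemma AE_lebesgue_onE:
  assumes "AE t in lebesgue_on S. P t" "S \<in> sets lebesgue"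
  obtains N where "negligible N" "\<And>t. t \<in> S \<Longrightarrow> t \<notin> N \<Longrightarrow> P t"
proof -
  have "AE t in lebesgue. t \<in> S \<longrightarrow> P t"
    using assms by (simp add: AE_restrict_space_iff)
  then obtain N where N: "N \<in> null_sets lebesgue" "\<And>t. t \<in> space lebesgue - N \<Longrightarrow> t \<in> S \<longrightarrow> P t"
    by (rule AE_E3) blast
  show thesis
    by (rule that[of N]) (use N in \<open>auto simp: negligible_iff_null_sets\<close>)
qed

text \<open>A single comparison of increments that serves for sums, differences, components and
  Lipschitz functions alike; \<open>g\<close> is taken constant when one majorant is enough.\<close>

lemma absolutely_continuous_on_dominated:
  fixes f :: "real \<Rightarrow> 'a::euclidean_space" and g :: "real \<Rightarrow> 'b::euclidean_space" and h :: "real \<Rightarrow> 'c::euclidean_space"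
  assumes f: "absolutely_continuous_on S f" and g: "absolutely_continuous_on S g"
    and le: "\<And>a b. a \<le> b \<Longrightarrow> {a..b} \<subseteq> S \<Longrightarrow> norm (h b - h a) \<le> norm (f b - f a) + norm (g b - g a)"
  shows "absolutely_continuous_on S h"
  unfolding absolutely_continuous_on_vsum
proof (intro allI impI)
  fix e :: real assume "e > 0"
  then have "e / 2 > 0" by simp
  from f this obtain d1 where d1: "d1 > 0" "\<And>D. interval_family S D \<Longrightarrow> vsum (\<lambda>x. x) D < d1 \<Longrightarrow> vsum f D < e / 2"
    unfolding absolutely_continuous_on_vsum by meson
  from g \<open>e / 2 > 0\<close> obtain d2 where d2: "d2 > 0" "\<And>D. interval_family S D \<Longrightarrow> vsum (\<lambda>x. x) D < d2 \<Longrightarrow> vsum g D < e / 2"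
    unfolding absolutely_continuous_on_vsum by meson
  show "\<exists>d>0. \<forall>D. interval_family S D \<and> vsum (\<lambda>x. x) D < d \<longrightarrow> vsum h D < e"
  proof (intro exI[of _ "min d1 d2"] conjI allI impI)
    fix D assume D: "interval_family S D \<and> vsum (\<lambda>x. x) D < min d1 d2"
    have "vsum h D \<le> vsum f D + vsum g D"
      unfolding vsum_def sum.distrib[symmetric]
    proof (rule sum_mono)
      fix p assume "p \<in> D"
      then show "(case p of (a, b) \<Rightarrow> norm (h b - h a)) \<le>
          (case p of (a, b) \<Rightarrow> norm (f b - f a)) + (case p of (a, b) \<Rightarrow> norm (g b - g a))"
        using le[of "fst p" "snd p"] interval_familyD(1,2)[of S D p] D by (simp add: split_beta)
    qed
    then show "vsum h D < e" using d1(2)[of D] d2(2)[of D] D by simp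
  qed (use d1 d2 in simp)
qed

lemma absolutely_continuous_on_const: "absolutely_continuous_on S (\<lambda>_. c)"
  unfolding absolutely_continuous_on_vsum by (auto simp: vsum_def intro: exI[of _ 1])

lemma absolutely_continuous_on_ident: "absolutely_continuous_on S (\<lambda>t. t)"
  unfolding absolutely_continuous_on_vsum by auto

lemma absolutely_continuous_on_scale:
  fixes f :: "real \<Rightarrow> 'a::euclidean_space"
  assumes "absolutely_continuous_on S f"
  shows "absolutely_continuous_on S (\<lambda>t. c *\<^sub>R f t)"
  unfolding absolutely_continuous_on_vsum
proof (intro allI impI)
  fix e :: real assume "e > 0"
  then have "e / (\<bar>c\<bar> + 1) > 0" by simp
  with assms obtain d where d: "d > 0" "\<And>D. interval_family S D \<Longrightarrow> vsum (\<lambda>x. x) D < d \<Longrightarrow> vsum f D < e / (\<bar>c\<bar> + 1)"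
    unfolding absolutely_continuous_on_vsum by meson
  have "vsum (\<lambda>t. c *\<^sub>R f t) D < e" if D: "interval_family S D" "vsum (\<lambda>x. x) D < d" for D
  proof -
    have "vsum (\<lambda>t. c *\<^sub>R f t) D = \<bar>c\<bar> * vsum f D"
      unfolding vsum_def by (simp add: sum_distrib_left split_beta flip: scaleR_diff_right)
    also have "\<dots> \<le> (\<bar>c\<bar> + 1) * vsum f D" using vsum_nonneg[of f D] by (intro mult_right_mono) auto
    also have "\<dots> < e" using d(2)[OF D] by (simp add: field_simps)
    finally show ?thesis .
  qed
  then show "\<exists>d>0. \<forall>D. interval_family S D \<and> vsum (\<lambda>x. x) D < d \<longrightarrow> vsum (\<lambda>t. c *\<^sub>R f t) D < e"
    using d(1) by blast
qed

text \<open>Jordan decomposition: \<open>f\<close> is the difference of \<open>V\<close> and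
  \<open>V - f\<close>, both nondecreasing and absolutely continuous, and each of them has a
  nonnegative density.\<close>

lemma absolutely_continuous_real_integral:
  fixes f :: "real \<Rightarrow> real"
  assumes f: "absolutely_continuous_on {a..b} f" and "a < b"
  obtains g where "g absolutely_integrable_on {a..b}" "\<And>t. t \<in> {a..b} \<Longrightarrow> (g has_integral (f t - f a)) {a..t}"
proof -
  obtain V :: "real \<Rightarrow> real" where V: "absolutely_continuous_on {a..b} V"
    "\<And>s t. a \<le> s \<Longrightarrow> s \<le> t \<Longrightarrow> t \<le> b \<Longrightarrow> norm (f t - f s) \<le> V t - V s"
    using absolutely_continuous_monotone_majorant[OF f] \<open>a < b\<close> by (metis less_imp_le)
  have W: "absolutely_continuous_on {a..b} (\<lambda>t. V t - f t)"
    by (rule absolutely_continuous_on_dominated[OF V(1) f]) auto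
  have mono: "V x \<le> V y" "V x - f x \<le> V y - f y" if "a \<le> x" "x \<le> y" "y \<le> b" for x y
    using V(2)[OF that] by (auto simp: abs_le_iff)
  obtain g1 where g1: "\<And>t. 0 \<le> g1 t" "\<And>t. t \<in> {a..b} \<Longrightarrow> (g1 has_integral (V t - V a)) {a..t}"
    using monotone_absolutely_continuous_integral[OF V(1) \<open>a < b\<close> mono(1)] by metis
  obtain g2 where g2: "\<And>t. 0 \<le> g2 t"
    "\<And>t. t \<in> {a..b} \<Longrightarrow> (g2 has_integral ((V t - f t) - (V a - f a))) {a..t}"
    using monotone_absolutely_continuous_integral[OF W \<open>a < b\<close> mono(2)] by metis
  have "b \<in> {a..b}" using \<open>a < b\<close> by simp
  then have "g1 integrable_on {a..b}" "g2 integrable_on {a..b}"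
    using g1(2) g2(2) has_integral_integrable by blast+
  then have "g1 absolutely_integrable_on {a..b}" "g2 absolutely_integrable_on {a..b}"
    using g1(1) g2(1) by (auto intro: nonnegative_absolutely_integrable_1)
  then have "(\<lambda>t. g1 t - g2 t) absolutely_integrable_on {a..b}" by (rule set_integral_diff(1))
  moreover have "((\<lambda>t. g1 t - g2 t) has_integral (f t - f a)) {a..t}" if "t \<in> {a..b}" for t
    using has_integral_diff[OF g1(2)[OF that] g2(2)[OF that]] by (simp add: algebra_simps)
  ultimately show thesis by (rule that)
qed

lemma absolutely_continuous_integral:
  fixes f :: "real \<Rightarrow> 'a::euclidean_space"
  assumes f: "absolutely_continuous_on {a..b} f" and "a < b"
  obtains g where "g absolutely_integrable_on {a..b}" "\<And>t. t \<in> {a..b} \<Longrightarrow> (g has_integral (f t - f a)) {a..t}"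
proof -
  have "absolutely_continuous_on {a..b} (\<lambda>t. f t \<bullet> i)" if "i \<in> Basis" for i
  proof (rule absolutely_continuous_on_dominated[OF f absolutely_continuous_on_const[of _ "0::real"]])
    fix x y
    have "norm (f y \<bullet> i - f x \<bullet> i) \<le> norm (f y - f x)"
      using Basis_le_norm[OF that, of "f y - f x"] by (simp add: inner_diff_left)
    then show "norm (f y \<bullet> i - f x \<bullet> i) \<le> norm (f y - f x) + norm (0 - 0 :: real)" by simp
  qed
  then have "\<forall>i\<in>Basis. \<exists>g. g absolutely_integrable_on {a..b} \<and>
      (\<forall>t\<in>{a..b}. (g has_integral (f t \<bullet> i - f a \<bullet> i)) {a..t})"
    using absolutely_continuous_real_integral[OF _ \<open>a < b\<close>] by metis
  then obtain g where g: "\<And>i. i \<in> Basis \<Longrightarrow> g i absolutely_integrable_on {a..b}"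
    "\<And>i t. i \<in> Basis \<Longrightarrow> t \<in> {a..b} \<Longrightarrow> (g i has_integral (f t \<bullet> i - f a \<bullet> i)) {a..t}"
    by metis
  let ?g = "\<lambda>t. \<Sum>i\<in>Basis. g i t *\<^sub>R i"
  show thesis
  proof
    show "?g absolutely_integrable_on {a..b}"
      by (subst absolutely_integrable_componentwise_iff) (use g(1) in \<open>simp add: inner_sum_left_Basis\<close>)
    show "(?g has_integral (f t - f a)) {a..t}" if "t \<in> {a..b}" for t
      by (subst has_integral_componentwise_iff) (use g(2) that in \<open>simp add: inner_sum_left_Basis inner_diff_left\<close>)
  qed
qed

section \<open>Lebesgue differentiation and the fundamental theorem of calculus\<close>

lemma integral_subinterval_diff:
  fixes f :: "real \<Rightarrow> 'a::euclidean_space"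
  assumes "f integrable_on {a..b}" "a \<le> s" "s \<le> t" "t \<le> b"
  shows "integral {s..t} f = integral {a..t} f - integral {a..s} f"
proof -
  have "integral {a..s} f + integral {s..t} f = integral {a..t} f"
    by (rule Henstock_Kurzweil_Integration.integral_combine)
       (use assms integrable_on_subinterval[OF assms(1)] in auto)
  then show ?thesis by (simp add: algebra_simps)
qed

lemma indefinite_integral_has_vector_derivative:
  fixes g :: "real \<Rightarrow> 'a::euclidean_space"
  assumes g: "g integrable_on {a..b}"
  obtains N where "negligible N"
    "\<And>t. t \<in> {a..b} \<Longrightarrow> t \<notin> N \<Longrightarrow> ((\<lambda>t. integral {a..t} g) has_vector_derivative g t) (at t within {a..b})"
proof -
  \<comment> \<open>Extension by 0, since averages over intervals starting near the ends of
    \<open>{a..b}\<close> may reach outside.\<close>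
  define G where "G t = (if t \<in> {a..b} then g t else 0)" for t
  have G_int: "G integrable_on {x..y}" for x y
  proof -
    have "G integrable_on UNIV" unfolding G_def using g by (simp only: integrable_restrict_UNIV)
    then show ?thesis by (rule integrable_on_subinterval) simp
  qed
  have G_int': "(\<lambda>t. G (- t)) integrable_on {x..y}" for x y
    using G_int[of "- y" "- x"] by (metis Henstock_Kurzweil_Integration.integrable_reflect_real minus_minus)
  obtain N1 where N1: "negligible N1" "\<And>x e. x \<notin> N1 \<Longrightarrow> 0 < e \<Longrightarrow>
      \<exists>d>0. \<forall>h. 0 < h \<and> h < d \<longrightarrow> norm (integral (cbox x (x + h *\<^sub>R One)) G /\<^sub>R h ^ DIM(real) - G x) < e"
    using integrable_ccontinuous_explicit[of G] G_int by (metis box_real(2))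
  obtain N2 where N2: "negligible N2" "\<And>x e. x \<notin> N2 \<Longrightarrow> 0 < e \<Longrightarrow>
      \<exists>d>0. \<forall>h. 0 < h \<and> h < d \<longrightarrow> norm (integral (cbox x (x + h *\<^sub>R One)) (\<lambda>t. G (- t)) /\<^sub>R h ^ DIM(real) - G (- x)) < e"
    using integrable_ccontinuous_explicit[of "\<lambda>t. G (- t)"] G_int' by (metis box_real(2))
  \<comment> \<open>The library has Lebesgue's differentiation theorem for right averages; the left averages
    are those of the reflected function.\<close>
  have scaled: "norm (v - h *\<^sub>R w) \<le> e * h" if "norm (v /\<^sub>R h - w) < e" "0 < h" for v w :: 'a and h e
  proof -
    have "v - h *\<^sub>R w = h *\<^sub>R (v /\<^sub>R h - w)" using that(2) by (simp add: scaleR_right_diff_distrib)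
    then show ?thesis using that by (simp add: mult.commute less_imp_le)
  qed
  show thesis
  proof
    show "negligible (N1 \<union> uminus ` N2)"
      using N1(1) N2(1)
      by (intro negligible_Un negligible_differentiable_image_negligible) (auto intro: differentiable_on_minus)
    fix t assume t: "t \<in> {a..b}" "t \<notin> N1 \<union> uminus ` N2"
    then have tN: "t \<notin> N1" "- t \<notin> N2" by (auto simp: image_iff)
    have Gt: "G t = g t" using t(1) by (simp add: G_def)
    have diff: "integral {a..y} g - integral {a..x} g = integral {x..y} G" if "a \<le> x" "x \<le> y" "y \<le> b" for x y
    proof -
      have "integral {x..y} G = integral {x..y} g"
        by (rule integral_cong) (use that in \<open>auto simp: G_def\<close>)
      then show ?thesis using integral_subinterval_diff[OF g that] by simp
    qed
    show "((\<lambda>t. integral {a..t} g) has_vector_derivative g t) (at t within {a..b})"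
      unfolding has_vector_derivative_def has_derivative_within_alt
    proof (intro conjI allI impI)
      show "bounded_linear (\<lambda>x. x *\<^sub>R g t)" by (rule bounded_linear_scaleR_left)
      fix e :: real assume "e > 0"
      obtain d1 where d1: "d1 > 0" "\<And>h. 0 < h \<Longrightarrow> h < d1 \<Longrightarrow> norm (integral {t..t + h} G /\<^sub>R h - g t) < e"
        using N1(2)[OF tN(1) \<open>e > 0\<close>] Gt by auto
      obtain d2 where d2: "d2 > 0" "\<And>h. 0 < h \<Longrightarrow> h < d2 \<Longrightarrow> norm (integral {- t..- t + h} (\<lambda>t. G (- t)) /\<^sub>R h - g t) < e"
        using N2(2)[OF tN(2) \<open>e > 0\<close>] Gt by auto
      show "\<exists>d>0. \<forall>y\<in>{a..b}. norm (y - t) < d \<longrightarrow>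
          norm (integral {a..y} g - integral {a..t} g - (y - t) *\<^sub>R g t) \<le> e * norm (y - t)"
      proof (intro exI[of _ "min d1 d2"] conjI ballI impI)
        fix y assume y: "y \<in> {a..b}" "norm (y - t) < min d1 d2"
        consider "y = t" | "t < y" | "y < t" by linarith
        then show "norm (integral {a..y} g - integral {a..t} g - (y - t) *\<^sub>R g t) \<le> e * norm (y - t)"
        proof cases
          case 1
          then show ?thesis by simp
        next
          case 2
          then have "norm (integral {t..t + (y - t)} G - (y - t) *\<^sub>R g t) \<le> e * (y - t)"
            using y by (intro scaled d1) auto
          then show ?thesis using diff[of t y] 2 t y by simp
        next
          case 3
          have "integral {- t..- y} (\<lambda>t. G (- t)) = integral {y..t} G"
            by (rule Henstock_Kurzweil_Integration.integral_reflect_real)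
          moreover have "norm (integral {- t..- t + (t - y)} (\<lambda>t. G (- t)) - (t - y) *\<^sub>R g t) \<le> e * (t - y)"
            using y 3 by (intro scaled d2) auto
          ultimately have *: "norm (integral {y..t} G - (t - y) *\<^sub>R g t) \<le> e * (t - y)" by simp
          have "integral {a..y} g - integral {a..t} g - (y - t) *\<^sub>R g t = - (integral {y..t} G - (t - y) *\<^sub>R g t)"
            using diff[of y t] 3 t y by (simp add: algebra_simps)
          then show ?thesis using * 3 by (simp only: norm_minus_cancel) simp
        qed
      qed (use d1 d2 in simp)
    qed
  qed
qed

text \<open>\<open>deriv_on\<close> has an arbitrary value where no derivative exists. By Lebesgue
  differentiation it agrees off a null set with the density of \<open>u\<close>, and integrability
  and the integral formula pass to it from there.\<close>

lemma absolutely_continuous_FTC: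
  fixes u :: "real \<Rightarrow> 'a::euclidean_space"
  assumes u: "absolutely_continuous_on {0..T} u" and T: "0 < T"
  shows "deriv_on T u absolutely_integrable_on {0..T}"
    and "\<And>s t. 0 \<le> s \<Longrightarrow> s \<le> t \<Longrightarrow> t \<le> T \<Longrightarrow> (deriv_on T u has_integral (u t - u s)) {s..t}"
    and "AE t in lebesgue_on {0..T}. (u has_vector_derivative deriv_on T u t) (at t within {0..T})"
proof -
  obtain g where g: "g absolutely_integrable_on {0..T}" "\<And>t. t \<in> {0..T} \<Longrightarrow> (g has_integral (u t - u 0)) {0..t}"
    using absolutely_continuous_integral[OF u T] by metis
  have gi: "g integrable_on {0..T}" using g(1) set_lebesgue_integral_eq_integral(1) by blast
  obtain N where N: "negligible N" "\<And>t. t \<in> {0..T} \<Longrightarrow> t \<notin> N \<Longrightarrow>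
      ((\<lambda>t. integral {0..t} g) has_vector_derivative g t) (at t within {0..T})"
    using indefinite_integral_has_vector_derivative[OF gi] by metis
  have der: "(u has_vector_derivative g t) (at t within {0..T})" if "t \<in> {0..T}" "t \<notin> N" for t
  proof -
    have "((\<lambda>t. u 0 + integral {0..t} g) has_vector_derivative g t) (at t within {0..T})"
      using has_vector_derivative_add[OF has_vector_derivative_const N(2)[OF that], of "u 0"] by simp
    then show ?thesis
      by (rule has_vector_derivative_transform[OF that(1), rotated])
         (use g(2)[THEN integral_unique] in simp)
  qed
  have deriv: "deriv_on T u t = g t" if "t \<in> {0..T}" "t \<notin> N" for t
    unfolding deriv_on_def by (rule vector_derivative_within_closed_interval) (use that T der in auto)
  show "deriv_on T u absolutely_integrable_on {0..T}"
    by (rule absolutely_integrable_spike[OF g(1) N(1)]) (use deriv in auto)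
  show "AE t in lebesgue_on {0..T}. (u has_vector_derivative deriv_on T u t) (at t within {0..T})"
    by (rule AE_lebesgue_onI[OF N(1)]) (use der deriv in auto)
  fix s t assume st: "0 \<le> s" "s \<le> t" "t \<le> T"
  have "integral {s..t} g = u t - u s"
    using g(2)[of s, THEN integral_unique] g(2)[of t, THEN integral_unique] st
      integral_subinterval_diff[OF gi st] by simp
  moreover have "g integrable_on {s..t}" by (rule integrable_on_subinterval[OF gi]) (use st in auto)
  ultimately have "(g has_integral (u t - u s)) {s..t}" by (simp add: has_integral_integral)
  then show "(deriv_on T u has_integral (u t - u s)) {s..t}"
    by (rule has_integral_spike[OF N(1), rotated]) (use st deriv in auto)
qed

text \<open>Absolute continuity of the integral: \<open>h\<close> is at most \<open>n\<close> plus
  its excess over \<open>n\<close>. Dominated convergence makes the excess integrate to less than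
  \<open>e / 2\<close> for some \<open>n\<close>, and the bounded part contributes at most
  \<open>n\<close> times the length of the family.\<close>

lemma absolutely_continuous_on_integral_bound:
  fixes p :: "real \<Rightarrow> 'a::euclidean_space" and h :: "real \<Rightarrow> real"
  assumes h: "h integrable_on {x..y}" and nonneg: "\<And>t. t \<in> {x..y} \<Longrightarrow> 0 \<le> h t"
    and le: "\<And>s t. x \<le> s \<Longrightarrow> s \<le> t \<Longrightarrow> t \<le> y \<Longrightarrow> norm (p t - p s) \<le> integral {s..t} h"
  shows "absolutely_continuous_on {x..y} p"
  unfolding absolutely_continuous_on_vsum
proof (intro allI impI)
  fix e :: real assume "e > 0"
  define q where "q n t = max (h t - real n) 0" for n t
  have h_abs: "h absolutely_integrable_on {x..y}" using h nonneg by (rule nonnegative_absolutely_integrable_1)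
  have q_int: "q n integrable_on {x..y}" for n
  proof -
    have "(\<lambda>t. h t - real n) absolutely_integrable_on {x..y}"
      using h_abs by (intro set_integral_diff(1)) (auto simp: absolutely_integrable_on_const)
    then have "(\<lambda>t. max (h t - real n) 0) absolutely_integrable_on {x..y}"
      by (rule absolutely_integrable_max_1) simp
    then show ?thesis unfolding q_def by (rule set_lebesgue_integral_eq_integral(1))
  qed
  have "(\<lambda>n. integral {x..y} (q n)) \<longlonglongrightarrow> integral {x..y} (\<lambda>_. 0)"
  proof (rule dominated_convergence(2)[OF q_int h])
    show "norm (q n t) \<le> h t" if "t \<in> {x..y}" for n t using nonneg[OF that] by (auto simp: q_def)
    show "(\<lambda>n. q n t) \<longlonglongrightarrow> 0" if "t \<in> {x..y}" for t
    proof (rule tendsto_eventually)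
      obtain m :: nat where "h t < real m" using reals_Archimedean2 by blast
      then show "\<forall>\<^sub>F n in sequentially. q n t = 0"
        unfolding eventually_sequentially q_def by (intro exI[of _ m]) auto
    qed
  qed
  then have "(\<lambda>n. integral {x..y} (q n)) \<longlonglongrightarrow> 0" by simp
  then have "\<forall>\<^sub>F n in sequentially. integral {x..y} (q n) < e / 2"
    by (rule order_tendstoD) (use \<open>e > 0\<close> in simp)
  then obtain n where n: "integral {x..y} (q n) < e / 2" unfolding eventually_sequentially by blast
  define d where "d = e / (2 * (real n + 1))"
  have "d > 0" using \<open>e > 0\<close> by (simp add: d_def)
  have "vsum p D < e" if D: "interval_family {x..y} D" "vsum (\<lambda>x. x) D < d" for D
  proof -
    have "vsum p D \<le> (\<Sum>(a, b)\<in>D. integral {a..b} (q n) + real n * (b - a))"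
      unfolding vsum_def
    proof (rule sum_mono)
      fix r assume r: "r \<in> D"
      obtain a b where ab: "r = (a, b)" by force
      have r': "a \<le> b" "{a..b} \<subseteq> {x..y}" using interval_familyD(1,2)[OF D(1) r] ab by auto
      then have xy: "x \<le> a" "b \<le> y" by auto
      have sub: "q n integrable_on {a..b}" "h integrable_on {a..b}"
        using integrable_on_subinterval[OF _ r'(2)] q_int h by blast+
      have "norm (p b - p a) \<le> integral {a..b} h" using le xy r' by blast
      also have "\<dots> \<le> integral {a..b} (\<lambda>t. q n t + real n)"
        by (rule integral_le) (use sub in \<open>auto intro!: integrable_add[of "q n"]\<close>, simp add: q_def)
      also have "\<dots> = integral {a..b} (q n) + real n * (b - a)"
        using r' sub by (subst Henstock_Kurzweil_Integration.integral_add) auto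
      finally show "(case r of (a, b) \<Rightarrow> norm (p b - p a)) \<le> (case r of (a, b) \<Rightarrow> integral {a..b} (q n) + real n * (b - a))"
        by (simp add: ab)
    qed
    also have "\<dots> = (\<Sum>(a, b)\<in>D. integral {a..b} (q n)) + real n * vsum (\<lambda>x. x) D"
      by (simp add: vsum_ident[OF D(1)] sum.distrib sum_distrib_left split_beta)
    also have "(\<Sum>(a, b)\<in>D. integral {a..b} (q n)) \<le> integral {x..y} (q n)"
      by (rule sum_integral_interval_family_le[OF D(1) q_int]) (simp add: q_def)
    also have "real n * vsum (\<lambda>x. x) D \<le> real n * d" using D(2) by (intro mult_left_mono) auto
    also have "real n * d \<le> e / 2" using \<open>e > 0\<close> by (simp add: d_def field_simps)
    finally show ?thesis using n by simp
  qed
  then show "\<exists>d>0. \<forall>D. interval_family {x..y} D \<and> vsum (\<lambda>x. x) D < d \<longrightarrow> vsum p D < e"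
    using \<open>d > 0\<close> by blast
qed

section \<open>Gradients of convex functions\<close>

text \<open>The derivative is an inner product in finite dimension. As \<open>grad\<close> is a
  definite description, uniqueness of the representing vector has to be shown too.\<close>

lemma grad_has_derivative:
  fixes f :: "'a::euclidean_space \<Rightarrow> real"
  assumes "f differentiable (at x)"
  shows "(f has_derivative (\<lambda>h. grad f x \<bullet> h)) (at x)"
proof -
  obtain f' where f': "(f has_derivative f') (at x)" using assms unfolding differentiable_def by blast
  then have lin: "linear f'" by (rule has_derivative_linear)
  define D where "D = (\<Sum>i\<in>Basis. f' i *\<^sub>R i)"
  have "f' h = h \<bullet> D" for h
  proof -
    have "f' h = f' (\<Sum>i\<in>Basis. (h \<bullet> i) *\<^sub>R i)" by (simp add: euclidean_representation)
    also have "\<dots> = (\<Sum>i\<in>Basis. (h \<bullet> i) * f' i)" using lin by (simp add: linear_sum linear_cmul)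
    also have "\<dots> = h \<bullet> D" unfolding D_def by (simp add: inner_sum_right mult.commute)
    finally show ?thesis .
  qed
  then have "f' = (\<lambda>h. h \<bullet> D)" by blast
  then have D: "GDERIV f x :> D" using f' unfolding gderiv_def by simp
  have "grad f x = D"
    unfolding grad_def
  proof (rule the_equality, rule D)
    fix D' assume "GDERIV f x :> D'"
    then have "(\<lambda>h. h \<bullet> D') = (\<lambda>h. h \<bullet> D)"
      using D unfolding gderiv_def by (rule has_derivative_unique)
    then show "D' = D" by (metis inner_commute vector_eq_ldot)
  qed
  then show ?thesis using D unfolding gderiv_def by (simp add: inner_commute)
qed

lemma grad_quotient_tendsto:
  fixes f :: "'a::euclidean_space \<Rightarrow> real"
  assumes "f differentiable (at x)"
  shows "((\<lambda>l. (f (x + l *\<^sub>R v) - f x) / l) \<longlongrightarrow> grad f x \<bullet> v) (at_right 0)"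
proof -
  have l: "((\<lambda>l. x + l *\<^sub>R v) has_derivative (\<lambda>l. l *\<^sub>R v)) (at 0)"
    by (auto intro!: derivative_eq_intros)
  have "(f has_derivative (\<lambda>h. grad f x \<bullet> h)) (at (x + 0 *\<^sub>R v))"
    using grad_has_derivative[OF assms] by simp
  from diff_chain_at[OF l this]
  have "((\<lambda>l. f (x + l *\<^sub>R v)) has_derivative (\<lambda>l. grad f x \<bullet> (l *\<^sub>R v))) (at 0)"
    by (simp add: o_def)
  then have "((\<lambda>l. f (x + l *\<^sub>R v)) has_field_derivative (grad f x \<bullet> v)) (at 0)"
    by (simp add: has_field_derivative_def mult.commute[of _ "grad f x \<bullet> v"] mult_commute_abs)
  then have "(\<lambda>l. (f (x + l *\<^sub>R v) - f x) / l) \<midarrow>0\<rightarrow> grad f x \<bullet> v"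
    by (simp add: DERIV_def)
  then show ?thesis by (rule filterlim_mono) (auto simp: at_le)
qed

lemma convex_quotient_le:
  fixes f :: "'a::euclidean_space \<Rightarrow> real"
  assumes "convex_on UNIV f" "0 < l" "l \<le> 1"
  shows "(f (x + l *\<^sub>R v) - f x) / l \<le> f (x + v) - f x"
proof -
  have "f ((1 - l) *\<^sub>R x + l *\<^sub>R (x + v)) \<le> (1 - l) * f x + l * f (x + v)"
    using assms by (intro convex_onD) auto
  moreover have "(1 - l) *\<^sub>R x + l *\<^sub>R (x + v) = x + l *\<^sub>R v" by (simp add: algebra_simps)
  ultimately show ?thesis using assms(2) by (simp add: field_simps)
qed

lemma convex_subgradient:
  fixes f :: "'a::euclidean_space \<Rightarrow> real"
  assumes "convex_on UNIV f" "f differentiable (at x)"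
  shows "f x + grad f x \<bullet> v \<le> f (x + v)"
proof -
  have "grad f x \<bullet> v \<le> f (x + v) - f x"
  proof (rule tendsto_upperbound[OF grad_quotient_tendsto[OF assms(2)]])
    have "\<forall>\<^sub>F l in at_right 0. 0 < l \<and> l < (1::real)"
      using eventually_at_right_real[of 0 1] by simp
    then show "\<forall>\<^sub>F l in at_right 0. (f (x + l *\<^sub>R v) - f x) / l \<le> f (x + v) - f x"
      by eventually_elim (rule convex_quotient_le[OF assms(1)]; simp)
  qed simp
  then show ?thesis by simp
qed

text \<open>The right side is free of \<open>l\<close>, so it dominates the difference quotients of
  the kinetic term under the integral. The upper half is monotonicity of slopes, the lower half the
  subgradient inequality used twice, for \<open>l *\<^sub>R v\<close> and for
  \<open>- v\<close>.\<close>

lemma convex_quotient_abs_le: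
  fixes f :: "'a::euclidean_space \<Rightarrow> real"
  assumes f: "convex_on UNIV f" "f differentiable (at x)" and l: "0 < l" "l \<le> 1"
    and nonneg: "\<And>x. 0 \<le> f x"
  shows "\<bar>(f (x + l *\<^sub>R v) - f x) / l\<bar> \<le> f (x + v) + f (x - v) + f x"
proof -
  have "grad f x \<bullet> (l *\<^sub>R v) \<le> f (x + l *\<^sub>R v) - f x"
    using convex_subgradient[OF f, of "l *\<^sub>R v"] by simp
  then have "grad f x \<bullet> v \<le> (f (x + l *\<^sub>R v) - f x) / l"
    using l(1) by (simp add: field_simps)
  moreover have "f x - f (x - v) \<le> grad f x \<bullet> v"
    using convex_subgradient[OF f, of "- v"] by simp
  ultimately show ?thesis
    using convex_quotient_le[OF f(1) l, of x v] nonneg[of x] nonneg[of "x + v"] nonneg[of "x - v"]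
    by linarith
qed

lemma borel_measurable_grad:
  fixes f :: "'a::euclidean_space \<Rightarrow> real" and g :: "'b \<Rightarrow> 'a"
  assumes f: "\<And>x. f differentiable (at x)" and g: "g \<in> borel_measurable M"
  shows "(\<lambda>t. grad f (g t)) \<in> borel_measurable M"
proof (subst borel_measurable_euclidean_space, rule ballI)
  fix i :: 'a assume "i \<in> Basis"
  have cont: "continuous_on UNIV f"
    using f by (simp add: continuous_on_eq_continuous_at differentiable_imp_continuous_within)
  define s where "s n = inverse (real (Suc n))" for n
  have s: "filterlim s (at_right 0) sequentially"
    unfolding filterlim_at s_def using LIMSEQ_inverse_real_of_nat by auto
  show "(\<lambda>t. grad f (g t) \<bullet> i) \<in> borel_measurable M"
  proof (rule borel_measurable_LIMSEQ_real)
    show "(\<lambda>n. (f (g t + s n *\<^sub>R i) - f (g t)) / s n) \<longlonglongrightarrow> grad f (g t) \<bullet> i" for t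
      by (rule filterlim_compose[OF grad_quotient_tendsto[OF f] s])
    show "(\<lambda>t. (f (g t + s n *\<^sub>R i) - f (g t)) / s n) \<in> borel_measurable M" for n
      using g borel_measurable_continuous_onI[OF cont] by measurable
  qed
qed

text \<open>A minimiser of \<open>f x - \<xi> \<bullet> x\<close> has gradient \<xi>. It exists
  because superlinearity with slope \<open>norm \<xi> + 1\<close> lets this function grow at least
  like \<open>norm x\<close>.\<close>

lemma grad_surj:
  fixes f :: "'a::euclidean_space \<Rightarrow> real"
  assumes f: "\<And>x. f differentiable (at x)" and superlinear: "\<And>K. \<exists>M. \<forall>x. K * norm x - M \<le> f x"
  shows "\<exists>x. grad f x = \<xi>"
proof -
  have cont: "continuous_on UNIV f"
    using f by (simp add: continuous_on_eq_continuous_at differentiable_imp_continuous_within)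
  obtain M where M: "\<And>x. (norm \<xi> + 1) * norm x - M \<le> f x" using superlinear by blast
  let ?g = "\<lambda>x. f x - \<xi> \<bullet> x"
  have lower: "norm x - M \<le> ?g x" for x
  proof -
    have "\<xi> \<bullet> x \<le> norm \<xi> * norm x" by (rule norm_cauchy_schwarz)
    then show ?thesis using M[of x] by (simp add: algebra_simps)
  qed
  \<comment> \<open>Beyond this radius the lower bound \<open>norm x - M\<close> already exceeds
    \<open>f 0\<close>, the value of the function at the origin.\<close>
  define R where "R = \<bar>M + f 0\<bar>"
  have "continuous_on (cball 0 R) ?g" by (intro continuous_intros continuous_on_subset[OF cont]) auto
  moreover have "cball (0::'a) R \<noteq> {}" by (simp add: R_def)
  ultimately obtain x where x: "x \<in> cball 0 R" "\<And>y. y \<in> cball 0 R \<Longrightarrow> ?g x \<le> ?g y"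
    using continuous_attains_inf[of "cball 0 R" ?g] compact_cball by blast
  have min: "?g x \<le> ?g y" for y
  proof (cases "y \<in> cball 0 R")
    case False
    have "?g x \<le> ?g 0" by (rule x(2)) (simp add: R_def)
    also have "\<dots> \<le> norm y - M" using False by (simp add: R_def)
    finally show ?thesis using lower[of y] by simp
  qed (rule x(2))
  have "\<xi> \<bullet> v \<le> grad f x \<bullet> v" for v
  proof (rule tendsto_lowerbound[OF grad_quotient_tendsto[OF f]])
    have "\<forall>\<^sub>F l in at_right 0. 0 < l \<and> l < (1::real)"
      using eventually_at_right_real[of 0 1] by simp
    then show "\<forall>\<^sub>F l in at_right 0. \<xi> \<bullet> v \<le> (f (x + l *\<^sub>R v) - f x) / l"
    proof eventually_elim
      case (elim l)
      then show ?case using min[of "x + l *\<^sub>R v"] by (simp add: field_simps inner_add_right)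
    qed
  qed simp
  from this[of "\<xi> - grad f x"] have "(\<xi> - grad f x) \<bullet> (\<xi> - grad f x) \<le> 0" by (simp add: inner_diff_left)
  then have "\<xi> - grad f x = 0" by (metis inner_eq_zero_iff inner_ge_zero order_antisym)
  then show ?thesis by (intro exI[of _ x]) simp
qed

section \<open>The direct method\<close>

text \<open>The hypotheses in the form used by the variational argument, at every time instead of
  almost every time; this is reached by changing \<open>F\<close> on a null set.
  \<open>F_local\<close> is what the bound on the Clarke gradient becomes,
  \<open>superlinear\<close> the growth of an N-function in affine form, and \<open>C2\<close> the
  constant of the \<Delta>2-condition.\<close>

locale periodic_action =
  fixes T :: real
    and \<phi> :: "'a::euclidean_space \<Rightarrow> real"
    and F :: "real \<Rightarrow> 'a \<Rightarrow> real"
    and b b1 :: "real \<Rightarrow> real"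
    and C2 :: real
  assumes T: "0 < T"
    and convex: "convex_on UNIV \<phi>"
    and diff: "\<And>x. \<phi> differentiable (at x)"
    and phi_nonneg: "\<And>x. 0 \<le> \<phi> x"
    and phi_0: "\<phi> 0 = 0"
    and Delta2: "0 < C2" "\<And>x. \<phi> (2 *\<^sub>R x) \<le> C2 * \<phi> x + 1"
    and superlinear: "\<And>K. \<exists>M. \<forall>x. K * norm x - M \<le> \<phi> x"
    and F_meas: "\<And>x. (\<lambda>t. F t x) \<in> borel_measurable (lebesgue_on {0..T})"
    and b_int: "b absolutely_integrable_on {0..T}"
    and b_nonneg: "\<And>t. t \<in> {0..T} \<Longrightarrow> 0 \<le> b t"
    and F_local: "\<And>R. \<exists>C\<ge>0. \<forall>t\<in>{0..T}. (\<forall>x\<in>ball 0 R. \<bar>F t x\<bar> \<le> C * b t) \<and>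
           (\<forall>x\<in>ball 0 R. \<forall>y\<in>ball 0 R. \<bar>F t x - F t y\<bar> \<le> C * b t * norm (x - y))"
    and b1_int: "b1 absolutely_integrable_on {0..T}"
    and F_BO: "\<And>t x y. t \<in> {0..T} \<Longrightarrow> \<bar>F t x - F t y\<bar> \<le> b1 t * (1 + norm (x - y))"
    and F_coercive: "filterlim (\<lambda>x. LINT t|lebesgue_on {0..T}. F t x) at_top at_infinity"
begin

lemma sets_Icc [simp, intro]: "{0..T} \<in> sets lebesgue" by simp

lemma phi_continuous: "continuous_on S \<phi>"
  using diff by (meson continuous_on_subset subset_UNIV continuous_on_eq_continuous_at open_UNIV differentiable_imp_continuous_within)

lemma phi_measurable [measurable]: "\<phi> \<in> borel_measurable borel"
  by (rule borel_measurable_continuous_onI[OF phi_continuous])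

section \<open>Growth of \<phi>, and measurability and integrability of the integrands\<close>

lemma phi_scale_le:
  assumes "0 \<le> s" "s \<le> 1"
  shows "\<phi> (s *\<^sub>R x) \<le> s * \<phi> x"
  using convex_onD[OF convex, of s 0 x] assms phi_0 by simp

text \<open>Convexity at the midpoint of \<open>2 *\<^sub>R x\<close> and
  \<open>2 *\<^sub>R y\<close>. The \<Delta>2-condition is spent on \<open>x\<close> alone, because
  \<open>y\<close> will be a bounded perturbation.\<close>

lemma phi_add_le: "\<phi> (x + y) \<le> C2 * \<phi> x + 1 + \<phi> (2 *\<^sub>R y)"
proof -
  have "\<phi> ((1 - 1/2) *\<^sub>R (2 *\<^sub>R x) + (1/2) *\<^sub>R (2 *\<^sub>R y)) \<le> (1 - 1/2) * \<phi> (2 *\<^sub>R x) + (1/2) * \<phi> (2 *\<^sub>R y)"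
    by (rule convex_onD[OF convex]) auto
  then have "\<phi> (x + y) \<le> \<phi> (2 *\<^sub>R x) / 2 + \<phi> (2 *\<^sub>R y) / 2" by simp
  also have "\<dots> \<le> \<phi> (2 *\<^sub>R x) + \<phi> (2 *\<^sub>R y)" using phi_nonneg[of "2 *\<^sub>R x"] phi_nonneg[of "2 *\<^sub>R y"] by simp
  finally show ?thesis using Delta2(2)[of x] by simp
qed

lemma phi_pow_le: "\<exists>A B. 0 \<le> A \<and> 0 \<le> B \<and> (\<forall>x. \<phi> (2 ^ n *\<^sub>R x) \<le> A * \<phi> x + B)"
proof (induction n)
  case 0
  show ?case by (rule exI[of _ 1], rule exI[of _ 0]) simp
next
  case (Suc n)
  then obtain A B where AB: "0 \<le> A" "0 \<le> B" "\<And>x. \<phi> (2 ^ n *\<^sub>R x) \<le> A * \<phi> x + B" by blast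
  have "\<phi> (2 ^ Suc n *\<^sub>R x) \<le> (C2 * A) * \<phi> x + (C2 * B + 1)" for x
  proof -
    have "\<phi> (2 ^ Suc n *\<^sub>R x) = \<phi> (2 *\<^sub>R (2 ^ n *\<^sub>R x))" by simp
    also have "\<dots> \<le> C2 * \<phi> (2 ^ n *\<^sub>R x) + 1" by (rule Delta2(2))
    also have "\<dots> \<le> C2 * (A * \<phi> x + B) + 1" using AB(3)[of x] Delta2(1) by (simp add: mult_left_mono)
    finally show ?thesis by (simp add: algebra_simps)
  qed
  then show ?case using AB Delta2(1) by (intro exI[of _ "C2 * A"] exI[of _ "C2 * B + 1"]) auto
qed

lemma absolutely_integrableI_bounded:
  fixes f :: "real \<Rightarrow> 'c::euclidean_space"
  assumes "f \<in> borel_measurable (lebesgue_on {0..T})" "g absolutely_integrable_on {0..T}"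
    "\<And>t. t \<in> {0..T} \<Longrightarrow> norm (f t) \<le> g t"
  shows "f absolutely_integrable_on {0..T}"
  using assms set_lebesgue_integral_eq_integral(1)
  by (blast intro: measurable_bounded_by_integrable_imp_absolutely_integrable)

lemma LINT_eq:
  fixes f :: "real \<Rightarrow> 'c::euclidean_space"
  assumes "f absolutely_integrable_on {0..T}"
  shows "(LINT t|lebesgue_on {0..T}. f t) = integral {0..T} f"
  by (rule lebesgue_integral_eq_integral[OF absolutely_integrable_imp_integrable[OF assms]]) auto

lemma integrable_on_Icc:
  fixes f :: "real \<Rightarrow> 'c::euclidean_space"
  assumes "f absolutely_integrable_on {0..T}" "0 \<le> s" "t \<le> T"
  shows "f absolutely_integrable_on {s..t}" "f integrable_on {s..t}"
proof -
  show "f absolutely_integrable_on {s..t}"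
    by (rule absolutely_integrable_on_subinterval[OF assms(1)]) (use assms in auto)
  then show "f integrable_on {s..t}" by (rule set_lebesgue_integral_eq_integral(1))
qed

lemma nn_integral_eq:
  fixes f :: "real \<Rightarrow> real"
  assumes "f absolutely_integrable_on {s..t}" "\<And>x. 0 \<le> f x"
  shows "(\<integral>\<^sup>+x. ennreal (f x) \<partial>lebesgue_on {s..t}) = ennreal (integral {s..t} f)"
proof -
  have int: "integrable (lebesgue_on {s..t}) f"
    by (rule absolutely_integrable_imp_integrable[OF assms(1)]) simp
  have "(\<integral>\<^sup>+x. ennreal (f x) \<partial>lebesgue_on {s..t}) = ennreal (integral\<^sup>L (lebesgue_on {s..t}) f)"
    by (rule nn_integral_eq_integral[OF int]) (use assms(2) in simp)
  then show ?thesis using lebesgue_integral_eq_integral[OF int] by simp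
qed

lemma absolutely_integrable_nn_integral:
  fixes f :: "real \<Rightarrow> real"
  assumes "f \<in> borel_measurable (lebesgue_on {0..T})" "\<And>x. 0 \<le> f x"
    "(\<integral>\<^sup>+x. ennreal (f x) \<partial>lebesgue_on {0..T}) < \<infinity>"
  shows "f absolutely_integrable_on {0..T}"
proof (subst absolutely_integrable_measurable_real)
  have "integrable (lebesgue_on {0..T}) f"
    by (rule integrableI_nonneg) (use assms in auto)
  then show "f \<in> borel_measurable (lebesgue_on {0..T}) \<and> integrable (lebesgue_on {0..T}) (\<lambda>x. \<bar>f x\<bar>)"
    using assms(1) by simp
qed simp

abbreviation "D \<equiv> deriv_on T"

lemma deriv_measurable:
  assumes "absolutely_continuous_on {0..T} u"
  shows "D u \<in> borel_measurable (lebesgue_on {0..T})"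
  by (rule absolutely_integrable_imp_borel_measurable[OF absolutely_continuous_FTC(1)[OF assms T]]) simp

text \<open>Membership in the Orlicz space controls \<phi> only at some multiple \<open>l\<close> of
  the derivative. Iterating the \<Delta>2-condition until the power of 2 exceeds
  \<open>1 / l\<close> recovers the derivative itself, at the price of an additive constant that is
  harmless on a bounded interval.\<close>

lemma W1_iff:
  "u \<in> W1_orlicz T \<phi> \<longleftrightarrow> absolutely_continuous_on {0..T} u \<and> (\<lambda>t. \<phi> (D u t)) absolutely_integrable_on {0..T}"
proof
  assume u: "u \<in> W1_orlicz T \<phi>"
  then have ac: "absolutely_continuous_on {0..T} u" by (simp add: W1_orlicz_def)
  obtain l where l: "l > 0" "(\<integral>\<^sup>+ t. ennreal (\<phi> (l *\<^sub>R D u t)) \<partial>lebesgue_on {0..T}) < \<infinity>"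
    using u by (auto simp: W1_orlicz_def orlicz_space_def)
  note [measurable] = deriv_measurable[OF ac]
  have int: "(\<lambda>t. \<phi> (l *\<^sub>R D u t)) absolutely_integrable_on {0..T}"
    by (rule absolutely_integrable_nn_integral) (use l phi_nonneg in auto)
  obtain n :: nat where n: "1 / l < 2 ^ n" using real_arch_pow[of 2] by auto
  obtain A B where AB: "0 \<le> A" "0 \<le> B" "\<And>x. \<phi> (2 ^ n *\<^sub>R x) \<le> A * \<phi> x + B" using phi_pow_le by blast
  have le: "\<phi> (D u t) \<le> A * \<phi> (l *\<^sub>R D u t) + B" for t
  proof -
    have "1 \<le> 2 ^ n * l" using n l(1) by (simp add: field_simps)
    then have s: "0 \<le> 1 / (2 ^ n * l)" "1 / (2 ^ n * l) \<le> 1" by auto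
    have "\<phi> (D u t) = \<phi> ((1 / (2 ^ n * l)) *\<^sub>R (2 ^ n *\<^sub>R (l *\<^sub>R D u t)))" using l(1) by simp
    also have "\<dots> \<le> 1 / (2 ^ n * l) * \<phi> (2 ^ n *\<^sub>R (l *\<^sub>R D u t))" by (rule phi_scale_le[OF s])
    also have "\<dots> \<le> 1 * \<phi> (2 ^ n *\<^sub>R (l *\<^sub>R D u t))" by (rule mult_right_mono[OF s(2) phi_nonneg])
    finally show ?thesis using AB(3)[of "l *\<^sub>R D u t"] by simp
  qed
  have "(\<lambda>t. \<phi> (D u t)) absolutely_integrable_on {0..T}"
  proof (rule absolutely_integrableI_bounded)
    show "(\<lambda>t. A * \<phi> (l *\<^sub>R D u t) + B) absolutely_integrable_on {0..T}"
      using int by (intro set_integral_add(1) set_integrable_mult_right) (auto simp: absolutely_integrable_on_const)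
  qed (use le phi_nonneg in auto)
  with ac show "absolutely_continuous_on {0..T} u \<and> (\<lambda>t. \<phi> (D u t)) absolutely_integrable_on {0..T}" by blast
next
  assume u: "absolutely_continuous_on {0..T} u \<and> (\<lambda>t. \<phi> (D u t)) absolutely_integrable_on {0..T}"
  then have "(\<integral>\<^sup>+ t. ennreal (\<phi> (1 *\<^sub>R D u t)) \<partial>lebesgue_on {0..T}) < \<infinity>"
    using nn_integral_eq[where f = "\<lambda>t. \<phi> (D u t)" and s = 0 and t = T] phi_nonneg by simp
  then show "u \<in> W1_orlicz T \<phi>"
    using u deriv_measurable unfolding W1_orlicz_def orlicz_space_def by (auto intro: exI[of _ 1])
qed

lemma F_continuous:
  assumes "t \<in> {0..T}"
  shows "continuous_on UNIV (F t)"
proof -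
  have "continuous (at x) (F t)" for x
  proof -
    obtain C where C: "0 \<le> C" "\<And>y z. y \<in> ball 0 (norm x + 1) \<Longrightarrow> z \<in> ball 0 (norm x + 1) \<Longrightarrow>
        \<bar>F t y - F t z\<bar> \<le> C * b t * norm (y - z)"
      using F_local[of "norm x + 1"] assms by metis
    have "(C * b t)-lipschitz_on (ball 0 (norm x + 1)) (F t)"
      using C b_nonneg[OF assms] by (intro lipschitz_onI) (auto simp: dist_norm)
    then have "continuous_on (ball 0 (norm x + 1)) (F t)" by (rule lipschitz_on_continuous_on)
    then show ?thesis by (simp add: continuous_on_eq_continuous_at)
  qed
  then show ?thesis by (simp add: continuous_at_imp_continuous_on)
qed

text \<open>The Caratheodory argument: \<open>p n t\<close> rounds \<open>t\<close> down to a grid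
  of mesh \<open>1 / Suc n\<close>, so \<open>w (p n t)\<close> takes countably many values and only
  measurability of \<open>F\<close> at fixed points is needed. Continuity of \<open>w\<close> and of
  \<open>F t\<close> then gives the limit. Rounding down keeps the grid points of
  \<open>{0..T}\<close> inside it.\<close>

lemma F_comp_measurable:
  assumes w: "continuous_on {0..T} w"
  shows "(\<lambda>t. F t (w t)) \<in> borel_measurable (lebesgue_on {0..T})"
proof -
  define p where "p n t = real_of_int \<lfloor>real (Suc n) * t\<rfloor> / real (Suc n)" for n t
  have p_le: "p n t \<le> t" "t - 1 / real (Suc n) \<le> p n t" for n t
  proof -
    show "p n t \<le> t" unfolding p_def by (simp add: divide_le_eq mult.commute)
    have "real (Suc n) * t - 1 \<le> real_of_int \<lfloor>real (Suc n) * t\<rfloor>" by linarith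
    then have "(real (Suc n) * t - 1) / real (Suc n) \<le> p n t" unfolding p_def by (rule divide_right_mono) simp
    then show "t - 1 / real (Suc n) \<le> p n t" by (simp add: diff_divide_distrib)
  qed
  have p_in: "p n t \<in> {0..T}" if "t \<in> {0..T}" for n t
    using that p_le(1)[of n t] by (auto simp: p_def)
  have p_lim: "(\<lambda>n. p n t) \<longlonglongrightarrow> t" for t
  proof (rule tendsto_sandwich[where f = "\<lambda>n. t - 1 / real (Suc n)" and h = "\<lambda>n. t"])
    show "(\<lambda>n. t - 1 / real (Suc n)) \<longlonglongrightarrow> t"
      using tendsto_diff[OF tendsto_const[of t] LIMSEQ_inverse_real_of_nat] by (simp add: inverse_eq_divide)
  qed (use p_le in auto)
  show ?thesis
  proof (rule borel_measurable_LIMSEQ_real)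
    show "(\<lambda>n. F t (w (p n t))) \<longlonglongrightarrow> F t (w t)" if "t \<in> space (lebesgue_on {0..T})" for t
    proof -
      have t: "t \<in> {0..T}" using that by simp
      have "(\<lambda>n. w (p n t)) \<longlonglongrightarrow> w t"
        using continuous_on_tendsto_compose[OF w p_lim t] p_in[OF t] by simp
      then show ?thesis
        using continuous_on_tendsto_compose[OF F_continuous[OF t], of "\<lambda>n. w (p n t)" "w t"] by simp
    qed
    show "(\<lambda>t. F t (w (p n t))) \<in> borel_measurable (lebesgue_on {0..T})" for n
      unfolding p_def
    proof (rule measurable_compose_countable[where g = "\<lambda>t. \<lfloor>real (Suc n) * t\<rfloor>"
          and f = "\<lambda>i t. F t (w (real_of_int i / real (Suc n)))"])
      have "(\<lambda>t. real (Suc n) * t) \<in> borel_measurable (lebesgue_on {0..T})"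
        by (rule continuous_imp_measurable_on_sets_lebesgue) (auto intro!: continuous_intros)
      then show "(\<lambda>t. \<lfloor>real (Suc n) * t\<rfloor>) \<in> measurable (lebesgue_on {0..T}) (count_space UNIV)"
        by (rule measurable_compose) (rule measurable_real_floor)
    qed (rule F_meas)
  qed
qed

lemma F_comp_integrable:
  assumes w: "continuous_on {0..T} w"
  shows "(\<lambda>t. F t (w t)) absolutely_integrable_on {0..T}"
proof -
  obtain R where R: "\<And>t. t \<in> {0..T} \<Longrightarrow> w t \<in> ball 0 R"
  proof -
    have "bounded (w ` {0..T})" by (rule compact_imp_bounded[OF compact_continuous_image[OF w]]) simp
    then obtain r where "w ` {0..T} \<subseteq> ball 0 r" using bounded_subset_ballD by blast
    then show thesis by (intro that[of r]) blast
  qed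
  obtain C where C: "\<And>t x. t \<in> {0..T} \<Longrightarrow> x \<in> ball 0 R \<Longrightarrow> \<bar>F t x\<bar> \<le> C * b t"
    using F_local[of R] by metis
  show ?thesis
    by (rule absolutely_integrableI_bounded[OF F_comp_measurable[OF w]
          set_integrable_mult_right[where a = C, OF b_int]]) (use C R in auto)
qed

lemma action_eq:
  assumes "u \<in> W1_orlicz T \<phi>"
  shows "action T \<phi> F u = integral {0..T} (\<lambda>t. \<phi> (D u t)) + integral {0..T} (\<lambda>t. F t (u t))"
  using assms unfolding action_def W1_iff
  by (simp add: LINT_eq F_comp_integrable absolutely_continuous_on_imp_continuous_on)

section \<open>Energy estimates and coercivity\<close>

lemma superlinearE:
  obtains M where "0 \<le> M" "\<And>x. K * norm x \<le> \<phi> x + M"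
proof -
  obtain M where M: "\<And>x. K * norm x - M \<le> \<phi> x" using superlinear by blast
  show thesis
  proof
    show "0 \<le> M" using M[of 0] phi_0 by simp
    show "K * norm x \<le> \<phi> x + M" for x using M[of x] by simp
  qed
qed

lemma W1_D:
  assumes "u \<in> W1_orlicz T \<phi>"
  shows "absolutely_continuous_on {0..T} u" "continuous_on {0..T} u"
    "(\<lambda>t. \<phi> (D u t)) absolutely_integrable_on {0..T}"
    "\<And>s t. 0 \<le> s \<Longrightarrow> s \<le> t \<Longrightarrow> t \<le> T \<Longrightarrow> (D u has_integral (u t - u s)) {s..t}"
    "\<And>s t. 0 \<le> s \<Longrightarrow> s \<le> t \<Longrightarrow> t \<le> T \<Longrightarrow> (\<lambda>t. \<phi> (D u t)) integrable_on {s..t}"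
proof -
  show u: "absolutely_continuous_on {0..T} u" "(\<lambda>t. \<phi> (D u t)) absolutely_integrable_on {0..T}"
    using assms by (auto simp: W1_iff)
  show "continuous_on {0..T} u" by (rule absolutely_continuous_on_imp_continuous_on[OF u(1)])
  show "(D u has_integral (u t - u s)) {s..t}" if "0 \<le> s" "s \<le> t" "t \<le> T" for s t
    by (rule absolutely_continuous_FTC(2)[OF u(1) T that])
  show "(\<lambda>t. \<phi> (D u t)) integrable_on {s..t}" if "0 \<le> s" "s \<le> t" "t \<le> T" for s t
    by (rule integrable_on_Icc(2)[OF u(2)]) (use that in auto)
qed

text \<open>Integrate the supporting affine function of \<phi> at the mean slope \<xi>; its linear
  part vanishes in the mean.\<close>

lemma jensen:
  assumes u: "u \<in> W1_orlicz T \<phi>" and st: "0 \<le> s" "s < t" "t \<le> T"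
  shows "(t - s) * \<phi> ((u t - u s) /\<^sub>R (t - s)) \<le> integral {s..t} (\<lambda>r. \<phi> (D u r))"
proof -
  define \<xi> where "\<xi> = (u t - u s) /\<^sub>R (t - s)"
  have du: "(D u has_integral (u t - u s)) {s..t}" using W1_D(4)[OF u] st by simp
  have "((\<lambda>r. \<phi> \<xi> - grad \<phi> \<xi> \<bullet> \<xi>) has_integral (t - s) *\<^sub>R (\<phi> \<xi> - grad \<phi> \<xi> \<bullet> \<xi>)) {s..t}"
    using has_integral_const_real[of "\<phi> \<xi> - grad \<phi> \<xi> \<bullet> \<xi>" s t] st by simp
  moreover have "((\<lambda>r. grad \<phi> \<xi> \<bullet> D u r) has_integral (grad \<phi> \<xi> \<bullet> (u t - u s))) {s..t}"
    using has_integral_linear[OF du bounded_linear_inner_right[of "grad \<phi> \<xi>"]] by (simp add: o_def)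
  ultimately have "((\<lambda>r. \<phi> \<xi> - grad \<phi> \<xi> \<bullet> \<xi> + grad \<phi> \<xi> \<bullet> D u r) has_integral
      ((t - s) *\<^sub>R (\<phi> \<xi> - grad \<phi> \<xi> \<bullet> \<xi>) + grad \<phi> \<xi> \<bullet> (u t - u s))) {s..t}"
    by (rule has_integral_add)
  moreover have "(t - s) *\<^sub>R (\<phi> \<xi> - grad \<phi> \<xi> \<bullet> \<xi>) + grad \<phi> \<xi> \<bullet> (u t - u s) = (t - s) * \<phi> \<xi>"
  proof -
    have "u t - u s = (t - s) *\<^sub>R \<xi>" using st by (simp add: \<xi>_def)
    then have "grad \<phi> \<xi> \<bullet> (u t - u s) = (t - s) * (grad \<phi> \<xi> \<bullet> \<xi>)" by simp
    then show ?thesis by (simp add: right_diff_distrib)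
  qed
  ultimately have "((\<lambda>r. \<phi> \<xi> - grad \<phi> \<xi> \<bullet> \<xi> + grad \<phi> \<xi> \<bullet> D u r) has_integral ((t - s) * \<phi> \<xi>)) {s..t}"
    by simp
  moreover have "((\<lambda>r. \<phi> (D u r)) has_integral integral {s..t} (\<lambda>r. \<phi> (D u r))) {s..t}"
    by (rule integrable_integral, rule W1_D(5)[OF u]) (use st in auto)
  ultimately have "(t - s) * \<phi> \<xi> \<le> integral {s..t} (\<lambda>r. \<phi> (D u r))"
  proof (rule has_integral_le)
    fix r
    show "\<phi> \<xi> - grad \<phi> \<xi> \<bullet> \<xi> + grad \<phi> \<xi> \<bullet> D u r \<le> \<phi> (D u r)"
      using convex_subgradient[OF convex diff, of \<xi> "D u r - \<xi>"] by (simp add: inner_diff_right)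
  qed
  then show ?thesis by (simp add: \<xi>_def)
qed

text \<open>The quantitative form of uniform integrability. The energy on the right need not become
  small with \<open>t - s\<close>; one takes \<open>K\<close> large against the energy first, and
  \<open>t - s\<close> small against \<open>M\<close> afterwards.\<close>

lemma modulus:
  assumes u: "u \<in> W1_orlicz T \<phi>" and st: "0 \<le> s" "s \<le> t" "t \<le> T"
    and K: "0 < K" "\<And>x. K * norm x \<le> \<phi> x + M"
  shows "K * norm (u t - u s) \<le> integral {s..t} (\<lambda>r. \<phi> (D u r)) + M * (t - s)"
proof -
  have du: "(D u has_integral (u t - u s)) {s..t}" using W1_D(4)[OF u] st by simp
  have int: "(\<lambda>r. (\<phi> (D u r) + M) / K) integrable_on {s..t}"
    using W1_D(5)[OF u st] by (intro integrable_on_divide integrable_add) auto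
  have "norm (integral {s..t} (D u)) \<le> integral {s..t} (\<lambda>r. (\<phi> (D u r) + M) / K)"
  proof (rule integral_norm_bound_integral)
    show "norm (D u r) \<le> (\<phi> (D u r) + M) / K" for r using K(2)[of "D u r"] K(1) by (simp add: field_simps)
  qed (use du int in auto)
  also have "\<dots> = integral {s..t} (\<lambda>r. \<phi> (D u r) + M) / K" by simp
  also have "integral {s..t} (\<lambda>r. \<phi> (D u r) + M) = integral {s..t} (\<lambda>r. \<phi> (D u r)) + M * (t - s)"
    using W1_D(5)[OF u st] st by (subst Henstock_Kurzweil_Integration.integral_add) auto
  finally show ?thesis using K(1) integral_unique[OF du] by (simp add: field_simps)
qed

lemma b1_nonneg: "t \<in> {0..T} \<Longrightarrow> 0 \<le> b1 t"
  using F_BO[of t 0 0] by simp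

lemma energy_mono:
  assumes u: "u \<in> W1_orlicz T \<phi>" and st: "0 \<le> s" "s \<le> t" "t \<le> T"
  shows "integral {s..t} (\<lambda>r. \<phi> (D u r)) \<le> integral {0..T} (\<lambda>r. \<phi> (D u r))"
  by (rule integral_subset_le) (use st W1_D(5)[OF u] T phi_nonneg in auto)

lemma coercive: "\<exists>A. \<forall>u\<in>W1_orlicz T \<phi>. action T \<phi> F u \<le> c \<longrightarrow>
    norm (u 0) \<le> A \<and> integral {0..T} (\<lambda>t. \<phi> (D u t)) \<le> A"
proof -
  let ?\<Phi> = "\<lambda>x. integral {0..T} (\<lambda>t. F t x)"
  have F_const: "(\<lambda>t. F t x) absolutely_integrable_on {0..T}" for x
    using F_comp_integrable[of "\<lambda>_. x"] by simp
  have \<Phi>: "filterlim ?\<Phi> at_top at_infinity"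
    using F_coercive by (simp add: LINT_eq[OF F_const])
  have big: "\<exists>R>0. \<forall>x. R \<le> norm x \<longrightarrow> Z \<le> ?\<Phi> x" for Z
  proof -
    have "\<forall>\<^sub>F x in at_infinity. Z \<le> ?\<Phi> x" using \<Phi> by (simp add: filterlim_at_top)
    then obtain R where R: "\<And>x. R \<le> norm x \<Longrightarrow> Z \<le> ?\<Phi> x" unfolding eventually_at_infinity by blast
    show ?thesis by (rule exI[of _ "max R 1"]) (use R in auto)
  qed
  obtain \<Phi>0 where \<Phi>0: "\<And>x. - \<Phi>0 \<le> ?\<Phi> x"
  proof -
    obtain R where R: "R > 0" "\<And>x. R \<le> norm x \<Longrightarrow> 0 \<le> ?\<Phi> x" using big[of 0] by blast
    obtain C where C: "0 \<le> C" "\<And>t x. t \<in> {0..T} \<Longrightarrow> x \<in> ball 0 R \<Longrightarrow> \<bar>F t x\<bar> \<le> C * b t"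
      using F_local[of R] by metis
    have Cb: "(\<lambda>t. C * b t) integrable_on {0..T}"
      by (rule set_lebesgue_integral_eq_integral(1)[OF set_integrable_mult_right[OF b_int]])
    have "- integral {0..T} (\<lambda>t. C * b t) \<le> ?\<Phi> x" for x
    proof (cases "R \<le> norm x")
      case True
      have "0 \<le> integral {0..T} (\<lambda>t. C * b t)" using C(1) b_nonneg by (intro integral_nonneg[OF Cb]) auto
      then show ?thesis using R(2)[OF True] by linarith
    next
      case False
      have "norm (?\<Phi> x) \<le> integral {0..T} (\<lambda>t. C * b t)"
        by (rule integral_norm_bound_integral[OF set_lebesgue_integral_eq_integral(1)[OF F_const] Cb])
           (use C(2) False in auto)
      then show ?thesis by simp
    qed
    then show thesis by (rule that)
  qed
  define \<beta> where "\<beta> = integral {0..T} b1"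
  have b1i: "b1 integrable_on {0..T}" by (rule set_lebesgue_integral_eq_integral(1)[OF b1_int])
  have \<beta>: "0 \<le> \<beta>" unfolding \<beta>_def using b1_nonneg by (rule integral_nonneg[OF b1i])
  \<comment> \<open>Chosen so that \<open>\<beta> * L\<close>, the price of replacing
    \<open>u t\<close> by \<open>u 0\<close> apart from the constant \<beta>, costs at most half of
    the kinetic energy.\<close>
  define K where "K = 2 * \<beta> + 1"
  have K: "0 < K" "2 * \<beta> \<le> K" using \<beta> by (auto simp: K_def)
  obtain M where M: "0 \<le> M" "\<And>x. K * norm x \<le> \<phi> x + M" using superlinearE[of K] by blast
  define Z where "Z = M * T"
  have Z: "0 \<le> Z" using M(1) T by (simp add: Z_def)
  obtain R where R: "R > 0" "\<And>x. R \<le> norm x \<Longrightarrow> c + \<beta> + Z + 1 \<le> ?\<Phi> x" using big by blast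
  show ?thesis
  proof (intro exI[of _ "max R (2 * (c + \<beta> + Z + \<Phi>0))"] ballI impI)
    fix u assume u: "u \<in> W1_orlicz T \<phi>" and c: "action T \<phi> F u \<le> c"
    define E where "E = integral {0..T} (\<lambda>t. \<phi> (D u t))"
    have "0 \<le> E" unfolding E_def by (rule integral_nonneg) (use W1_D(5)[OF u, of 0 T] T phi_nonneg in auto)
    define L where "L = (E + Z) / K"
    have L: "0 \<le> L" "\<beta> * L \<le> (E + Z) / 2"
    proof -
      show "0 \<le> L" unfolding L_def using \<open>0 \<le> E\<close> Z K by simp
      have "2 * \<beta> * L \<le> K * L" using K(2) \<open>0 \<le> L\<close> by (rule mult_right_mono)
      then have "2 * (\<beta> * L) \<le> K * L" by (simp only: mult.assoc)
      moreover have "K * L = E + Z" using K(1) by (simp add: L_def)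
      ultimately have "2 * (\<beta> * L) \<le> E + Z" by (simp only:)
      then show "\<beta> * L \<le> (E + Z) / 2" by (simp add: field_simps)
    qed
    have osc: "norm (u t - u 0) \<le> L" if "t \<in> {0..T}" for t
    proof -
      have "K * norm (u t - u 0) \<le> integral {0..t} (\<lambda>r. \<phi> (D u r)) + M * (t - 0)"
        using modulus[OF u _ _ _ K(1) M(2), of 0 t] that by auto
      also have "\<dots> \<le> E + Z"
        unfolding E_def Z_def using energy_mono[OF u, of 0 t] M(1) that by (intro add_mono mult_left_mono) auto
      finally show ?thesis using K(1) by (simp add: L_def field_simps)
    qed
    have Fu: "(\<lambda>t. F t (u t)) integrable_on {0..T}"
      by (rule set_lebesgue_integral_eq_integral(1)[OF F_comp_integrable[OF W1_D(2)[OF u]]])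
    have F0: "(\<lambda>t. F t (u 0)) integrable_on {0..T}" by (rule set_lebesgue_integral_eq_integral(1)[OF F_const])
    have b1L: "(\<lambda>t. b1 t * (1 + L)) integrable_on {0..T}" using b1i by (rule integrable_on_mult_left)
    have "?\<Phi> (u 0) - \<beta> * (1 + L) = integral {0..T} (\<lambda>t. F t (u 0) - b1 t * (1 + L))"
      unfolding \<beta>_def using F0 b1L by (simp add: Henstock_Kurzweil_Integration.integral_diff)
    also have "\<dots> \<le> integral {0..T} (\<lambda>t. F t (u t))"
    proof (rule integral_le)
      show "(\<lambda>t. F t (u 0) - b1 t * (1 + L)) integrable_on {0..T}" using F0 b1L by (rule integrable_diff)
      fix t assume t: "t \<in> {0..T}"
      have "\<bar>F t (u t) - F t (u 0)\<bar> \<le> b1 t * (1 + norm (u t - u 0))" by (rule F_BO[OF t])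
      also have "\<dots> \<le> b1 t * (1 + L)" using osc[OF t] b1_nonneg[OF t] by (intro mult_left_mono) auto
      finally show "F t (u 0) - b1 t * (1 + L) \<le> F t (u t)" by linarith
    qed (rule Fu)
    finally have "E + ?\<Phi> (u 0) - \<beta> * (1 + L) \<le> c"
      using c unfolding action_eq[OF u] E_def by linarith
    \<comment> \<open>Half of the energy survives. From here \<open>0 \<le> E\<close> and coercivity
      of the averaged potential bound \<open>u 0\<close>, and the lower bound
      \<open>- \<Phi>0\<close> of that potential bounds \<open>E\<close>.\<close>
    then have main: "E / 2 + ?\<Phi> (u 0) \<le> c + \<beta> + Z / 2" using L(2) by (simp add: distrib_left)
    have "norm (u 0) \<le> R"
    proof (rule ccontr)
      assume "\<not> norm (u 0) \<le> R"
      then show False using R(2)[of "u 0"] main \<open>0 \<le> E\<close> Z by (simp add: field_simps)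
    qed
    moreover have "E \<le> 2 * (c + \<beta> + Z + \<Phi>0)" using \<Phi>0[of "u 0"] main Z by (simp add: field_simps)
    ultimately show "norm (u 0) \<le> max R (2 * (c + \<beta> + Z + \<Phi>0)) \<and>
        integral {0..T} (\<lambda>t. \<phi> (D u t)) \<le> max R (2 * (c + \<beta> + Z + \<Phi>0))"
      by (auto simp: E_def)
  qed
qed

text \<open>\<open>K\<close> makes the energy term at most a quarter of \<open>K * e\<close>, then
  \<open>d\<close> does the same for the term with \<open>M\<close>; the resulting bound
  \<open>e / 2\<close> on the sums is uniform in \<open>n\<close>. A sum over a finite family
  survives pointwise convergence. The 1 in \<open>M + 1\<close> avoids division by 0.\<close>

lemma limit_absolutely_continuous:
  assumes un: "\<And>n. un n \<in> W1_orlicz T \<phi>" "\<And>n. integral {0..T} (\<lambda>t. \<phi> (D (un n) t)) \<le> A"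
    and lim: "\<And>t. t \<in> {0..T} \<Longrightarrow> (\<lambda>n. un n t) \<longlonglongrightarrow> u t"
  shows "absolutely_continuous_on {0..T} u"
  unfolding absolutely_continuous_on_vsum
proof (intro allI impI)
  fix e :: real assume "e > 0"
  define K where "K = 4 * \<bar>A\<bar> / e + 1"
  have K: "0 < K" "\<bar>A\<bar> \<le> K * (e / 4)" using \<open>e > 0\<close> by (auto simp: K_def field_simps add_nonneg_pos)
  obtain M where M: "0 \<le> M" "\<And>x. K * norm x \<le> \<phi> x + M" using superlinearE[of K] by blast
  define d where "d = K * e / (4 * (M + 1))"
  have "d > 0" using K(1) M(1) \<open>e > 0\<close> by (simp add: d_def)
  have Md: "M * d \<le> K * (e / 4)"
  proof -
    have "M * d \<le> (M + 1) * d" using \<open>d > 0\<close> by simp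
    also have "\<dots> = K * (e / 4)"
    proof -
      have "4 * M + 4 \<noteq> 0" using M(1) by linarith
      then show ?thesis by (simp add: d_def field_simps)
    qed
    finally show ?thesis .
  qed
  have "vsum u I \<le> e / 2" if I: "interval_family {0..T} I" "vsum (\<lambda>x. x) I < d" for I
  proof -
    have "vsum (un n) I \<le> e / 2" for n
    proof -
      have "K * vsum (un n) I = (\<Sum>(a, b)\<in>I. K * norm (un n b - un n a))"
        by (simp add: vsum_def sum_distrib_left split_beta)
      also have "\<dots> \<le> (\<Sum>(a, b)\<in>I. integral {a..b} (\<lambda>r. \<phi> (D (un n) r)) + M * (b - a))"
      proof (rule sum_mono)
        fix p assume "p \<in> I"
        then have "0 \<le> fst p" "fst p \<le> snd p" "snd p \<le> T" using interval_familyD(1,2)[OF I(1)] by auto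
        then show "(case p of (a, b) \<Rightarrow> K * norm (un n b - un n a)) \<le>
            (case p of (a, b) \<Rightarrow> integral {a..b} (\<lambda>r. \<phi> (D (un n) r)) + M * (b - a))"
          using modulus[OF un(1) _ _ _ K(1) M(2)] by (simp add: split_beta)
      qed
      also have "\<dots> = (\<Sum>(a, b)\<in>I. integral {a..b} (\<lambda>r. \<phi> (D (un n) r))) + M * vsum (\<lambda>x. x) I"
        by (simp add: vsum_ident[OF I(1)] sum.distrib sum_distrib_left split_beta)
      also have "(\<Sum>(a, b)\<in>I. integral {a..b} (\<lambda>r. \<phi> (D (un n) r))) \<le> integral {0..T} (\<lambda>r. \<phi> (D (un n) r))"
        by (rule sum_integral_interval_family_le[OF I(1)]) (use W1_D(5)[OF un(1)] T phi_nonneg in auto)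
      also have "\<dots> \<le> K * (e / 4)" using un(2)[of n] K(2) by linarith
      also have "M * vsum (\<lambda>x. x) I \<le> K * (e / 4)"
        using I(2) M(1) Md by (meson less_imp_le mult_left_mono order_trans)
      finally have "K * vsum (un n) I \<le> K * (e / 2)" by simp
      then show ?thesis using K(1) by simp
    qed
    moreover have "(\<lambda>n. vsum (un n) I) \<longlonglongrightarrow> vsum u I"
      unfolding vsum_def
    proof (rule tendsto_sum)
      fix p assume "p \<in> I"
      then have "{fst p..snd p} \<subseteq> {0..T}" "fst p \<le> snd p" using interval_familyD(1,2)[OF I(1)] by auto
      then have "fst p \<in> {0..T}" "snd p \<in> {0..T}" by auto
      then show "(\<lambda>n. case p of (a, b) \<Rightarrow> norm (un n b - un n a)) \<longlonglongrightarrow> (case p of (a, b) \<Rightarrow> norm (u b - u a))"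
        unfolding split_beta by (intro tendsto_intros lim)
    qed
    ultimately show ?thesis by (intro LIMSEQ_le_const2) auto
  qed
  then have "\<forall>I. interval_family {0..T} I \<and> vsum (\<lambda>x. x) I < d \<longrightarrow> vsum u I < e" using \<open>e > 0\<close> by fastforce
  then show "\<exists>d>0. \<forall>I. interval_family {0..T} I \<and> vsum (\<lambda>x. x) I < d \<longrightarrow> vsum u I < e"
    using \<open>d > 0\<close> by blast
qed

section \<open>Difference quotients and lower semicontinuity of the energy\<close>

lemma steklov_continuous:
  assumes h: "0 < h" and v: "continuous_on {0..T} v"
  shows "continuous_on {0..T - h} (\<lambda>t. \<phi> ((v (t + h) - v t) /\<^sub>R h))"
proof -
  have "continuous_on {0..T - h} v" by (rule continuous_on_subset[OF v]) (use h in auto)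
  moreover have "continuous_on {0..T - h} (\<lambda>t. v (t + h))"
    by (rule continuous_on_compose2[OF v]) (use h in \<open>auto intro!: continuous_intros\<close>)
  ultimately show ?thesis
    by (intro continuous_on_compose2[OF phi_continuous[of UNIV]] continuous_intros) auto
qed

text \<open>With \<open>E\<close> the energy up to time \<open>t\<close>, Jensen bounds the
  integrand by \<open>(E (t + h) - E t) / h\<close>. After a shift the common part over
  \<open>{h..T - h}\<close> cancels, leaving the mean of \<open>E\<close> over the last piece of
  length \<open>h\<close> minus that over the first, which is at most \<open>E T\<close>. The bound
  \<open>h \<le> T / 2\<close> puts \<open>h\<close> before \<open>T - h\<close>.\<close>

lemma steklov_le:
  assumes u: "u \<in> W1_orlicz T \<phi>" and h: "0 < h" "h \<le> T / 2"
  shows "(\<lambda>t. \<phi> ((u (t + h) - u t) /\<^sub>R h)) integrable_on {0..T - h}"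
    and "integral {0..T - h} (\<lambda>t. \<phi> ((u (t + h) - u t) /\<^sub>R h)) \<le> integral {0..T} (\<lambda>t. \<phi> (D u t))"
proof -
  define E where "E t = integral {0..t} (\<lambda>r. \<phi> (D u r))" for t
  have E_diff: "E t - E s = integral {s..t} (\<lambda>r. \<phi> (D u r))" if "0 \<le> s" "s \<le> t" "t \<le> T" for s t
    unfolding E_def
    by (rule integral_subinterval_diff[where b = T, symmetric]) (use that W1_D(5)[OF u, of 0 T] T in auto)
  have E_mono: "E s \<le> E t" if "0 \<le> s" "s \<le> t" "t \<le> T" for s t
  proof -
    have "0 \<le> integral {s..t} (\<lambda>r. \<phi> (D u r))" by (rule integral_nonneg[OF W1_D(5)[OF u that] phi_nonneg])
    then show ?thesis using E_diff[OF that] by simp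
  qed
  have E0: "E 0 = 0" by (simp add: E_def)
  have E_cont: "continuous_on {0..T} E"
    unfolding E_def by (rule indefinite_integral_continuous_1) (use W1_D(5)[OF u] T in auto)
  show int: "(\<lambda>t. \<phi> ((u (t + h) - u t) /\<^sub>R h)) integrable_on {0..T - h}"
    by (rule integrable_continuous_real[OF steklov_continuous[OF h(1) W1_D(2)[OF u]]])
  have E_int: "E integrable_on {s..t}" if "0 \<le> s" "t \<le> T" for s t
    by (rule integrable_continuous_real, rule continuous_on_subset[OF E_cont]) (use that in auto)
  have Eh_cont: "continuous_on {0..T - h} (\<lambda>t. E (t + h))"
    by (rule continuous_on_compose2[OF E_cont]) (use h in \<open>auto intro!: continuous_intros\<close>)
  have E_cont': "continuous_on {0..T - h} E" by (rule continuous_on_subset[OF E_cont]) (use h in auto)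
  have "integral {0..T - h} (\<lambda>t. \<phi> ((u (t + h) - u t) /\<^sub>R h)) \<le> integral {0..T - h} (\<lambda>t. (E (t + h) - E t) / h)"
  proof (rule integral_le[OF int])
    show "(\<lambda>t. (E (t + h) - E t) / h) integrable_on {0..T - h}"
      by (intro integrable_continuous_real continuous_intros Eh_cont E_cont') (use h in auto)
    fix t assume t: "t \<in> {0..T - h}"
    have "h * \<phi> ((u (t + h) - u t) /\<^sub>R h) \<le> E (t + h) - E t"
      using jensen[OF u, of t "t + h"] E_diff[of t "t + h"] t h by auto
    then show "\<phi> ((u (t + h) - u t) /\<^sub>R h) \<le> (E (t + h) - E t) / h" using h by (simp add: field_simps)
  qed
  also have "\<dots> = (integral {0..T - h} (\<lambda>t. E (t + h)) - integral {0..T - h} E) / h"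
    using integrable_continuous_real[OF Eh_cont] integrable_continuous_real[OF E_cont']
    by (simp add: Henstock_Kurzweil_Integration.integral_diff)
  also have "integral {0..T - h} (\<lambda>t. E (t + h)) = integral {h..T} E"
  proof (rule integral_unique)
    have "(E has_integral integral {h..T} E) (cbox h T)"
      using integrable_integral[OF E_int[of h T]] h by simp
    from has_integral_affinity'[OF this, of 1 h]
    show "((\<lambda>t. E (t + h)) has_integral integral {h..T} E) {0..T - h}" by simp
  qed
  also have "integral {h..T} E = integral {h..T - h} E + integral {T - h..T} E"
    by (rule Henstock_Kurzweil_Integration.integral_combine[symmetric]) (use h E_int in auto)
  also have "integral {0..T - h} E = integral {0..h} E + integral {h..T - h} E"
    by (rule Henstock_Kurzweil_Integration.integral_combine[symmetric]) (use h E_int in auto)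
  also have "(integral {h..T - h} E + integral {T - h..T} E - (integral {0..h} E + integral {h..T - h} E)) / h
      = (integral {T - h..T} E - integral {0..h} E) / h" by simp
  also have "\<dots> \<le> (h * E T - 0) / h"
  proof (rule divide_right_mono[OF diff_mono])
    have "integral {T - h..T} E \<le> integral {T - h..T} (\<lambda>_. E T)"
      by (rule integral_le) (use h E_int E_mono in auto)
    then show "integral {T - h..T} E \<le> h * E T" using h by simp
    show "0 \<le> integral {0..h} E"
      by (rule integral_nonneg) (use h E_int E_mono[of 0] E0 in auto)
  qed (use h in simp)
  also have "\<dots> = integral {0..T} (\<lambda>t. \<phi> (D u t))" using h by (simp add: E_def)
  finally show "integral {0..T - h} (\<lambda>t. \<phi> ((u (t + h) - u t) /\<^sub>R h)) \<le> integral {0..T} (\<lambda>t. \<phi> (D u t))" .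
qed

end

lemma nn_integral_Fatou_le:
  fixes f :: "nat \<Rightarrow> 'b \<Rightarrow> ennreal"
  assumes meas: "\<And>n. f n \<in> borel_measurable M"
    and lim: "AE x in M. (\<lambda>n. f n x) \<longlonglongrightarrow> g x" and le: "\<And>n. (\<integral>\<^sup>+x. f n x \<partial>M) \<le> L"
  shows "(\<integral>\<^sup>+x. g x \<partial>M) \<le> L"
proof -
  have "(\<integral>\<^sup>+x. g x \<partial>M) = (\<integral>\<^sup>+x. liminf (\<lambda>n. f n x) \<partial>M)"
    by (rule nn_integral_cong_AE, use lim in eventually_elim)
       (metis lim_imp_Liminf trivial_limit_sequentially)
  also have "\<dots> \<le> liminf (\<lambda>n. \<integral>\<^sup>+x. f n x \<partial>M)" by (rule nn_integral_liminf[OF meas])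
  also have "\<dots> \<le> limsup (\<lambda>n. \<integral>\<^sup>+x. f n x \<partial>M)" by (rule Liminf_le_Limsup) simp
  also have "\<dots> \<le> L" using le by (intro Limsup_bounded always_eventually) auto
  finally show ?thesis .
qed

lemma vanishing_steps:
  assumes "0 < d"
  obtains h :: "nat \<Rightarrow> real" where "\<And>n. 0 < h n" "\<And>n. h n \<le> d" "h \<longlonglongrightarrow> 0"
proof
  let ?h = "\<lambda>n. d * inverse (real (Suc n))"
  show "?h \<longlonglongrightarrow> 0" using tendsto_mult_right_zero[OF LIMSEQ_inverse_real_of_nat] by simp
  show "0 < ?h n" for n using assms by simp
  show "?h n \<le> d" for n
  proof -
    have "inverse (real (Suc n)) \<le> 1" by (simp add: field_simps)
    then have "?h n \<le> d * 1" using assms by (intro mult_left_mono) auto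
    then show ?thesis by simp
  qed
qed

lemma has_vector_derivative_right_quotient:
  fixes f :: "real \<Rightarrow> 'a::real_normed_vector"
  assumes f: "(f has_vector_derivative d) (at t within {a..b})" and t: "a \<le> t" "t < b"
    and h: "h \<longlonglongrightarrow> 0" "\<And>n. 0 < h n"
  shows "(\<lambda>n. (f (t + h n) - f t) /\<^sub>R h n) \<longlonglongrightarrow> d"
proof -
  have der: "((\<lambda>s. norm ((f s - f t) - (s - t) *\<^sub>R d) / norm (s - t)) \<longlongrightarrow> 0) (at t within {a..b})"
    using f unfolding has_vector_derivative_def has_derivative_iff_norm by blast
  have ev: "\<forall>\<^sub>F n in sequentially. h n < b - t" by (rule order_tendstoD[OF h(1)]) (use t in simp)
  have "filterlim (\<lambda>n. t + h n) (at t within {a..b}) sequentially"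
    unfolding filterlim_at
  proof
    show "\<forall>\<^sub>F n in sequentially. t + h n \<in> {a..b} \<and> t + h n \<noteq> t"
      using ev
    proof eventually_elim
      case (elim n)
      then show ?case using h(2)[of n] t by auto
    qed
    show "(\<lambda>n. t + h n) \<longlonglongrightarrow> t" using tendsto_add[OF tendsto_const h(1), of t] by simp
  qed
  from filterlim_compose[OF der this]
  have "(\<lambda>n. norm ((f (t + h n) - f t) - h n *\<^sub>R d) / norm (h n)) \<longlonglongrightarrow> 0" by simp
  moreover have "norm ((f (t + h n) - f t) - h n *\<^sub>R d) / norm (h n) = norm ((f (t + h n) - f t) /\<^sub>R h n - d)" for n
  proof -
    have "(f (t + h n) - f t) /\<^sub>R h n - d = ((f (t + h n) - f t) - h n *\<^sub>R d) /\<^sub>R h n"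
      using h(2)[of n] by (simp add: scaleR_right_diff_distrib)
    then show ?thesis by (simp add: divide_inverse mult.commute)
  qed
  ultimately have "(\<lambda>n. norm ((f (t + h n) - f t) /\<^sub>R h n - d)) \<longlonglongrightarrow> 0" by simp
  then show ?thesis by (rule Lim_null[THEN iffD2, OF tendsto_norm_zero_cancel])
qed

context periodic_action
begin

text \<open>By Jensen, the energy of the difference quotients with a fixed step \<open>h\<close> is at most the energy
  of the derivative. It passes to the pointwise limit \<open>u\<close>, and then Fatou's lemma is applied as
  \<open>h\<close> tends to \<open>0\<close>; no weak convergence of derivatives is needed.\<close>

lemma lower_semicontinuous:
  assumes un: "\<And>n. un n \<in> W1_orlicz T \<phi>" "\<And>n. integral {0..T} (\<lambda>t. \<phi> (D (un n) t)) \<le> A"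
    and lim: "\<And>t. t \<in> {0..T} \<Longrightarrow> (\<lambda>n. un n t) \<longlonglongrightarrow> u t"
  shows "u \<in> W1_orlicz T \<phi>" and "integral {0..T} (\<lambda>t. \<phi> (D u t)) \<le> A"
proof -
  have ac: "absolutely_continuous_on {0..T} u" by (rule limit_absolutely_continuous[OF un lim])
  have uc: "continuous_on {0..T} u" by (rule absolutely_continuous_on_imp_continuous_on[OF ac])
  note [measurable] = deriv_measurable[OF ac]
  have "0 \<le> integral {0..T} (\<lambda>t. \<phi> (D (un 0) t))"
    by (rule integral_nonneg) (use W1_D(5)[OF un(1), of 0 T] T phi_nonneg in auto)
  then have "0 \<le> A" using un(2)[of 0] by linarith
  let ?q = "\<lambda>v h t. \<phi> ((v (t + h) - v t) /\<^sub>R h)"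
  have q_meas: "(\<lambda>t. ennreal (?q v h t)) \<in> borel_measurable (lebesgue_on {0..T - h})"
    if "0 < h" "continuous_on {0..T} v" for h and v :: "real \<Rightarrow> 'a"
    by (intro measurable_compose[OF continuous_imp_measurable_on_sets_lebesgue[OF steklov_continuous[OF that]]]) auto
  have q_le: "(\<integral>\<^sup>+t. ennreal (?q u h t) \<partial>lebesgue_on {0..T - h}) \<le> ennreal A" if h: "0 < h" "h \<le> T / 2" for h
  proof (rule nn_integral_Fatou_le)
    show "(\<lambda>t. ennreal (?q (un n) h t)) \<in> borel_measurable (lebesgue_on {0..T - h})" for n
      by (rule q_meas[OF h(1) W1_D(2)[OF un(1)]])
    show "AE t in lebesgue_on {0..T - h}. (\<lambda>n. ennreal (?q (un n) h t)) \<longlonglongrightarrow> ennreal (?q u h t)"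
    proof (rule AE_I2)
      fix t assume "t \<in> space (lebesgue_on {0..T - h})"
      then have t: "t \<in> {0..T}" "t + h \<in> {0..T}" using h by auto
      have "(\<lambda>n. (un n (t + h) - un n t) /\<^sub>R h) \<longlonglongrightarrow> (u (t + h) - u t) /\<^sub>R h"
        by (intro tendsto_intros lim t)
      then have "(\<lambda>n. ?q (un n) h t) \<longlonglongrightarrow> ?q u h t"
        using continuous_on_tendsto_compose[OF phi_continuous[of UNIV], of _ _ sequentially] by simp
      then show "(\<lambda>n. ennreal (?q (un n) h t)) \<longlonglongrightarrow> ennreal (?q u h t)" by (rule tendsto_ennrealI)
    qed
    show "(\<integral>\<^sup>+t. ennreal (?q (un n) h t) \<partial>lebesgue_on {0..T - h}) \<le> ennreal A" for n
    proof -
      have "?q (un n) h absolutely_integrable_on {0..T - h}"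
        by (rule nonnegative_absolutely_integrable_1[OF steklov_le(1)[OF un(1) h]]) (rule phi_nonneg)
      then have "(\<integral>\<^sup>+t. ennreal (?q (un n) h t) \<partial>lebesgue_on {0..T - h}) = ennreal (integral {0..T - h} (?q (un n) h))"
        by (rule nn_integral_eq) (rule phi_nonneg)
      also have "\<dots> \<le> ennreal A"
        using steklov_le(2)[OF un(1) h, of n] un(2)[of n] by (intro ennreal_leI) linarith
      finally show ?thesis .
    qed
  qed
  obtain h where h: "\<And>n. 0 < h n" "\<And>n. h n \<le> T / 2" and h_lim: "h \<longlonglongrightarrow> 0"
    using vanishing_steps[of "T / 2"] T by auto
  obtain N where N: "negligible N"
    "\<And>t. t \<in> {0..T} \<Longrightarrow> t \<notin> N \<Longrightarrow> (u has_vector_derivative D u t) (at t within {0..T})"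
    using AE_lebesgue_onE[OF absolutely_continuous_FTC(3)[OF ac T]] by auto
  \<comment> \<open>The domains \<open>{0..T - h n}\<close> vary with \<open>n\<close>, so
    everything is moved to the whole line by indicators before Fatou. Extended integrals are used
    because finiteness of the energy of \<open>u\<close> is itself part of the claim.\<close>
  have "(\<integral>\<^sup>+t. ennreal (\<phi> (D u t)) * indicator {0..T} t \<partial>lebesgue) \<le> ennreal A"
  proof (rule nn_integral_Fatou_le)
    show "(\<lambda>t. ennreal (?q u (h n) t) * indicator {0..T - h n} t) \<in> borel_measurable lebesgue" for n
      using q_meas[OF h(1) uc, of n] by (subst (asm) borel_measurable_restrict_space_iff_ennreal) auto
    show "(\<integral>\<^sup>+t. ennreal (?q u (h n) t) * indicator {0..T - h n} t \<partial>lebesgue) \<le> ennreal A" for n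
      using q_le[OF h, of n] by (subst (asm) nn_integral_restrict_space) auto
    \<comment> \<open>The end points are discarded along with \<open>N\<close>: the quotients look
      to the right, and a time before \<open>T\<close> lies in \<open>{0..T - h n}\<close> only from
      some \<open>n\<close> on.\<close>
    have "insert 0 (insert T N) \<in> null_sets lebesgue"
      using N(1) by (simp add: negligible_iff_null_sets[symmetric])
    then have "AE t in lebesgue. t \<notin> insert 0 (insert T N)" by (rule AE_not_in)
    then show "AE t in lebesgue. (\<lambda>n. ennreal (?q u (h n) t) * indicator {0..T - h n} t)
        \<longlonglongrightarrow> ennreal (\<phi> (D u t)) * indicator {0..T} t"
    proof eventually_elim
      case (elim t)
      show ?case
      proof (cases "0 < t \<and> t < T")
        case False
        then have "t \<notin> {0..T}" using elim by auto
        then have "t \<notin> {0..T - h n}" for n using h(1)[of n] by auto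
        then show ?thesis using \<open>t \<notin> {0..T}\<close> by simp
      next
        case True
        have ev: "\<forall>\<^sub>F n in sequentially. h n < T - t" by (rule order_tendstoD[OF h_lim]) (use True in simp)
        have "(\<lambda>n. (u (t + h n) - u t) /\<^sub>R h n) \<longlonglongrightarrow> D u t"
          by (rule has_vector_derivative_right_quotient[OF N(2) _ _ h_lim h(1)]) (use True elim in auto)
        then have "(\<lambda>n. ?q u (h n) t) \<longlonglongrightarrow> \<phi> (D u t)"
          using continuous_on_tendsto_compose[OF phi_continuous[of UNIV], of _ _ sequentially] by simp
        then have "(\<lambda>n. ennreal (?q u (h n) t)) \<longlonglongrightarrow> ennreal (\<phi> (D u t)) * indicator {0..T} t"
          using True by (simp add: tendsto_ennrealI)
        then show ?thesis
        proof (rule Lim_transform_eventually)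
          show "\<forall>\<^sub>F n in sequentially. ennreal (?q u (h n) t) = ennreal (?q u (h n) t) * indicator {0..T - h n} t"
            using ev
          proof eventually_elim
            case (elim n)
            then show ?case using True by simp
          qed
        qed
      qed
    qed
  qed
  then have nn: "(\<integral>\<^sup>+t. ennreal (\<phi> (D u t)) \<partial>lebesgue_on {0..T}) \<le> ennreal A"
    by (subst nn_integral_restrict_space) auto
  have int: "(\<lambda>t. \<phi> (D u t)) absolutely_integrable_on {0..T}"
  proof (rule absolutely_integrable_nn_integral)
    show "(\<integral>\<^sup>+t. ennreal (\<phi> (D u t)) \<partial>lebesgue_on {0..T}) < \<infinity>"
      using nn by (rule le_less_trans) simp
  qed (use phi_nonneg in auto)
  then show "u \<in> W1_orlicz T \<phi>" using ac by (simp add: W1_iff)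
  have "ennreal (integral {0..T} (\<lambda>t. \<phi> (D u t))) \<le> ennreal A"
    using nn nn_integral_eq[where f = "\<lambda>t. \<phi> (D u t)", OF int phi_nonneg] by simp
  then show "integral {0..T} (\<lambda>t. \<phi> (D u t)) \<le> A" using \<open>0 \<le> A\<close> by (simp add: ennreal_le_iff)
qed

text \<open>Slope 1 in the superlinear bound gives boundedness. For equicontinuity the energy
  contribution \<open>A\<close> does not shrink with the interval, so the slope \<open>K\<close> is
  taken with \<open>A < K * (e / 2)\<close>. The radius \<open>R\<close> is returned because it
  selects the function that dominates the potentials.\<close>

lemma compactness:
  assumes un: "\<And>n. un n \<in> W1_orlicz T \<phi>" "\<And>n. integral {0..T} (\<lambda>t. \<phi> (D (un n) t)) \<le> A"
    "\<And>n. norm (un n 0) \<le> A"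
  obtains k u R where "strict_mono (k :: nat \<Rightarrow> nat)" "continuous_on {0..T} u"
    "\<And>t. t \<in> {0..T} \<Longrightarrow> (\<lambda>n. un (k n) t) \<longlonglongrightarrow> u t" "\<And>n t. t \<in> {0..T} \<Longrightarrow> norm (un n t) < R"
proof -
  have "0 \<le> A" using un(3)[of 0] norm_ge_zero order_trans by blast
  have mod: "K * norm (un n t - un n s) \<le> A + M * \<bar>t - s\<bar>"
    if "0 < K" "\<And>x. K * norm x \<le> \<phi> x + M" "s \<in> {0..T}" "t \<in> {0..T}" for K M n s t
  proof -
    have *: "K * norm (un n t - un n s) \<le> A + M * (t - s)" if st: "0 \<le> s" "s \<le> t" "t \<le> T" for s t
      using modulus[OF un(1) st \<open>0 < K\<close> \<open>\<And>x. K * norm x \<le> \<phi> x + M\<close>, of n] energy_mono[OF un(1) st, of n] un(2)[of n]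
      by linarith
    show ?thesis
    proof (cases "s \<le> t")
      case True
      then show ?thesis using *[of s t] that by simp
    next
      case False
      then show ?thesis using *[of t s] that by (simp add: norm_minus_commute)
    qed
  qed
  obtain M1 where M1: "0 \<le> M1" "\<And>x. 1 * norm x \<le> \<phi> x + M1" using superlinearE[of 1] by blast
  define R where "R = A + (A + M1 * T) + 1"
  have bound: "norm (un n t) < R" if t: "t \<in> {0..T}" for n t
  proof -
    have "norm (un n t) \<le> norm (un n 0) + norm (un n t - un n 0)"
      using norm_triangle_ineq[of "un n 0" "un n t - un n 0"] by simp
    moreover have "1 * norm (un n t - un n 0) \<le> A + M1 * \<bar>t - 0\<bar>"
      by (rule mod[OF _ M1(2)]) (use t T in auto)
    moreover have "M1 * \<bar>t - 0\<bar> \<le> M1 * T" using t M1(1) by (intro mult_left_mono) auto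
    ultimately show ?thesis using un(3)[of n] by (simp add: R_def)
  qed
  have equi: "\<exists>d>0. \<forall>n t. t \<in> {0..T} \<and> norm (s - t) < d \<longrightarrow> norm (un n s - un n t) < e"
    if s: "s \<in> {0..T}" and "0 < e" for s e
  proof -
    define K where "K = 2 * A / e + 1"
    have K: "0 < K" "A < K * (e / 2)" using \<open>0 < e\<close> \<open>0 \<le> A\<close> by (auto simp: K_def field_simps add_nonneg_pos)
    obtain M where M: "0 \<le> M" "\<And>x. K * norm x \<le> \<phi> x + M" using superlinearE[of K] by blast
    define d where "d = K * e / (2 * (M + 1))"
    have "d > 0" using K(1) M(1) \<open>0 < e\<close> by (simp add: d_def)
    have Md: "M * d \<le> K * (e / 2)"
    proof -
      have "M * d \<le> (M + 1) * d" using \<open>d > 0\<close> by simp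
      also have "\<dots> = K * (e / 2)"
      proof -
        have "2 * M + 2 \<noteq> 0" using M(1) by linarith
        then show ?thesis by (simp add: d_def field_simps)
      qed
      finally show ?thesis .
    qed
    show ?thesis
    proof (intro exI[of _ d] conjI allI impI \<open>d > 0\<close>)
      fix n t assume t: "t \<in> {0..T} \<and> norm (s - t) < d"
      have "K * norm (un n s - un n t) \<le> A + M * \<bar>s - t\<bar>" using mod[OF K(1) M(2)] s t by blast
      also have "M * \<bar>s - t\<bar> \<le> M * d" using t M(1) by (intro mult_left_mono) auto
      finally have "K * norm (un n s - un n t) < K * e" using K(2) Md by (simp add: field_simps)
      then show "norm (un n s - un n t) < e" using K(1) by simp
    qed
  qed
  obtain u k where uk: "continuous_on {0..T} u" "strict_mono (k :: nat \<Rightarrow> nat)"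
    "\<And>e. 0 < e \<Longrightarrow> \<exists>N. \<forall>n t. n \<ge> N \<and> t \<in> {0..T} \<longrightarrow> norm (un (k n) t - u t) < e"
    using Arzela_Ascoli[of "{0..T}" un R] bound equi by (metis compact_Icc less_imp_le)
  show thesis
  proof (rule that[OF uk(2,1) _ bound])
    fix t assume t: "t \<in> {0..T}"
    show "(\<lambda>n. un (k n) t) \<longlonglongrightarrow> u t"
      unfolding lim_sequentially dist_norm using uk(3) t by metis
  qed
qed

section \<open>Existence of a minimiser\<close>

lemma zero_in_W1: "(\<lambda>_. 0) \<in> W1_orlicz_per T \<phi>"
proof -
  have ac: "absolutely_continuous_on {0..T} (\<lambda>_. 0 :: 'a)" by (rule absolutely_continuous_on_const)
  have "D (\<lambda>_. 0 :: 'a) t = 0" if "t \<in> {0..T}" for t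
    unfolding deriv_on_def by (rule vector_derivative_within_closed_interval) (use that T in auto)
  then have "(\<lambda>t. \<phi> (D (\<lambda>_. 0) t)) absolutely_integrable_on {0..T} \<longleftrightarrow> (\<lambda>_. 0 :: real) absolutely_integrable_on {0..T}"
    using phi_0 by (intro set_integrable_cong) auto
  then show ?thesis using ac by (simp add: W1_orlicz_per_def W1_iff)
qed

lemma minimizer_exists:
  "\<exists>u\<in>W1_orlicz_per T \<phi>. \<forall>v\<in>W1_orlicz_per T \<phi>. action T \<phi> F u \<le> action T \<phi> F v"
proof -
  let ?W = "W1_orlicz_per T \<phi>" and ?I = "action T \<phi> F"
  let ?E = "\<lambda>u. integral {0..T} (\<lambda>t. \<phi> (D u t))" and ?P = "\<lambda>u. integral {0..T} (\<lambda>t. F t (u t))"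
  have W: "u \<in> W1_orlicz T \<phi>" "u 0 = u T" if "u \<in> ?W" for u using that by (auto simp: W1_orlicz_per_def)
  have E_nonneg: "0 \<le> ?E u" if "u \<in> W1_orlicz T \<phi>" for u
    by (rule integral_nonneg) (use W1_D(5)[OF that, of 0 T] T phi_nonneg in auto)
  have bdd_P: "\<exists>B. \<forall>u\<in>W1_orlicz T \<phi>. (\<forall>t\<in>{0..T}. norm (u t) < R) \<longrightarrow> - B \<le> ?P u" for R
  proof -
    obtain C where C: "\<And>t x. t \<in> {0..T} \<Longrightarrow> x \<in> ball 0 R \<Longrightarrow> \<bar>F t x\<bar> \<le> C * b t"
      using F_local[of R] by metis
    have "- integral {0..T} (\<lambda>t. C * b t) \<le> ?P u" if u: "u \<in> W1_orlicz T \<phi>" "\<forall>t\<in>{0..T}. norm (u t) < R" for u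
    proof -
      have "norm (?P u) \<le> integral {0..T} (\<lambda>t. C * b t)"
        by (rule integral_norm_bound_integral[OF set_lebesgue_integral_eq_integral(1)[OF F_comp_integrable[OF W1_D(2)[OF u(1)]]]
              set_lebesgue_integral_eq_integral(1)[OF set_integrable_mult_right[OF b_int]]])
           (use C u(2) in auto)
      then show ?thesis by simp
    qed
    then show ?thesis by blast
  qed
  obtain A where A: "\<And>u. u \<in> W1_orlicz T \<phi> \<Longrightarrow> ?I u \<le> ?I (\<lambda>_. 0) + 1 \<Longrightarrow> norm (u 0) \<le> A \<and> ?E u \<le> A"
    using coercive by blast
  have bdd: "bdd_below (?I ` ?W)"
  proof -
    obtain M1 where M1: "0 \<le> M1" "\<And>x. 1 * norm x \<le> \<phi> x + M1" using superlinearE[of 1] by blast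
    obtain B where B: "\<And>u. u \<in> W1_orlicz T \<phi> \<Longrightarrow> (\<forall>t\<in>{0..T}. norm (u t) < A + (A + M1 * T) + 1) \<Longrightarrow> - B \<le> ?P u"
      using bdd_P[of "A + (A + M1 * T) + 1"] by blast
    \<comment> \<open>Only curves whose action is at most that of 0 plus 1 need an estimate:
      coercivity confines them to a fixed ball, where the potential is bounded below. The others
      have larger action than 0 anyway.\<close>
    have "min (- B) (?I (\<lambda>_. 0)) \<le> ?I u" if u: "u \<in> ?W" for u
    proof (cases "?I u \<le> ?I (\<lambda>_. 0) + 1")
      case True
      note u0 = A[OF W(1)[OF u] True]
      have "norm (u t) < A + (A + M1 * T) + 1" if t: "t \<in> {0..T}" for t
      proof -
        have "norm (u t) \<le> norm (u 0) + norm (u t - u 0)"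
          using norm_triangle_ineq[of "u 0" "u t - u 0"] by simp
        moreover have "1 * norm (u t - u 0) \<le> integral {0..t} (\<lambda>r. \<phi> (D u r)) + M1 * (t - 0)"
          using t by (intro modulus[OF W(1)[OF u] _ _ _ _ M1(2)]) auto
        moreover have "integral {0..t} (\<lambda>r. \<phi> (D u r)) \<le> ?E u" using t by (intro energy_mono[OF W(1)[OF u]]) auto
        moreover have "M1 * (t - 0) \<le> M1 * T" using t M1(1) by (intro mult_left_mono) auto
        ultimately show ?thesis using u0 by simp
      qed
      then have "- B \<le> ?P u" using B[OF W(1)[OF u]] by blast
      then show ?thesis using E_nonneg[OF W(1)[OF u]] unfolding action_eq[OF W(1)[OF u]] by linarith
    qed linarith
    then show ?thesis by (intro bdd_belowI2) auto
  qed
  define m where "m = Inf (?I ` ?W)"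
  have m_le: "m \<le> ?I u" if "u \<in> ?W" for u unfolding m_def using bdd that by (simp add: cInf_lower)
  have "\<exists>u\<in>?W. ?I u < m + inverse (real (Suc n))" for n
  proof -
    have "Inf (?I ` ?W) < m + inverse (real (Suc n))" by (simp add: m_def)
    then obtain y where "y \<in> ?I ` ?W" "y < m + inverse (real (Suc n))"
      using cInf_lessD[of "?I ` ?W"] zero_in_W1 by blast
    then show ?thesis by blast
  qed
  then obtain un where un: "\<And>n. un n \<in> ?W" "\<And>n. ?I (un n) < m + inverse (real (Suc n))" by metis
  have "?I (un n) \<le> ?I (\<lambda>_. 0) + 1" for n
  proof -
    have "inverse (real (Suc n)) \<le> 1" by (simp add: field_simps)
    then show ?thesis using un(2)[of n] m_le[OF zero_in_W1] by linarith
  qed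
  note unA = A[OF W(1)[OF un(1)] this]
  obtain k u R where k: "strict_mono (k :: nat \<Rightarrow> nat)" and u: "continuous_on {0..T} u"
    "\<And>t. t \<in> {0..T} \<Longrightarrow> (\<lambda>n. un (k n) t) \<longlonglongrightarrow> u t" and R: "\<And>n t. t \<in> {0..T} \<Longrightarrow> norm (un n t) < R"
    using compactness[of un A] W(1)[OF un(1)] unA by metis
  obtain C where C: "\<And>t x. t \<in> {0..T} \<Longrightarrow> x \<in> ball 0 R \<Longrightarrow> \<bar>F t x\<bar> \<le> C * b t"
    using F_local[of R] by metis
  have P_lim: "(\<lambda>n. ?P (un (k n))) \<longlonglongrightarrow> ?P u"
  proof (rule dominated_convergence(2))
    show "(\<lambda>t. F t (un (k n) t)) integrable_on {0..T}" for n
      by (rule set_lebesgue_integral_eq_integral(1)[OF F_comp_integrable[OF W1_D(2)[OF W(1)[OF un(1)]]]])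
    show "(\<lambda>t. C * b t) integrable_on {0..T}"
      by (rule set_lebesgue_integral_eq_integral(1)[OF set_integrable_mult_right[OF b_int]])
    show "norm (F t (un (k n) t)) \<le> C * b t" if "t \<in> {0..T}" for n t using C R that by simp
    show "(\<lambda>n. F t (un (k n) t)) \<longlonglongrightarrow> F t (u t)" if "t \<in> {0..T}" for t
      using continuous_on_tendsto_compose[OF F_continuous[OF that] u(2)[OF that]] by simp
  qed
  have E_lim: "\<forall>\<^sub>F n in sequentially. ?E (un (k n)) < m - ?P u + e" if "e > 0" for e
  proof -
    have "(\<lambda>n. m + inverse (real (Suc (k n))) - ?P (un (k n))) \<longlonglongrightarrow> m + 0 - ?P u"
      using LIMSEQ_subseq_LIMSEQ[OF LIMSEQ_inverse_real_of_nat k] P_lim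
      by (intro tendsto_intros) (auto simp: o_def)
    then have "\<forall>\<^sub>F n in sequentially. m + inverse (real (Suc (k n))) - ?P (un (k n)) < m - ?P u + e"
      by (rule order_tendstoD) (use that in simp)
    then show ?thesis
    proof eventually_elim
      case (elim n)
      then show ?case using un(2)[of "k n"] unfolding action_eq[OF W(1)[OF un(1)]] by linarith
    qed
  qed
  \<comment> \<open>The energies are below \<open>m - ?P u + e\<close> only eventually, while lower
    semicontinuity asks for a bound on every member; hence the initial terms are dropped, and
    \<open>e\<close> tends to 0 afterwards.\<close>
  have lsc: "u \<in> W1_orlicz T \<phi> \<and> ?E u \<le> m - ?P u + e" if e: "e > 0" for e
  proof -
    obtain N where N: "\<And>n. n \<ge> N \<Longrightarrow> ?E (un (k n)) < m - ?P u + e"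
      using E_lim[OF e] unfolding eventually_sequentially by blast
    have 1: "un (k (n + N)) \<in> W1_orlicz T \<phi>" for n by (rule W(1)[OF un(1)])
    have 2: "?E (un (k (n + N))) \<le> m - ?P u + e" for n by (rule less_imp_le[OF N]) simp
    have 3: "(\<lambda>n. un (k (n + N)) t) \<longlonglongrightarrow> u t" if "t \<in> {0..T}" for t
      by (rule LIMSEQ_ignore_initial_segment[OF u(2)[OF that]])
    from lower_semicontinuous[where un = "\<lambda>n. un (k (n + N))", OF 1 2 3] show ?thesis by blast
  qed
  then have uW: "u \<in> W1_orlicz T \<phi>" using zero_less_one by blast
  have "?E u \<le> m - ?P u" by (rule field_le_epsilon) (use lsc in blast)
  then have min: "?I u \<le> m" unfolding action_eq[OF uW] by linarith
  have "u 0 = u T"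
  proof -
    have "(\<lambda>n. un (k n) 0) \<longlonglongrightarrow> u 0" "(\<lambda>n. un (k n) T) \<longlonglongrightarrow> u T" using u(2) T by auto
    moreover have "un (k n) 0 = un (k n) T" for n by (rule W(2)[OF un(1)])
    ultimately show ?thesis using LIMSEQ_unique by auto
  qed
  then have "u \<in> ?W" using uW by (simp add: W1_orlicz_per_def)
  then show ?thesis using min m_le by (meson order_trans)
qed

end

section \<open>The Euler inclusion\<close>

text \<open>The clamped affine function that climbs from 0 at \<open>a\<close> to 1 at
  \<open>a + h\<close>; differences of two such ramps are the trapezoids used as test
  functions.\<close>

definition ramp :: "real \<Rightarrow> real \<Rightarrow> real \<Rightarrow> real" where
  "ramp h a t = max 0 (min 1 ((t - a) / h))"

lemma ramp_bounds: "0 \<le> ramp h a t" "ramp h a t \<le> 1"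
  by (auto simp: ramp_def)

lemma ramp_eq_0: "0 < h \<Longrightarrow> t \<le> a \<Longrightarrow> ramp h a t = 0"
  using divide_nonpos_pos[of "t - a" h] by (simp add: ramp_def)

lemma ramp_eq_1: "0 < h \<Longrightarrow> a + h \<le> t \<Longrightarrow> ramp h a t = 1"
  by (simp add: ramp_def min_def max_def field_simps)

lemma ramp_eq_linear: "0 < h \<Longrightarrow> a \<le> t \<Longrightarrow> t \<le> a + h \<Longrightarrow> ramp h a t = (t - a) / h"
  by (auto simp: ramp_def min_def max_def field_simps)

lemma ramp_antimono: "0 < h \<Longrightarrow> a \<le> a' \<Longrightarrow> ramp h a' t \<le> ramp h a t"
  unfolding ramp_def by (intro max.mono min.mono divide_right_mono) auto

lemma absolutely_continuous_on_ramp: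
  assumes "0 < h"
  shows "absolutely_continuous_on S (ramp h a)"
proof (rule absolutely_continuous_on_dominated[OF
      absolutely_continuous_on_scale[OF absolutely_continuous_on_ident, of S "1 / h"] absolutely_continuous_on_const])
  fix x y :: real assume "x \<le> y"
  have "\<bar>ramp h a y - ramp h a x\<bar> \<le> \<bar>(y - a) / h - (x - a) / h\<bar>"
    unfolding ramp_def by (auto simp: max_def min_def)
  also have "(y - a) / h - (x - a) / h = (1 / h) * y - (1 / h) * x" by (simp add: diff_divide_distrib)
  finally show "norm (ramp h a y - ramp h a x) \<le> norm ((1 / h) *\<^sub>R y - (1 / h) *\<^sub>R x) + norm (0 - 0 :: real)"
    by simp
qed

lemma ramp_has_vector_derivative:
  assumes h: "0 < h" and t: "t \<noteq> a" "t \<noteq> a + h"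
  shows "(ramp h a has_vector_derivative indicator {a<..<a + h} t / h) (at t within S)"
proof -
  consider "t < a" | "a < t" "t < a + h" | "a + h < t" using t by linarith
  then have "(ramp h a has_vector_derivative indicator {a<..<a + h} t / h) (at t)"
  proof cases
    case 1
    have "((\<lambda>_. 0 :: real) has_vector_derivative 0) (at t)" by (rule has_vector_derivative_const)
    then have "(ramp h a has_vector_derivative 0) (at t)"
      by (rule has_vector_derivative_transform_within_open[where S = "{..<a}"]) (use 1 h in \<open>auto simp: ramp_eq_0\<close>)
    then show ?thesis using 1 by simp
  next
    case 2
    have "((\<lambda>t. (t - a) / h) has_vector_derivative 1 / h) (at t)"
      using h by (auto intro!: derivative_eq_intros simp: has_real_derivative_iff_has_vector_derivative[symmetric])
    then have "(ramp h a has_vector_derivative 1 / h) (at t)"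
      by (rule has_vector_derivative_transform_within_open[where S = "{a<..<a + h}"]) (use 2 h in \<open>auto simp: ramp_eq_linear\<close>)
    then show ?thesis using 2 by simp
  next
    case 3
    have "((\<lambda>_. 1 :: real) has_vector_derivative 0) (at t)" by (rule has_vector_derivative_const)
    then have "(ramp h a has_vector_derivative 0) (at t)"
      by (rule has_vector_derivative_transform_within_open[where S = "{a + h<..}"]) (use 3 h in \<open>auto simp: ramp_eq_1\<close>)
    then show ?thesis using 3 by simp
  qed
  then show ?thesis by (rule has_vector_derivative_at_within)
qed

section \<open>One-sided directional derivatives and the variational inequality\<close>

lemma quotient_limit_scale:
  fixes f :: "'a::real_normed_vector \<Rightarrow> real"
  assumes lim: "\<And>v. ((\<lambda>l. (f (x + l *\<^sub>R v) - f x) / l) \<longlongrightarrow> d v) (at_right 0)" and "0 \<le> c"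
  shows "d (c *\<^sub>R v) = c * d v"
proof (cases "c = 0")
  case True
  have "((\<lambda>l. (f (x + l *\<^sub>R 0) - f x) / l) \<longlongrightarrow> 0) (at_right 0)" by simp
  then have "d 0 = 0" using lim[of 0] tendsto_unique trivial_limit_at_right_real by blast
  then show ?thesis using True by simp
next
  case False
  then have c: "0 < c" using assms by simp
  have "((\<lambda>l. l * c) \<longlongrightarrow> 0) (at_right 0)" by (auto intro!: tendsto_eq_intros)
  moreover have "\<forall>\<^sub>F l in at_right 0. l * c \<in> {0<..} \<and> l * c \<noteq> 0"
    using eventually_at_right_less[of 0] by eventually_elim (use c in simp)
  ultimately have "filterlim (\<lambda>l. l * c) (at_right 0) (at_right 0)" unfolding filterlim_at by blast
  from filterlim_compose[OF lim[of v] this]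
  have "((\<lambda>l. c * ((f (x + (l * c) *\<^sub>R v) - f x) / (l * c))) \<longlongrightarrow> c * d v) (at_right 0)"
    by (rule tendsto_mult_left)
  then have "((\<lambda>l. (f (x + l *\<^sub>R (c *\<^sub>R v)) - f x) / l) \<longlongrightarrow> c * d v) (at_right 0)"
    using c by simp
  then show ?thesis using lim[of "c *\<^sub>R v"] tendsto_unique trivial_limit_at_right_real by blast
qed

lemma quotient_limit_lipschitz:
  fixes f :: "'a::real_normed_vector \<Rightarrow> real"
  assumes lim: "\<And>v. ((\<lambda>l. (f (x + l *\<^sub>R v) - f x) / l) \<longlongrightarrow> d v) (at_right 0)"
    and U: "open U" "x \<in> U" and L: "\<And>y z. y \<in> U \<Longrightarrow> z \<in> U \<Longrightarrow> \<bar>f y - f z\<bar> \<le> L * norm (y - z)"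
  shows "\<bar>d v - d w\<bar> \<le> L * norm (v - w)"
proof -
  have lim': "((\<lambda>l. \<bar>(f (x + l *\<^sub>R v) - f x) / l - (f (x + l *\<^sub>R w) - f x) / l\<bar>) \<longlongrightarrow> \<bar>d v - d w\<bar>) (at_right 0)"
    by (intro tendsto_intros lim)
  have near: "\<forall>\<^sub>F l in at_right 0. x + l *\<^sub>R z \<in> U" for z
  proof -
    have "((\<lambda>l. x + l *\<^sub>R z) \<longlongrightarrow> x) (at_right 0)" by (auto intro!: tendsto_eq_intros)
    then show ?thesis by (rule topological_tendstoD) (use U in auto)
  qed
  have "\<forall>\<^sub>F l in at_right 0. \<bar>(f (x + l *\<^sub>R v) - f x) / l - (f (x + l *\<^sub>R w) - f x) / l\<bar> \<le> L * norm (v - w)"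
    using near[of v] near[of w] eventually_at_right_less[of 0]
  proof eventually_elim
    case (elim l)
    have "\<bar>f (x + l *\<^sub>R v) - f (x + l *\<^sub>R w)\<bar> \<le> L * norm (l *\<^sub>R (v - w))"
      using L[OF elim(1,2)] by (simp add: scaleR_right_diff_distrib)
    also have "\<dots> = L * norm (v - w) * l" using elim(3) by simp
    finally show ?case using elim(3) by (simp add: diff_divide_distrib[symmetric] divide_le_eq)
  qed
  then show ?thesis by (rule tendsto_upperbound[OF lim']) simp
qed

text \<open>\<open>G t x v\<close> is the one-sided directional derivative of \<open>F t\<close>.
  That it equals Clarke's derivative is used outside the locale, where
  \<open>d \<bullet> v \<le> G t x v\<close> for all \<open>v\<close> is turned into membership in
  the Clarke gradient.\<close>

locale regular_periodic_action = periodic_action T \<phi> F b b1 C2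
  for T :: real and \<phi> :: "'a::euclidean_space \<Rightarrow> real" and F b b1 C2 +
  fixes G :: "real \<Rightarrow> 'a \<Rightarrow> 'a \<Rightarrow> real"
  assumes G: "\<And>t x v. t \<in> {0..T} \<Longrightarrow> ((\<lambda>l. (F t (x + l *\<^sub>R v) - F t x) / l) \<longlongrightarrow> G t x v) (at_right 0)"
begin

lemma inverse_Suc_at_right: "filterlim (\<lambda>n. inverse (real (Suc n))) (at_right 0) sequentially"
  unfolding filterlim_at using LIMSEQ_inverse_real_of_nat by auto

lemma G_scale:
  assumes "t \<in> {0..T}" "0 \<le> c"
  shows "G t x (c *\<^sub>R v) = c * G t x v"
  by (rule quotient_limit_scale[where f = "F t" and x = x, OF G[OF assms(1)] assms(2)])

lemma G_lipschitz:
  assumes "t \<in> {0..T}" "norm x < R"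
    and "\<And>x y. x \<in> ball 0 R \<Longrightarrow> y \<in> ball 0 R \<Longrightarrow> \<bar>F t x - F t y\<bar> \<le> L * norm (x - y)"
  shows "\<bar>G t x v - G t x w\<bar> \<le> L * norm (v - w)"
  by (rule quotient_limit_lipschitz[where f = "F t" and x = x, OF G[OF assms(1)], of "ball 0 R"])
     (use assms in auto)

lemma G_comp_measurable:
  assumes w: "continuous_on {0..T} w"
  shows "(\<lambda>t. G t (w t) v) \<in> borel_measurable (lebesgue_on {0..T})"
proof (rule borel_measurable_LIMSEQ_real)
  let ?s = "\<lambda>n. inverse (real (Suc n))"
  show "(\<lambda>n. (F t (w t + ?s n *\<^sub>R v) - F t (w t)) / ?s n) \<longlonglongrightarrow> G t (w t) v"
    if "t \<in> space (lebesgue_on {0..T})" for t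
    by (rule filterlim_compose[OF G inverse_Suc_at_right]) (use that in simp)
  have "(\<lambda>t. F t (w t + ?s n *\<^sub>R v)) \<in> borel_measurable (lebesgue_on {0..T})" for n
    by (rule F_comp_measurable) (intro continuous_intros w)
  then show "(\<lambda>t. (F t (w t + ?s n *\<^sub>R v) - F t (w t)) / ?s n) \<in> borel_measurable (lebesgue_on {0..T})" for n
    using F_comp_measurable[OF w] by measurable
qed

text \<open>The margin \<open>d\<close> leaves room for the varied curve: \<open>u\<close> and its
  variation lie in one ball, with one Lipschitz constant.\<close>

lemma local_constant:
  assumes u: "continuous_on {0..T} u"
  obtains R C where "\<And>t. t \<in> {0..T} \<Longrightarrow> norm (u t) + d < R" "0 \<le> C"
    "\<And>t x y. t \<in> {0..T} \<Longrightarrow> x \<in> ball 0 R \<Longrightarrow> y \<in> ball 0 R \<Longrightarrow> \<bar>F t x - F t y\<bar> \<le> C * b t * norm (x - y)"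
proof -
  have "bounded (u ` {0..T})" by (rule compact_imp_bounded[OF compact_continuous_image[OF u]]) simp
  then obtain r where r: "u ` {0..T} \<subseteq> ball 0 r" using bounded_subset_ballD by blast
  have R: "norm (u t) + d < r + d" if "t \<in> {0..T}" for t using r that by (auto simp: image_subset_iff)
  obtain C where "0 \<le> C" "\<And>t x y. t \<in> {0..T} \<Longrightarrow> x \<in> ball 0 (r + d) \<Longrightarrow> y \<in> ball 0 (r + d) \<Longrightarrow>
      \<bar>F t x - F t y\<bar> \<le> C * b t * norm (x - y)"
    using F_local[of "r + d"] by metis
  with R show thesis by (rule that)
qed

lemma G_comp_bound:
  assumes u: "continuous_on {0..T} u"
  obtains C where "0 \<le> C" "\<And>t v w. t \<in> {0..T} \<Longrightarrow> \<bar>G t (u t) v - G t (u t) w\<bar> \<le> C * b t * norm (v - w)"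
    "\<And>t v. t \<in> {0..T} \<Longrightarrow> \<bar>G t (u t) v\<bar> \<le> C * b t * norm v"
proof -
  obtain R C where RC: "\<And>t. t \<in> {0..T} \<Longrightarrow> norm (u t) + 0 < R" "0 \<le> C"
    "\<And>t x y. t \<in> {0..T} \<Longrightarrow> x \<in> ball 0 R \<Longrightarrow> y \<in> ball 0 R \<Longrightarrow> \<bar>F t x - F t y\<bar> \<le> C * b t * norm (x - y)"
    using local_constant[OF u, of 0] by blast
  have lip: "\<bar>G t (u t) v - G t (u t) w\<bar> \<le> C * b t * norm (v - w)" if "t \<in> {0..T}" for t v w
    by (rule G_lipschitz[OF that _ RC(3)[OF that]]) (use RC(1)[OF that] in simp)
  have "\<bar>G t (u t) v\<bar> \<le> C * b t * norm v" if "t \<in> {0..T}" for t v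
    using lip[OF that, of v 0] G_scale[OF that, of 0 "u t" 0] by simp
  then show thesis using that RC(2) lip by blast
qed

lemma G_comp_integrable:
  assumes u: "continuous_on {0..T} u"
  shows "(\<lambda>t. G t (u t) v) absolutely_integrable_on {0..T}"
proof -
  obtain C where "0 \<le> C" "\<And>t v w. t \<in> {0..T} \<Longrightarrow> \<bar>G t (u t) v - G t (u t) w\<bar> \<le> C * b t * norm (v - w)"
    and C: "\<And>t v. t \<in> {0..T} \<Longrightarrow> \<bar>G t (u t) v\<bar> \<le> C * b t * norm v"
    using G_comp_bound[OF u] by metis
  show ?thesis
  proof (rule absolutely_integrableI_bounded[OF G_comp_measurable[OF u]])
    show "(\<lambda>t. (C * norm v) * b t) absolutely_integrable_on {0..T}"
      using b_int by (rule set_integrable_mult_right)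
  qed (use C[of _ v] in \<open>simp add: mult.commute mult.left_commute\<close>)
qed

text \<open>Compare \<open>u\<close> with its variation by \<open>s n * \<theta> t\<close> in
  direction \<open>e\<close>, divide by \<open>s n\<close> and pass to the limit by dominated
  convergence in both integrals. Nonnegativity of \<theta> is what allows
  \<open>G t (u t) (\<theta> t *\<^sub>R e)\<close> to be written as \<theta> times the derivative
  in direction \<open>e\<close>.\<close>

lemma euler_inequality:
  fixes \<theta> \<theta>' :: "real \<Rightarrow> real"
  assumes u: "u \<in> W1_orlicz_per T \<phi>"
    and min: "\<And>v. v \<in> W1_orlicz_per T \<phi> \<Longrightarrow> action T \<phi> F u \<le> action T \<phi> F v"
    and \<theta>_ac: "absolutely_continuous_on {0..T} \<theta>" and \<theta>_per: "\<theta> 0 = \<theta> T"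
    and \<theta>: "\<And>t. t \<in> {0..T} \<Longrightarrow> 0 \<le> \<theta> t \<and> \<theta> t \<le> 1"
    and \<theta>'_meas: "\<theta>' \<in> borel_measurable (lebesgue_on {0..T})"
    and \<theta>'_bound: "\<And>t. t \<in> {0..T} \<Longrightarrow> \<bar>\<theta>' t\<bar> \<le> K"
    and \<theta>_deriv: "negligible N"
      "\<And>t. t \<in> {0..T} \<Longrightarrow> t \<notin> N \<Longrightarrow> (\<theta> has_vector_derivative \<theta>' t) (at t within {0..T})"
  shows "0 \<le> integral {0..T} (\<lambda>t. \<theta>' t * (grad \<phi> (D u t) \<bullet> e)) + integral {0..T} (\<lambda>t. \<theta> t * G t (u t) e)"
proof -
  have uW: "u \<in> W1_orlicz T \<phi>" and u_per: "u 0 = u T" using u by (auto simp: W1_orlicz_per_def)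
  note [measurable] = deriv_measurable[OF W1_D(1)[OF uW]] \<theta>'_meas
  define s where "s n = inverse (real (Suc n))" for n
  have s: "0 < s n" "s n \<le> 1" for n by (auto simp: s_def field_simps)
  have s_lim: "filterlim s (at_right 0) sequentially" unfolding s_def by (rule inverse_Suc_at_right)
  define v where "v n t = u t + (s n * \<theta> t) *\<^sub>R e" for n t
  define dv where "dv n t = D u t + s n *\<^sub>R (\<theta>' t *\<^sub>R e)" for n t
  have "0 \<le> K" using \<theta>'_bound[of 0] T by force
  \<comment> \<open>\<open>S\<close> bounds \<phi> at twice every perturbation of the derivative
    that occurs; the factor 2 is the one in \<open>phi_add_le\<close>.\<close>
  obtain S where S: "\<And>x. norm x \<le> 2 * K * norm e \<Longrightarrow> \<phi> x \<le> S"
  proof -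
    have "bounded (\<phi> ` cball 0 (2 * K * norm e))"
      by (intro compact_imp_bounded compact_continuous_image phi_continuous) auto
    then obtain S where "\<forall>y\<in>\<phi> ` cball 0 (2 * K * norm e). norm y \<le> S"
      unfolding bounded_iff by blast
    then show thesis by (intro that[of S]) (simp add: abs_le_iff)
  qed
  have shift: "\<phi> (D u t + c *\<^sub>R (\<theta>' t *\<^sub>R e)) \<le> C2 * \<phi> (D u t) + 1 + S" if t: "t \<in> {0..T}" and c: "\<bar>c\<bar> \<le> 1" for t c
  proof -
    have "norm (2 *\<^sub>R (c *\<^sub>R (\<theta>' t *\<^sub>R e))) = 2 * (\<bar>c\<bar> * \<bar>\<theta>' t\<bar>) * norm e" by (simp add: abs_mult)
    also have "\<dots> \<le> 2 * (1 * K) * norm e"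
      using c \<theta>'_bound[OF t] by (intro mult_right_mono mult_left_mono mult_mono) auto
    finally have "\<phi> (2 *\<^sub>R (c *\<^sub>R (\<theta>' t *\<^sub>R e))) \<le> S" by (intro S) simp
    then show ?thesis using phi_add_le[of "D u t" "c *\<^sub>R (\<theta>' t *\<^sub>R e)"] by linarith
  qed
  have dom: "(\<lambda>t. C2 * \<phi> (D u t) + 1 + S) absolutely_integrable_on {0..T}"
    using W1_D(3)[OF uW] by (intro set_integral_add(1) set_integrable_mult_right) (auto simp: absolutely_integrable_on_const)
  have phi_dv: "(\<lambda>t. \<phi> (dv n t)) absolutely_integrable_on {0..T}" for n
  proof (rule absolutely_integrableI_bounded[OF _ dom])
    show "(\<lambda>t. \<phi> (dv n t)) \<in> borel_measurable (lebesgue_on {0..T})" unfolding dv_def by measurable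
    show "norm (\<phi> (dv n t)) \<le> C2 * \<phi> (D u t) + 1 + S" if "t \<in> {0..T}" for t
      using shift[OF that, of "s n"] s[of n] phi_nonneg[of "dv n t"] by (simp add: dv_def)
  qed
  obtain N' where N': "negligible N'"
    "\<And>t. t \<in> {0..T} \<Longrightarrow> t \<notin> N' \<Longrightarrow> (u has_vector_derivative D u t) (at t within {0..T})"
    using AE_lebesgue_onE[OF absolutely_continuous_FTC(3)[OF W1_D(1)[OF uW] T]] by auto
  have Dv: "D (v n) t = dv n t" if "t \<in> {0..T}" "t \<notin> N \<union> N'" for n t
    unfolding deriv_on_def
  proof (rule vector_derivative_within_closed_interval)
    have "(\<theta> has_vector_derivative \<theta>' t) (at t within {0..T})" using \<theta>_deriv(2) that by blast
    then have \<theta>e: "((\<lambda>t. (s n * \<theta> t) *\<^sub>R e) has_vector_derivative (s n * \<theta>' t) *\<^sub>R e) (at t within {0..T})"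
      by (auto intro!: derivative_eq_intros simp: has_real_derivative_iff_has_vector_derivative[symmetric])
    have "(u has_vector_derivative D u t) (at t within {0..T})" using N'(2) that by blast
    from has_vector_derivative_add[OF this \<theta>e]
    show "(v n has_vector_derivative dv n t) (at t within {0..T})"
      by (simp add: v_def[abs_def] dv_def)
  qed (use that T in auto)
  have neg: "negligible (N \<union> N')" using \<theta>_deriv(1) N'(1) by (rule negligible_Un)
  have vW: "v n \<in> W1_orlicz T \<phi>" for n
    unfolding W1_iff
  proof
    show "absolutely_continuous_on {0..T} (v n)"
    proof (rule absolutely_continuous_on_dominated[OF W1_D(1)[OF uW] absolutely_continuous_on_scale[OF \<theta>_ac, of "norm e"]])
      fix x y
      have "v n y - v n x = (u y - u x) + (s n * (\<theta> y - \<theta> x)) *\<^sub>R e"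
        by (simp add: v_def algebra_simps)
      then have "norm (v n y - v n x) \<le> norm (u y - u x) + s n * (\<bar>\<theta> y - \<theta> x\<bar> * norm e)"
        using norm_triangle_ineq[of "u y - u x" "(s n * (\<theta> y - \<theta> x)) *\<^sub>R e"] s(1)[of n]
        by (simp add: abs_mult mult.assoc)
      also have "s n * (\<bar>\<theta> y - \<theta> x\<bar> * norm e) \<le> 1 * (\<bar>\<theta> y - \<theta> x\<bar> * norm e)"
        using s(2)[of n] by (intro mult_right_mono) auto
      also have "\<dots> = norm (norm e *\<^sub>R \<theta> y - norm e *\<^sub>R \<theta> x)"
        by (simp add: abs_mult mult.commute flip: right_diff_distrib)
      finally show "norm (v n y - v n x) \<le> norm (u y - u x) + norm (norm e *\<^sub>R \<theta> y - norm e *\<^sub>R \<theta> x)" by simp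
    qed
    show "(\<lambda>t. \<phi> (D (v n) t)) absolutely_integrable_on {0..T}"
      by (rule absolutely_integrable_spike[OF phi_dv[of n] neg]) (use Dv in auto)
  qed
  have E_v: "integral {0..T} (\<lambda>t. \<phi> (D (v n) t)) = integral {0..T} (\<lambda>t. \<phi> (dv n t))" for n
    by (rule integral_spike[OF neg]) (use Dv in auto)
  have v_per: "v n \<in> W1_orlicz_per T \<phi>" for n
    using vW u_per \<theta>_per by (simp add: W1_orlicz_per_def v_def)
  define q where "q n t = (\<phi> (D u t + s n *\<^sub>R (\<theta>' t *\<^sub>R e)) - \<phi> (D u t)) / s n" for n t
  define r where "r n t = (F t (v n t) - F t (u t)) / s n" for n t
  note abs_int = set_lebesgue_integral_eq_integral(1)
  have Fv: "(\<lambda>t. F t (v n t)) absolutely_integrable_on {0..T}" for n by (rule F_comp_integrable[OF W1_D(2)[OF vW]])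
  have Fu: "(\<lambda>t. F t (u t)) absolutely_integrable_on {0..T}" by (rule F_comp_integrable[OF W1_D(2)[OF uW]])
  have q_int: "q n absolutely_integrable_on {0..T}" for n
    using set_integrable_divide[OF set_integral_diff(1)[OF phi_dv[of n] W1_D(3)[OF uW]], of "s n"]
    by (simp add: q_def[abs_def] dv_def)
  have r_int: "r n absolutely_integrable_on {0..T}" for n
    using set_integrable_divide[OF set_integral_diff(1)[OF Fv[of n] Fu], of "s n"] by (simp add: r_def[abs_def])
  have ge0: "0 \<le> integral {0..T} (q n) + integral {0..T} (r n)" for n
  proof -
    have "0 \<le> (action T \<phi> F (v n) - action T \<phi> F u) / s n" using min[OF v_per[of n]] s(1)[of n] by simp
    also have "\<dots> = (integral {0..T} (\<lambda>t. \<phi> (dv n t)) - integral {0..T} (\<lambda>t. \<phi> (D u t))) / s n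
        + (integral {0..T} (\<lambda>t. F t (v n t)) - integral {0..T} (\<lambda>t. F t (u t))) / s n"
      unfolding action_eq[OF vW] action_eq[OF uW] E_v by (simp add: add_divide_distrib diff_divide_distrib)
    also have "(integral {0..T} (\<lambda>t. \<phi> (dv n t)) - integral {0..T} (\<lambda>t. \<phi> (D u t))) / s n = integral {0..T} (q n)"
      using abs_int[OF phi_dv[of n]] abs_int[OF W1_D(3)[OF uW]]
      by (simp add: q_def[abs_def] dv_def Henstock_Kurzweil_Integration.integral_diff)
    also have "(integral {0..T} (\<lambda>t. F t (v n t)) - integral {0..T} (\<lambda>t. F t (u t))) / s n = integral {0..T} (r n)"
      using abs_int[OF Fv[of n]] abs_int[OF Fu]
      by (simp add: r_def[abs_def] Henstock_Kurzweil_Integration.integral_diff)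
    finally show ?thesis .
  qed
  have q_lim: "(\<lambda>n. integral {0..T} (q n)) \<longlonglongrightarrow> integral {0..T} (\<lambda>t. \<theta>' t * (grad \<phi> (D u t) \<bullet> e))"
  proof (rule dominated_convergence(2)[OF abs_int[OF q_int]])
    \<comment> \<open>This dominates the kinetic quotients for all step sizes at once: two
      applications of \<open>shift\<close>, with \<open>c\<close> equal to 1 and to -1, plus the
      unperturbed term.\<close>
    show "(\<lambda>t. 2 * (C2 * \<phi> (D u t) + 1 + S) + \<phi> (D u t)) integrable_on {0..T}"
      by (intro integrable_add integrable_on_mult_right abs_int dom W1_D(3)[OF uW])
    show "norm (q n t) \<le> 2 * (C2 * \<phi> (D u t) + 1 + S) + \<phi> (D u t)" if t: "t \<in> {0..T}" for n t
    proof -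
      have "\<bar>q n t\<bar> \<le> \<phi> (D u t + \<theta>' t *\<^sub>R e) + \<phi> (D u t - \<theta>' t *\<^sub>R e) + \<phi> (D u t)"
        unfolding q_def by (rule convex_quotient_abs_le[OF convex diff s phi_nonneg])
      then show ?thesis using shift[OF t, of 1] shift[OF t, of "- 1"] by simp
    qed
    show "(\<lambda>n. q n t) \<longlonglongrightarrow> \<theta>' t * (grad \<phi> (D u t) \<bullet> e)" if "t \<in> {0..T}" for t
      using filterlim_compose[OF grad_quotient_tendsto[OF diff, of "D u t" "\<theta>' t *\<^sub>R e"] s_lim] by (simp add: q_def)
  qed
  have r_lim: "(\<lambda>n. integral {0..T} (r n)) \<longlonglongrightarrow> integral {0..T} (\<lambda>t. \<theta> t * G t (u t) e)"
  proof -
    obtain R C where RC: "\<And>t. t \<in> {0..T} \<Longrightarrow> norm (u t) + norm e < R" "0 \<le> C"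
      "\<And>t x y. t \<in> {0..T} \<Longrightarrow> x \<in> ball 0 R \<Longrightarrow> y \<in> ball 0 R \<Longrightarrow> \<bar>F t x - F t y\<bar> \<le> C * b t * norm (x - y)"
      using local_constant[OF W1_D(2)[OF uW], of "norm e"] by blast
    show ?thesis
    proof (rule dominated_convergence(2)[OF abs_int[OF r_int]])
      show "(\<lambda>t. (C * norm e) * b t) integrable_on {0..T}" by (intro integrable_on_mult_right abs_int b_int)
      show "norm (r n t) \<le> (C * norm e) * b t" if t: "t \<in> {0..T}" for n t
      proof -
        have st: "0 \<le> s n * \<theta> t" "s n * \<theta> t \<le> s n" "s n * \<theta> t \<le> 1"
          using s[of n] \<theta>[OF t] mult_left_mono[of "\<theta> t" 1 "s n"] mult_le_one[of "s n" "\<theta> t"] by auto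
        have d: "norm (v n t - u t) = (s n * \<theta> t) * norm e" using st(1) by (simp add: v_def)
        have "norm (v n t) \<le> norm (u t) + norm (v n t - u t)" using norm_triangle_ineq[of "u t" "v n t - u t"] by simp
        also have "norm (v n t - u t) \<le> 1 * norm e" unfolding d using st(3) by (intro mult_right_mono) auto
        finally have "v n t \<in> ball 0 R" using RC(1)[OF t] by simp
        moreover have "norm (u t) \<le> norm (u t) + norm e" by simp
        then have "u t \<in> ball 0 R" using RC(1)[OF t] by (simp only: mem_ball_0)
        ultimately have "\<bar>F t (v n t) - F t (u t)\<bar> \<le> C * b t * norm (v n t - u t)" by (rule RC(3)[OF t])
        also have "\<dots> \<le> C * b t * (s n * norm e)"
          unfolding d using st(2) RC(2) b_nonneg[OF t] by (intro mult_left_mono mult_right_mono) auto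
        finally show ?thesis using s(1)[of n] by (simp add: r_def divide_le_eq mult.commute mult.left_commute)
      qed
      show "(\<lambda>n. r n t) \<longlonglongrightarrow> \<theta> t * G t (u t) e" if t: "t \<in> {0..T}" for t
        using filterlim_compose[OF G[OF t, of "u t" "\<theta> t *\<^sub>R e"] s_lim] G_scale[OF t, of "\<theta> t" "u t" e] \<theta>[OF t]
        by (simp add: r_def v_def)
    qed
  qed
  show ?thesis by (rule LIMSEQ_le_const[OF tendsto_add[OF q_lim r_lim]]) (use ge0 in auto)
qed

end

section \<open>The momentum: increments, continuous representative, periodicity\<close>

lemma integral_indicator_interval:
  fixes f :: "real \<Rightarrow> real"
  assumes "f integrable_on {0..T}" "0 \<le> x" "y \<le> T"
  shows "(\<lambda>t. indicator {x<..<y} t * f t) integrable_on {0..T}"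
    and "integral {0..T} (\<lambda>t. indicator {x<..<y} t * f t) = integral {x..y} f"
proof -
  have e: "{x<..<y} \<inter> {0..T} = {x<..<y}" using assms(2,3) by auto
  have eq: "(\<lambda>t. indicator {x<..<y} t * f t) = (\<lambda>t. if t \<in> {x<..<y} then f t else 0)"
    by (auto simp: indicator_def)
  have "f integrable_on {x..y}" by (rule integrable_on_subinterval[OF assms(1)]) (use assms in auto)
  then have "f integrable_on {x<..<y}" by (simp only: integrable_on_open_interval_real)
  then show "(\<lambda>t. indicator {x<..<y} t * f t) integrable_on {0..T}"
    unfolding eq integrable_restrict_Int e .
  show "integral {0..T} (\<lambda>t. indicator {x<..<y} t * f t) = integral {x..y} f"
    unfolding eq integral_restrict_Int e by (rule integral_open_interval_real[symmetric])
qed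

lemma closure_interval_minus_negligible:
  fixes T :: real
  assumes "negligible N" "0 < T"
  shows "{0..T} \<subseteq> closure ({0<..<T} - N)"
proof
  fix x assume x: "x \<in> {0..T}"
  show "x \<in> closure ({0<..<T} - N)"
    unfolding closure_approachable
  proof (intro allI impI)
    fix e :: real assume "e > 0"
    define l r where "l = max 0 (x - e)" and "r = min T (x + e)"
    have "l < r" using x \<open>e > 0\<close> \<open>0 < T\<close> by (auto simp: l_def r_def)
    then have "\<not> negligible {l<..<r}" using negligible_interval(2)[of l r] by simp
    then have "\<not> {l<..<r} \<subseteq> N" using assms(1) negligible_subset by blast
    then obtain y where "y \<in> {l<..<r}" "y \<notin> N" by blast
    then show "\<exists>y\<in>{0<..<T} - N. dist y x < e"
      by (intro bexI[of _ y]) (auto simp: l_def r_def dist_real_def)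
  qed
qed

context regular_periodic_action
begin

text \<open>The subgradient inequality in directions \<open>i\<close> and \<open>- i\<close> traps
  each component of the gradient between differences of \<phi>, and the \<Delta>2-condition bounds
  the shifted values by \<phi> at the derivative.\<close>

lemma momentum_integrable:
  assumes u: "u \<in> W1_orlicz T \<phi>"
  shows "(\<lambda>t. grad \<phi> (D u t)) absolutely_integrable_on {0..T}"
proof (subst absolutely_integrable_componentwise_iff, rule ballI)
  fix i :: 'a assume "i \<in> Basis"
  note [measurable] = borel_measurable_grad[OF diff deriv_measurable[OF W1_D(1)[OF u]]]
  show "(\<lambda>t. grad \<phi> (D u t) \<bullet> i) absolutely_integrable_on {0..T}"
  proof (rule absolutely_integrableI_bounded)
    show "(\<lambda>t. (2 * C2) * \<phi> (D u t) + (2 + \<phi> (2 *\<^sub>R i) + \<phi> (2 *\<^sub>R (- i)))) absolutely_integrable_on {0..T}"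
      using W1_D(3)[OF u]
      by (intro set_integral_add(1) set_integrable_mult_right) (auto simp: absolutely_integrable_on_const)
    fix t
    have "grad \<phi> (D u t) \<bullet> i \<le> \<phi> (D u t + i) - \<phi> (D u t)"
      using convex_subgradient[OF convex diff, of "D u t" i] by simp
    moreover have "\<phi> (D u t) - \<phi> (D u t + (- i)) \<le> grad \<phi> (D u t) \<bullet> i"
      using convex_subgradient[OF convex diff, of "D u t" "- i"] by simp
    moreover note phi_add_le[of "D u t" i] phi_add_le[of "D u t" "- i"]
      phi_nonneg[of "D u t"] phi_nonneg[of "D u t + i"] phi_nonneg[of "D u t + (- i)"]
    ultimately show "norm (grad \<phi> (D u t) \<bullet> i) \<le> (2 * C2) * \<phi> (D u t) + (2 + \<phi> (2 *\<^sub>R i) + \<phi> (2 *\<^sub>R (- i)))"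
      using mult_nonneg_nonneg[of C2 "\<phi> (D u t)"] Delta2(1) phi_nonneg[of "2 *\<^sub>R i"] phi_nonneg[of "2 *\<^sub>R (- i)"]
      by (simp add: abs_le_iff)
  qed measurable
qed

text \<open>The Euler inequality is tested with the trapezoid that is \<open>1\<close> on \<open>[s + h, r]\<close>, and with \<open>1\<close>
  minus this trapezoid, which is periodic as well and links the two ends of the interval.\<close>

lemma momentum_increment:
  fixes u e
  defines "P \<equiv> \<lambda>t. grad \<phi> (D u t)" and "g \<equiv> \<lambda>t. G t (u t) e"
  assumes u: "u \<in> W1_orlicz_per T \<phi>"
    and min: "\<And>v. v \<in> W1_orlicz_per T \<phi> \<Longrightarrow> action T \<phi> F u \<le> action T \<phi> F v"
    and sr: "0 \<le> s" "s < r" "r < T"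
    and Ps: "((\<lambda>t. integral {0..t} P) has_vector_derivative P s) (at s within {0..T})"
    and Pr: "((\<lambda>t. integral {0..t} P) has_vector_derivative P r) (at r within {0..T})"
  shows "(P r - P s) \<bullet> e \<le> integral {s..r} g"
    and "(P s - P r) \<bullet> e \<le> integral {0..T} g - integral {s..r} g"
proof -
  have uW: "u \<in> W1_orlicz T \<phi>" using u by (simp add: W1_orlicz_per_def)
  note abs_int = set_lebesgue_integral_eq_integral(1)
  have P_int: "P integrable_on {0..T}" unfolding P_def by (rule abs_int[OF momentum_integrable[OF uW]])
  have Pe_int: "(\<lambda>t. P t \<bullet> e) integrable_on {0..T}"
    using integrable_linear[OF P_int bounded_linear_inner_left[of e]] by (simp add: o_def)
  have g_abs: "g absolutely_integrable_on {0..T}" unfolding g_def by (rule G_comp_integrable[OF W1_D(2)[OF uW]])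
  have g_int: "g integrable_on {0..T}" by (rule abs_int[OF g_abs])
  \<comment> \<open>Steps bounded by \<open>d\<close> keep the first ramp to the left of the second,
    and the second inside \<open>{0..T}\<close>; so the trapezoid vanishes at both ends.\<close>
  define d where "d = min (r - s) (T - r)"
  have d: "0 < d" "d \<le> r - s" "d \<le> T - r" using sr by (auto simp: d_def)
  obtain h where h0: "\<And>n. 0 < h n" "\<And>n. h n \<le> d" and h_lim: "h \<longlonglongrightarrow> 0"
    using vanishing_steps[OF d(1)] by metis
  have h: "0 < h n" "s + h n \<le> r" "r + h n \<le> T" for n
    using h0[of n] d by auto
  define H where "H t = integral {0..t} P" for t
  have H_diff: "integral {x..y} (\<lambda>t. P t \<bullet> e) = (H y - H x) \<bullet> e" if "0 \<le> x" "x \<le> y" "y \<le> T" for x y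
  proof -
    have "integral {x..y} P = H y - H x" unfolding H_def by (rule integral_subinterval_diff[OF P_int that])
    moreover have "P integrable_on {x..y}" by (rule integrable_on_subinterval[OF P_int]) (use that in auto)
    ultimately show ?thesis
      using integral_linear[of P "{x..y}" "\<lambda>v. v \<bullet> e"] bounded_linear_inner_left by (simp add: o_def)
  qed
  define \<theta> where "\<theta> n t = ramp (h n) s t - ramp (h n) r t" for n t
  define \<theta>' where "\<theta>' n t = (indicator {s<..<s + h n} t - indicator {r<..<r + h n} t) / h n" for n and t :: real
  define A where "A n = integral {0..T} (\<lambda>t. \<theta>' n t * (P t \<bullet> e))" for n
  define B where "B n = integral {0..T} (\<lambda>t. \<theta> n t * g t)" for n
  have \<theta>_bounds: "0 \<le> \<theta> n t" "\<theta> n t \<le> 1" for n t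
    using ramp_antimono[OF h(1)[of n], of s r t] sr ramp_bounds[of "h n" s t] ramp_bounds[of "h n" r t]
    by (auto simp: \<theta>_def)
  have \<theta>_ac: "absolutely_continuous_on {0..T} (\<theta> n)" for n
    unfolding \<theta>_def
  proof (rule absolutely_continuous_on_dominated[OF absolutely_continuous_on_ramp[OF h(1)[of n], of _ s]
          absolutely_continuous_on_ramp[OF h(1)[of n], of _ r]])
    fix x y
    show "norm (ramp (h n) s y - ramp (h n) r y - (ramp (h n) s x - ramp (h n) r x))
        \<le> norm (ramp (h n) s y - ramp (h n) s x) + norm (ramp (h n) r y - ramp (h n) r x)"
      using norm_triangle_ineq4[of "ramp (h n) s y - ramp (h n) s x" "ramp (h n) r y - ramp (h n) r x"]
      by (simp add: algebra_simps)
  qed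
  have \<theta>g_int: "(\<lambda>t. \<theta> n t * g t) integrable_on {0..T}" for n
  proof -
    have "\<theta> n \<in> borel_measurable (lebesgue_on {0..T})"
      by (rule continuous_imp_measurable_on_sets_lebesgue[OF absolutely_continuous_on_imp_continuous_on[OF \<theta>_ac]]) (rule sets_Icc)
    then have "(\<lambda>t. \<theta> n t * g t) \<in> borel_measurable (lebesgue_on {0..T})"
      using absolutely_integrable_imp_borel_measurable[OF g_abs sets_Icc] by measurable
    then have "(\<lambda>t. \<theta> n t * g t) absolutely_integrable_on {0..T}"
      by (rule absolutely_integrableI_bounded[OF _ absolutely_integrable_norm[OF g_abs, unfolded o_def]])
         (use \<theta>_bounds[of n] in \<open>simp add: abs_mult mult_left_le_one_le\<close>)
    then show ?thesis by (rule abs_int)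
  qed
  have \<theta>_ends: "\<theta> n 0 = 0" "\<theta> n T = 0" for n
    using h[of n] sr by (auto simp: \<theta>_def ramp_eq_0 ramp_eq_1)
  have \<theta>'_meas: "\<theta>' n \<in> borel_measurable (lebesgue_on {0..T})" for n
  proof -
    have "\<theta>' n \<in> borel_measurable borel" unfolding \<theta>'_def by measurable
    then show ?thesis by (intro measurable_restrict_space1 measurable_completion) simp
  qed
  have \<theta>'_bound: "\<bar>\<theta>' n t\<bar> \<le> 1 / h n" for n t
    using h(1)[of n] unfolding \<theta>'_def by (auto simp: indicator_def abs_divide divide_right_mono)
  have \<theta>_deriv: "(\<theta> n has_vector_derivative \<theta>' n t) (at t within {0..T})"
    if "t \<notin> {s, s + h n, r, r + h n}" for n t
    unfolding \<theta>_def \<theta>'_def diff_divide_distrib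
    using that by (intro has_vector_derivative_diff ramp_has_vector_derivative h(1)) auto
  have neg: "negligible {s, s + h n, r, r + h n}" for n by (rule negligible_finite) simp
  have AB: "0 \<le> A n + B n" for n
    unfolding A_def B_def P_def g_def
    using euler_inequality[OF u min \<theta>_ac[of n] _ _ \<theta>'_meas[of n] \<theta>'_bound[of n] neg[of n] \<theta>_deriv[of _ n], of e]
      \<theta>_ends[of n] \<theta>_bounds[of n] by simp
  have AB': "0 \<le> - A n + (integral {0..T} g - B n)" for n
  proof -
    have "0 \<le> integral {0..T} (\<lambda>t. - \<theta>' n t * (P t \<bullet> e)) + integral {0..T} (\<lambda>t. (1 - \<theta> n t) * g t)"
      unfolding P_def g_def
    proof (rule euler_inequality[OF u min, where N = "{s, s + h n, r, r + h n}" and K = "1 / h n"])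
      show "absolutely_continuous_on {0..T} (\<lambda>t. 1 - \<theta> n t)"
        by (rule absolutely_continuous_on_dominated[OF \<theta>_ac[of n] absolutely_continuous_on_const[of _ "0 :: real"]])
           (simp add: abs_minus_commute)
      show "((\<lambda>t. 1 - \<theta> n t) has_vector_derivative - \<theta>' n t) (at t within {0..T})"
        if "t \<notin> {s, s + h n, r, r + h n}" for t
        using has_vector_derivative_diff[OF has_vector_derivative_const[of 1] \<theta>_deriv[OF that]] by simp
      show "(\<lambda>t. - \<theta>' n t) \<in> borel_measurable (lebesgue_on {0..T})" using \<theta>'_meas[of n] by measurable
    qed (use \<theta>_ends[of n] \<theta>_bounds[of n] \<theta>'_bound[of n] neg[of n] in auto)
    moreover have "integral {0..T} (\<lambda>t. (1 - \<theta> n t) * g t) = integral {0..T} g - B n"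
      using g_int \<theta>g_int[of n] by (simp add: B_def left_diff_distrib Henstock_Kurzweil_Integration.integral_diff)
    ultimately show ?thesis by (simp add: A_def)
  qed
  have A_lim: "A \<longlonglongrightarrow> (P s - P r) \<bullet> e"
  proof -
    \<comment> \<open>The slopes of the trapezoid turn \<open>A n\<close> into a difference of two
      right averages of \<open>P\<close>, taken at \<open>s\<close> and \<open>r\<close>, where the
      primitive is differentiable by assumption.\<close>
    have "A = (\<lambda>n. ((H (s + h n) - H s) /\<^sub>R h n - (H (r + h n) - H r) /\<^sub>R h n) \<bullet> e)"
    proof
      fix n
      have i: "(\<lambda>t. indicator {s<..<s + h n} t * (P t \<bullet> e)) integrable_on {0..T}"
        "(\<lambda>t. indicator {r<..<r + h n} t * (P t \<bullet> e)) integrable_on {0..T}"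
        by (rule integral_indicator_interval(1)[OF Pe_int]; use sr h[of n] in simp)+
      have "A n = integral {0..T} (\<lambda>t. (indicator {s<..<s + h n} t * (P t \<bullet> e) - indicator {r<..<r + h n} t * (P t \<bullet> e)) / h n)"
        unfolding A_def \<theta>'_def by (simp add: left_diff_distrib)
      also have "\<dots> = (integral {0..T} (\<lambda>t. indicator {s<..<s + h n} t * (P t \<bullet> e)) -
          integral {0..T} (\<lambda>t. indicator {r<..<r + h n} t * (P t \<bullet> e))) / h n"
        using i by (simp add: Henstock_Kurzweil_Integration.integral_diff)
      also have "\<dots> = ((H (s + h n) - H s) \<bullet> e - (H (r + h n) - H r) \<bullet> e) / h n"
        using sr h[of n] by (simp add: integral_indicator_interval(2)[OF Pe_int] H_diff)
      finally show "A n = ((H (s + h n) - H s) /\<^sub>R h n - (H (r + h n) - H r) /\<^sub>R h n) \<bullet> e"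
        by (simp add: inner_diff_left divide_inverse algebra_simps)
    qed
    moreover have "(\<lambda>n. ((H (s + h n) - H s) /\<^sub>R h n - (H (r + h n) - H r) /\<^sub>R h n) \<bullet> e) \<longlonglongrightarrow> (P s - P r) \<bullet> e"
      using has_vector_derivative_right_quotient[OF Ps _ _ h_lim h(1)]
        has_vector_derivative_right_quotient[OF Pr _ _ h_lim h(1)] sr
      unfolding H_def by (intro tendsto_intros) auto
    ultimately show ?thesis by (simp only:)
  qed
  have B_lim: "B \<longlonglongrightarrow> integral {s..r} g"
  proof -
    \<comment> \<open>The pointwise limit is exactly the indicator of the interval open at
      \<open>s\<close> and closed at \<open>r\<close>: both ramps vanish at \<open>s\<close>, and
      only the first one has risen at \<open>r\<close>.\<close>
    have "B \<longlonglongrightarrow> integral {0..T} (\<lambda>t. if t \<in> {s<..r} then g t else 0)"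
      unfolding B_def
    proof (rule dominated_convergence(2))
      show "(\<lambda>t. \<theta> n t * g t) integrable_on {0..T}" for n by (rule \<theta>g_int)
      show "(\<lambda>t. norm (g t)) integrable_on {0..T}" by (rule abs_int[OF absolutely_integrable_norm[OF g_abs, unfolded o_def]])
      show "norm (\<theta> n t * g t) \<le> norm (g t)" for n t
        using \<theta>_bounds[of n t] by (simp add: abs_mult mult_left_le_one_le)
      show "(\<lambda>n. \<theta> n t * g t) \<longlonglongrightarrow> (if t \<in> {s<..r} then g t else 0)" for t
      proof (rule tendsto_eventually)
        have small: "\<forall>\<^sub>F n in sequentially. h n < c" if "0 < c" for c by (rule order_tendstoD(2)[OF h_lim that])
        consider "t \<le> s" | "s < t" "t \<le> r" | "r < t" by linarith
        then show "\<forall>\<^sub>F n in sequentially. \<theta> n t * g t = (if t \<in> {s<..r} then g t else 0)"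
        proof cases
          case 1
          then show ?thesis using sr h(1) by (auto simp: \<theta>_def ramp_eq_0)
        next
          case 2
          then have "0 < t - s" by simp
          from small[OF this] show ?thesis
          proof eventually_elim
            case (elim n)
            then show ?case using 2 h(1)[of n] by (simp add: \<theta>_def ramp_eq_0 ramp_eq_1)
          qed
        next
          case 3
          then have "0 < t - r" by simp
          from small[OF this] show ?thesis
          proof eventually_elim
            case (elim n)
            then show ?case using 3 sr h(1)[of n] by (simp add: \<theta>_def ramp_eq_1)
          qed
        qed
      qed
    qed
    also have "integral {0..T} (\<lambda>t. if t \<in> {s<..r} then g t else 0) = integral {0..T} (\<lambda>t. if t \<in> {s..r} then g t else 0)"
      by (rule integral_spike[of "{s}"]) auto
    also have "\<dots> = integral ({s..r} \<inter> {0..T}) g" by (rule integral_restrict_Int)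
    also have "{s..r} \<inter> {0..T} = {s..r}" using sr by auto
    finally show ?thesis .
  qed
  have "0 \<le> (P s - P r) \<bullet> e + integral {s..r} g"
    by (rule LIMSEQ_le_const[OF tendsto_add[OF A_lim B_lim]]) (use AB in auto)
  then show "(P r - P s) \<bullet> e \<le> integral {s..r} g" by (simp add: inner_diff_left)
  have "0 \<le> - ((P s - P r) \<bullet> e) + (integral {0..T} g - integral {s..r} g)"
    by (rule LIMSEQ_le_const[OF tendsto_add[OF tendsto_minus[OF A_lim] tendsto_diff[OF tendsto_const B_lim]]])
       (use AB' in auto)
  then show "(P s - P r) \<bullet> e \<le> integral {0..T} g - integral {s..r} g" by simp
qed

text \<open>Testing the increment \<open>P r - P s\<close> with itself as direction turns the
  one-sided inequality into a norm bound by the integral of \<open>C * b t\<close>. Hence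
  \<open>P\<close> is uniformly continuous on a dense set of Lebesgue points and extends to all of
  \<open>{0..T}\<close>; both increment inequalities pass to the extension, and the norm bound then
  gives absolute continuity.\<close>

lemma momentum_exists:
  assumes u: "u \<in> W1_orlicz_per T \<phi>"
    and min: "\<And>v. v \<in> W1_orlicz_per T \<phi> \<Longrightarrow> action T \<phi> F u \<le> action T \<phi> F v"
  obtains p where "absolutely_continuous_on {0..T} p" "p 0 = p T"
    "AE t in lebesgue_on {0..T}. grad \<phi> (D u t) = p t"
    "\<And>e s r. 0 \<le> s \<Longrightarrow> s \<le> r \<Longrightarrow> r \<le> T \<Longrightarrow> (p r - p s) \<bullet> e \<le> integral {s..r} (\<lambda>t. G t (u t) e)"
proof -
  have uW: "u \<in> W1_orlicz T \<phi>" using u by (simp add: W1_orlicz_per_def)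
  note abs_int = set_lebesgue_integral_eq_integral(1)
  define P where "P t = grad \<phi> (D u t)" for t
  have P_eq: "P = (\<lambda>t. grad \<phi> (D u t))" by (simp add: P_def fun_eq_iff)
  have P_int: "P integrable_on {0..T}" unfolding P_def by (rule abs_int[OF momentum_integrable[OF uW]])
  obtain N where N: "negligible N" "\<And>t. t \<in> {0..T} \<Longrightarrow> t \<notin> N \<Longrightarrow>
      ((\<lambda>t. integral {0..t} P) has_vector_derivative P t) (at t within {0..T})"
    using indefinite_integral_has_vector_derivative[OF P_int] by metis
  \<comment> \<open>Lebesgue points in the interior only, since the increments were obtained for
    \<open>r < T\<close>; the end points come back through the closure.\<close>
  define S where "S = {0<..<T} - N"
  have S_sub: "S \<subseteq> {0..T}" by (auto simp: S_def)
  have S_closure: "closure S = {0..T}"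
    using closure_interval_minus_negligible[OF N(1) T] closure_minimal[OF S_sub] by (auto simp: S_def)
  have incr: "(P r - P s) \<bullet> e \<le> integral {s..r} (\<lambda>t. G t (u t) e)"
    "(P s - P r) \<bullet> e \<le> integral {0..T} (\<lambda>t. G t (u t) e) - integral {s..r} (\<lambda>t. G t (u t) e)"
    if "s \<in> S" "r \<in> S" "s < r" for s r e
    using momentum_increment[OF u min, of s r e] N(2)[of s, unfolded P_eq] N(2)[of r, unfolded P_eq] that
    unfolding P_eq by (auto simp: S_def)
  obtain C where C: "0 \<le> C" "\<And>t v w. t \<in> {0..T} \<Longrightarrow> \<bar>G t (u t) v - G t (u t) w\<bar> \<le> C * b t * norm (v - w)"
    "\<And>t v. t \<in> {0..T} \<Longrightarrow> \<bar>G t (u t) v\<bar> \<le> C * b t * norm v"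
    using G_comp_bound[OF W1_D(2)[OF uW]] by metis
  have Cb_int: "(\<lambda>t. C * b t) integrable_on {0..T}"
    by (rule abs_int[OF set_integrable_mult_right[OF b_int]])
  have Cb_nonneg: "0 \<le> C * b t" if "t \<in> {0..T}" for t using C(1) b_nonneg[OF that] by simp
  have g_int: "(\<lambda>t. G t (u t) e) integrable_on {0..T}" for e
    by (rule abs_int[OF G_comp_integrable[OF W1_D(2)[OF uW]]])
  have norm_le: "norm d \<le> integral {s..r} (\<lambda>t. C * b t)"
    if "0 \<le> s" "s \<le> r" "r \<le> T" and d: "d \<bullet> d \<le> integral {s..r} (\<lambda>t. G t (u t) d)" for s r and d :: 'a
  proof -
    have "integral {s..r} (\<lambda>t. G t (u t) d) \<le> integral {s..r} (\<lambda>t. C * b t * norm d)"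
    proof (rule integral_le)
      show "(\<lambda>t. G t (u t) d) integrable_on {s..r}"
        by (rule integrable_on_subinterval[OF g_int]) (use that in auto)
      show "(\<lambda>t. C * b t * norm d) integrable_on {s..r}"
        by (rule integrable_on_mult_left, rule integrable_on_subinterval[OF Cb_int]) (use that in auto)
      show "G t (u t) d \<le> C * b t * norm d" if "t \<in> {s..r}" for t
        using C(3)[of t d] that \<open>0 \<le> s\<close> \<open>r \<le> T\<close> by auto
    qed
    also have "\<dots> = integral {s..r} (\<lambda>t. C * b t) * norm d" by simp
    finally have "norm d * norm d \<le> integral {s..r} (\<lambda>t. C * b t) * norm d"
      using d by (simp add: power2_norm_eq_inner[symmetric] power2_eq_square)
    moreover have "0 \<le> integral {s..r} (\<lambda>t. C * b t)"
      by (rule integral_nonneg, rule integrable_on_subinterval[OF Cb_int]) (use that Cb_nonneg in auto)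
    ultimately show ?thesis by (cases "d = 0") (auto simp: mult_le_cancel_right)
  qed
  define B where "B x = integral {0..x} (\<lambda>t. C * b t)" for x
  have B_uc: "uniformly_continuous_on {0..T} B"
    unfolding B_def by (intro compact_uniformly_continuous indefinite_integral_continuous_1 Cb_int) simp
  have P_B: "norm (P r - P s) \<le> \<bar>B r - B s\<bar>" if "s \<in> S" "r \<in> S" for s r
  proof -
    have *: "norm (P r - P s) \<le> \<bar>B r - B s\<bar>" if "s \<in> S" "r \<in> S" "s < r" for s r
    proof -
      have sr: "0 \<le> s" "s \<le> r" "r \<le> T" using that by (auto simp: S_def)
      have "norm (P r - P s) \<le> integral {s..r} (\<lambda>t. C * b t)" by (rule norm_le[OF sr incr(1)[OF that]])
      also have "\<dots> = B r - B s" unfolding B_def by (rule integral_subinterval_diff[OF Cb_int sr])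
      finally show ?thesis by simp
    qed
    consider "s < r" | "s = r" | "r < s" by linarith
    then show ?thesis
    proof cases
      case 1 then show ?thesis by (rule *[OF that])
    next
      case 2 then show ?thesis by simp
    next
      case 3 then show ?thesis using *[OF that(2,1)] by (simp add: norm_minus_commute abs_minus_commute)
    qed
  qed
  have "uniformly_continuous_on S P"
    unfolding uniformly_continuous_on_def
  proof (intro allI impI)
    fix e :: real assume "e > 0"
    then obtain d where d: "d > 0" "\<And>x y. x \<in> {0..T} \<Longrightarrow> y \<in> {0..T} \<Longrightarrow> dist y x < d \<Longrightarrow> dist (B y) (B x) < e"
      using B_uc unfolding uniformly_continuous_on_def by meson
    show "\<exists>d>0. \<forall>x\<in>S. \<forall>y\<in>S. dist y x < d \<longrightarrow> dist (P y) (P x) < e"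
    proof (intro exI[of _ d] conjI ballI impI d(1))
      fix x y assume xy: "x \<in> S" "y \<in> S" "dist y x < d"
      have "dist (P y) (P x) \<le> dist (B y) (B x)" using P_B[OF xy(1,2)] by (simp add: dist_norm)
      also have "\<dots> < e" using d(2) xy S_sub by blast
      finally show "dist (P y) (P x) < e" .
    qed
  qed
  then obtain p where p: "uniformly_continuous_on {0..T} p" "\<And>x. x \<in> S \<Longrightarrow> P x = p x"
    using uniformly_continuous_on_extension_on_closure[of S P] S_closure by metis
  have p_cont: "continuous_on {0..T} p" by (rule uniformly_continuous_imp_continuous[OF p(1)])
  have g_cont: "continuous_on {0..T} (\<lambda>x. integral {0..x} (\<lambda>t. G t (u t) e))" for e
    by (rule indefinite_integral_continuous_1[OF g_int])
  have seq: "\<exists>x. (\<forall>n. x n \<in> S) \<and> x \<longlonglongrightarrow> t" if "t \<in> {0..T}" for t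
    using that S_closure closure_sequential by blast
  have seq_lim: "(\<lambda>n. f (x n)) \<longlonglongrightarrow> f t"
    if "continuous_on {0..T} f" "\<And>n. x n \<in> S" "x \<longlonglongrightarrow> t" "t \<in> {0..T}" for f :: "real \<Rightarrow> 'c::topological_space" and x t
    by (rule continuous_on_tendsto_compose[OF that(1,3,4)]) (rule always_eventually, use that(2) S_sub in blast)
  have lim: "(p r - p s) \<bullet> e \<le> integral {s..r} (\<lambda>t. G t (u t) e) \<and>
      (p s - p r) \<bullet> e \<le> integral {0..T} (\<lambda>t. G t (u t) e) - integral {s..r} (\<lambda>t. G t (u t) e)"
    if sr: "0 \<le> s" "s < r" "r \<le> T" for s r e
  proof -
    let ?\<Gamma> = "\<lambda>x. integral {0..x} (\<lambda>t. G t (u t) e)"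
    have in_T: "s \<in> {0..T}" "r \<in> {0..T}" using sr by auto
    obtain x where x: "\<And>n. x n \<in> S" "x \<longlonglongrightarrow> s" using seq[OF in_T(1)] by blast
    obtain y where y: "\<And>n. y n \<in> S" "y \<longlonglongrightarrow> r" using seq[OF in_T(2)] by blast
    define m where "m = (s + r) / 2"
    have m: "s < m" "m < r" using sr by (auto simp: m_def)
    have ev: "\<forall>\<^sub>F n in sequentially. x n < y n"
      using order_tendstoD(2)[OF x(2) m(1)] order_tendstoD(1)[OF y(2) m(2)] by eventually_elim simp
    have l: "(\<lambda>n. p (x n)) \<longlonglongrightarrow> p s" "(\<lambda>n. p (y n)) \<longlonglongrightarrow> p r"
      "(\<lambda>n. ?\<Gamma> (x n)) \<longlonglongrightarrow> ?\<Gamma> s" "(\<lambda>n. ?\<Gamma> (y n)) \<longlonglongrightarrow> ?\<Gamma> r"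
      using seq_lim[OF p_cont x in_T(1)] seq_lim[OF p_cont y in_T(2)]
        seq_lim[OF g_cont x in_T(1)] seq_lim[OF g_cont y in_T(2)] by auto
    have le: "(p (y n) - p (x n)) \<bullet> e \<le> ?\<Gamma> (y n) - ?\<Gamma> (x n) \<and>
        (p (x n) - p (y n)) \<bullet> e \<le> ?\<Gamma> T - (?\<Gamma> (y n) - ?\<Gamma> (x n))" if "x n < y n" for n
    proof -
      have "0 \<le> x n" "x n \<le> y n" "y n \<le> T" using x(1)[of n] y(1)[of n] that by (auto simp: S_def)
      then have "integral {x n..y n} (\<lambda>t. G t (u t) e) = ?\<Gamma> (y n) - ?\<Gamma> (x n)" by (rule integral_subinterval_diff[OF g_int])
      then show ?thesis using incr[OF x(1) y(1) that, of e] p(2)[OF x(1)] p(2)[OF y(1)] by simp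
    qed
    have "(p r - p s) \<bullet> e \<le> ?\<Gamma> r - ?\<Gamma> s"
      by (rule tendsto_le[OF trivial_limit_sequentially tendsto_diff[OF l(4,3)]
            tendsto_inner[OF tendsto_diff[OF l(2,1)] tendsto_const]])
         (use ev in eventually_elim, use le in blast)
    moreover have "(p s - p r) \<bullet> e \<le> ?\<Gamma> T - (?\<Gamma> r - ?\<Gamma> s)"
      by (rule tendsto_le[OF trivial_limit_sequentially tendsto_diff[OF tendsto_const tendsto_diff[OF l(4,3)]]
            tendsto_inner[OF tendsto_diff[OF l(1,2)] tendsto_const]])
         (use ev in eventually_elim, use le in blast)
    moreover have "integral {s..r} (\<lambda>t. G t (u t) e) = ?\<Gamma> r - ?\<Gamma> s" by (rule integral_subinterval_diff[OF g_int]) (use sr in auto)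
    ultimately show ?thesis by simp
  qed
  have main: "(p r - p s) \<bullet> e \<le> integral {s..r} (\<lambda>t. G t (u t) e)" if "0 \<le> s" "s \<le> r" "r \<le> T" for s r e
    using lim[of s r e] that by (cases "s = r") auto
  show thesis
  proof (rule that)
    show "absolutely_continuous_on {0..T} p"
      by (rule absolutely_continuous_on_integral_bound[OF Cb_int Cb_nonneg]) (use norm_le main in auto)
    \<comment> \<open>On the full interval the right side of the second inequality is 0. The jump of
      the momentum, taken as the direction, is therefore 0.\<close>
    have "(p 0 - p T) \<bullet> (p 0 - p T) \<le> 0" using lim[of 0 T "p 0 - p T"] T by simp
    then have "p 0 - p T = 0" by (metis inner_eq_zero_iff inner_ge_zero order_antisym)
    then show "p 0 = p T" by simp
    have "negligible (insert 0 (insert T N))" using N(1) by simp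
    then show "AE t in lebesgue_on {0..T}. grad \<phi> (D u t) = p t"
      by (rule AE_lebesgue_onI) (use p(2) in \<open>auto simp: S_def P_def\<close>)
  qed (rule main)
qed

text \<open>Divide the increment inequality by the step and let it tend to 0 from the right; both
  derivatives are limits of such quotients.\<close>

lemma derivative_inner_le:
  assumes p: "(p has_vector_derivative d) (at t within {0..T})"
    and g: "((\<lambda>x. integral {0..x} g) has_vector_derivative c) (at t within {0..T})" "g integrable_on {0..T}"
    and t: "0 \<le> t" "t < T"
    and le: "\<And>r. t \<le> r \<Longrightarrow> r \<le> T \<Longrightarrow> (p r - p t) \<bullet> e \<le> integral {t..r} g"
  shows "d \<bullet> e \<le> (c :: real)"
proof -
  obtain h where h: "\<And>n. 0 < h n" "\<And>n. h n \<le> T - t" and h_lim: "h \<longlonglongrightarrow> 0"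
    using vanishing_steps[of "T - t"] t by auto
  let ?\<Gamma> = "\<lambda>x. integral {0..x} g"
  have "((p (t + h n) - p t) /\<^sub>R h n) \<bullet> e \<le> (?\<Gamma> (t + h n) - ?\<Gamma> t) /\<^sub>R h n" for n
  proof -
    have "integral {t..t + h n} g = ?\<Gamma> (t + h n) - ?\<Gamma> t"
      by (rule integral_subinterval_diff[OF g(2)]) (use t h[of n] in auto)
    then have "(p (t + h n) - p t) \<bullet> e \<le> ?\<Gamma> (t + h n) - ?\<Gamma> t" using le[of "t + h n"] h[of n] by simp
    then show ?thesis using h(1)[of n] by (simp add: mult_left_mono)
  qed
  then show ?thesis
    by (intro LIMSEQ_le[OF tendsto_inner[OF has_vector_derivative_right_quotient[OF p t h_lim h(1)] tendsto_const]
          has_vector_derivative_right_quotient[OF g(1) t h_lim h(1)]]) auto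
qed

lemma minimizer_solves:
  assumes u: "u \<in> W1_orlicz_per T \<phi>"
    and min: "\<And>v. v \<in> W1_orlicz_per T \<phi> \<Longrightarrow> action T \<phi> F u \<le> action T \<phi> F v"
  obtains w where "AE t in lebesgue_on {0..T}. (u has_vector_derivative w t) (at t within {0..T})"
    "absolutely_continuous_on {0..T} (\<lambda>t. grad \<phi> (w t))"
    "AE t in lebesgue_on {0..T}. \<exists>d. (\<forall>v. d \<bullet> v \<le> G t (u t) v) \<and>
       ((\<lambda>s. grad \<phi> (w s)) has_vector_derivative d) (at t within {0..T})"
    "w 0 = w T"
proof -
  have uW: "u \<in> W1_orlicz T \<phi>" using u by (simp add: W1_orlicz_per_def)
  obtain p where p: "absolutely_continuous_on {0..T} p" "p 0 = p T"
    "AE t in lebesgue_on {0..T}. grad \<phi> (D u t) = p t"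
    "\<And>e s r. 0 \<le> s \<Longrightarrow> s \<le> r \<Longrightarrow> r \<le> T \<Longrightarrow> (p r - p s) \<bullet> e \<le> integral {s..r} (\<lambda>t. G t (u t) e)"
  proof (rule momentum_exists[OF u min], goal_cases)
    case (2 p)
    show thesis by (rule 2(1)) (fact 2)+
  qed
  obtain X where X: "\<And>\<xi>. grad \<phi> (X \<xi>) = \<xi>" using grad_surj[OF diff superlinear] by metis
  define w where "w t = (if 0 < t \<and> t < T \<and> grad \<phi> (D u t) = p t then D u t else X (p t))" for t
  \<comment> \<open>Outside a null set \<open>w\<close> is \<open>u'\<close>; elsewhere, and at both end points, it is a preimage of the
    continuous momentum \<open>p\<close>, so that \<open>p 0 = p T\<close> yields \<open>w 0 = w T\<close>.\<close>
  have grad_w: "grad \<phi> (w t) = p t" for t by (simp add: w_def X)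
  have inner: "AE t in lebesgue_on {0..T}. 0 < t \<and> t < T"
    by (rule AE_lebesgue_onI[of "{0, T}"]) auto
  \<comment> \<open>The null set in the differentiated inequality depends on the direction
    \<open>e\<close>. Countably many directions share one null set, and continuity of
    \<open>G t (u t)\<close> extends the inequality from a dense set to all directions.\<close>
  obtain Q :: "'a set" where Q: "countable Q" "\<And>X. open X \<Longrightarrow> X \<noteq> {} \<Longrightarrow> \<exists>d\<in>Q. d \<in> X"
    using countable_dense_setE by metis
  have g_int: "(\<lambda>t. G t (u t) e) integrable_on {0..T}" for e
    by (rule set_lebesgue_integral_eq_integral(1)[OF G_comp_integrable[OF W1_D(2)[OF uW]]])
  have "AE t in lebesgue_on {0..T}. D p t \<bullet> e \<le> G t (u t) e" for e
  proof -
    obtain N where N: "negligible N" "\<And>t. t \<in> {0..T} \<Longrightarrow> t \<notin> N \<Longrightarrow>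
        ((\<lambda>x. integral {0..x} (\<lambda>t. G t (u t) e)) has_vector_derivative G t (u t) e) (at t within {0..T})"
      using indefinite_integral_has_vector_derivative[OF g_int] by metis
    have "AE t in lebesgue_on {0..T}.
        ((\<lambda>x. integral {0..x} (\<lambda>t. G t (u t) e)) has_vector_derivative G t (u t) e) (at t within {0..T})"
      by (rule AE_lebesgue_onI[OF N]) auto
    then show ?thesis
      using inner absolutely_continuous_FTC(3)[OF p(1) T]
    proof eventually_elim
      case (elim t)
      then show ?case using p(4)[of t _ e] by (intro derivative_inner_le[OF elim(3,1) g_int]) auto
    qed
  qed
  then have "AE t in lebesgue_on {0..T}. \<forall>e\<in>Q. D p t \<bullet> e \<le> G t (u t) e"
    by (subst AE_ball_countable[OF Q(1)]) (rule ballI)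
  then have "AE t in lebesgue_on {0..T}. t \<in> {0..T} \<longrightarrow> (\<forall>v. D p t \<bullet> v \<le> G t (u t) v)"
  proof eventually_elim
    case (elim t)
    show ?case
    proof (intro impI allI, rule ccontr)
      fix v assume t: "t \<in> {0..T}" and "\<not> D p t \<bullet> v \<le> G t (u t) v"
      then have "v \<in> {v. 0 < D p t \<bullet> v - G t (u t) v}" by simp
      then have ne: "{v. 0 < D p t \<bullet> v - G t (u t) v} \<noteq> {}" by blast
      obtain C where C: "0 \<le> C" "\<And>t v w. t \<in> {0..T} \<Longrightarrow> \<bar>G t (u t) v - G t (u t) w\<bar> \<le> C * b t * norm (v - w)"
        and "\<And>t v. t \<in> {0..T} \<Longrightarrow> \<bar>G t (u t) v\<bar> \<le> C * b t * norm v"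
        using G_comp_bound[OF W1_D(2)[OF uW]] by metis
      have "(C * b t)-lipschitz_on UNIV (G t (u t))"
        using C(1) C(2)[OF t] b_nonneg[OF t] by (intro lipschitz_onI) (auto simp: dist_norm)
      then have "continuous_on UNIV (G t (u t))" by (rule lipschitz_on_continuous_on)
      then have "continuous_on UNIV (\<lambda>v. D p t \<bullet> v - G t (u t) v)" by (intro continuous_intros)
      then have "open {v. 0 < D p t \<bullet> v - G t (u t) v}"
        by (intro open_Collect_less continuous_on_const)
      from Q(2)[OF this ne] show False using elim by force
    qed
  qed
  moreover have "AE t in lebesgue_on {0..T}. t \<in> {0..T}" by (rule AE_I2) simp
  ultimately have incl: "AE t in lebesgue_on {0..T}. \<forall>v. D p t \<bullet> v \<le> G t (u t) v" by eventually_elim simp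
  show thesis
  proof (rule that)
    show "AE t in lebesgue_on {0..T}. (u has_vector_derivative w t) (at t within {0..T})"
      using absolutely_continuous_FTC(3)[OF W1_D(1)[OF uW] T] p(3) inner
      by eventually_elim (simp add: w_def)
    show "absolutely_continuous_on {0..T} (\<lambda>t. grad \<phi> (w t))" using p(1) by (simp add: grad_w)
    show "AE t in lebesgue_on {0..T}. \<exists>d. (\<forall>v. d \<bullet> v \<le> G t (u t) v) \<and>
       ((\<lambda>s. grad \<phi> (w s)) has_vector_derivative d) (at t within {0..T})"
      using incl absolutely_continuous_FTC(3)[OF p(1) T]
    proof eventually_elim
      case (elim t)
      then show ?case unfolding grad_w by blast
    qed
    show "w 0 = w T" using p(2) by (simp add: w_def)
  qed
qed

end

section \<open>Clarke regularity\<close>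

lemma regular_deriv_less:
  assumes "clarke_deriv f x v = ereal D" and "D < a"
  shows "\<forall>\<^sub>F (y, l) in nhds x \<times>\<^sub>F at_right 0. (f (y + l *\<^sub>R v) - f y) / l < a"
proof -
  have "Limsup (nhds x \<times>\<^sub>F at_right 0) (\<lambda>(y, l). ereal ((f (y + l *\<^sub>R v) - f y) / l)) < ereal a"
    using assms by (simp add: clarke_deriv_def)
  then have "\<forall>\<^sub>F p in nhds x \<times>\<^sub>F at_right 0. (case p of (y, l) \<Rightarrow> ereal ((f (y + l *\<^sub>R v) - f y) / l)) < ereal a"
    by (rule Limsup_lessD)
  then show ?thesis by (rule eventually_mono) auto
qed

text \<open>The increment along \<open>v + w\<close> is split at \<open>x + l *\<^sub>R w\<close>.
  The quotient in direction \<open>v\<close> is then based at a moving point, which the upper limit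
  in Clarke's derivative admits; regularity identifies the result with the ordinary derivative at
  \<open>x\<close>.\<close>

lemma regular_deriv_subadditive:
  fixes f :: "'a::euclidean_space \<Rightarrow> real"
  assumes lim: "\<And>v. ((\<lambda>l. (f (x + l *\<^sub>R v) - f x) / l) \<longlongrightarrow> d x v) (at_right 0)"
    and reg: "\<And>v. clarke_deriv f x v = ereal (d x v)"
  shows "d x (v + w) \<le> d x v + d x w"
proof (rule field_le_epsilon)
  fix e :: real assume "e > 0"
  have "d x v < d x v + e" using \<open>e > 0\<close> by simp
  have "filterlim (\<lambda>l. (x + l *\<^sub>R w, l)) (nhds x \<times>\<^sub>F at_right 0) (at_right 0)"
    by (rule filterlim_Pair) (auto intro!: tendsto_eq_intros filterlim_ident)
  with regular_deriv_less[OF reg \<open>d x v < d x v + e\<close>]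
  have ev: "\<forall>\<^sub>F l in at_right 0. (f (x + l *\<^sub>R w + l *\<^sub>R v) - f (x + l *\<^sub>R w)) / l < d x v + e"
    unfolding filterlim_iff by fastforce
  show "d x (v + w) \<le> d x v + d x w + e"
  proof (rule tendsto_le[OF trivial_limit_at_right_real _ lim])
    show "((\<lambda>l. d x v + e + (f (x + l *\<^sub>R w) - f x) / l) \<longlongrightarrow> d x v + d x w + e) (at_right 0)"
      using tendsto_add[OF tendsto_const[of "d x v + e"] lim[of w]] by (simp add: algebra_simps)
    show "\<forall>\<^sub>F l in at_right 0. (f (x + l *\<^sub>R (v + w)) - f x) / l \<le> d x v + e + (f (x + l *\<^sub>R w) - f x) / l"
      using ev
    proof eventually_elim
      case (elim l)
      have "(f (x + l *\<^sub>R (v + w)) - f x) / l =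
          (f (x + l *\<^sub>R w + l *\<^sub>R v) - f (x + l *\<^sub>R w)) / l + (f (x + l *\<^sub>R w) - f x) / l"
        by (simp add: algebra_simps flip: add_divide_distrib)
      then show ?case using elim by linarith
    qed
  qed
qed

text \<open>Clarke's upper limit bounds the quotients below some \<open>a' < a\<close> for all base
  points \<open>y\<close> near \<open>x\<close> and all small steps simultaneously. With
  \<open>y\<close> fixed, the quotients converge to \<open>d y v\<close>, which is thus at most
  \<open>a'\<close>.\<close>

lemma regular_deriv_upper_semicontinuous:
  fixes f :: "'a::euclidean_space \<Rightarrow> real"
  assumes lim: "\<And>x v. ((\<lambda>l. (f (x + l *\<^sub>R v) - f x) / l) \<longlongrightarrow> d x v) (at_right 0)"
    and reg: "\<And>x v. clarke_deriv f x v = ereal (d x v)"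
  shows "open {x. d x v < a}"
proof (subst open_subopen, intro ballI)
  fix x assume "x \<in> {x. d x v < a}"
  then obtain a' where a': "d x v < a'" "a' < a" using dense by blast
  obtain P Q where P: "eventually P (nhds x)" and Q: "eventually Q (at_right (0::real))"
    and PQ: "\<And>y l. P y \<Longrightarrow> Q l \<Longrightarrow> (f (y + l *\<^sub>R v) - f y) / l < a'"
    using regular_deriv_less[OF reg a'(1)] unfolding eventually_prod_filter by auto
  obtain S where S: "open S" "x \<in> S" "\<And>y. y \<in> S \<Longrightarrow> P y" using P unfolding eventually_nhds by blast
  have "d y v < a" if "y \<in> S" for y
  proof -
    have "d y v \<le> a'"
    proof (rule tendsto_upperbound[OF lim])
      show "\<forall>\<^sub>F l in at_right 0. (f (y + l *\<^sub>R v) - f y) / l \<le> a'"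
        using Q by (rule eventually_mono) (rule less_imp_le[OF PQ[OF S(3)[OF that]]])
    qed simp
    then show ?thesis using a'(2) by simp
  qed
  then show "\<exists>T. open T \<and> x \<in> T \<and> T \<subseteq> {x. d x v < a}" using S by blast
qed

text \<open>Hahn-Banach is avoided by minimising \<open>p v + norm v ^ 2 / 2\<close>: if \<open>z\<close> is a minimiser, then
  the linear functional of \<open>- z\<close> lies below \<open>p\<close>.\<close>

lemma sublinear_dominates_linear:
  fixes p :: "'a::euclidean_space \<Rightarrow> real"
  assumes sub: "\<And>v w. p (v + w) \<le> p v + p w" and hom: "\<And>s v. 0 \<le> s \<Longrightarrow> p (s *\<^sub>R v) = s * p v"
    and lip: "\<And>v w. \<bar>p v - p w\<bar> \<le> L * norm (v - w)"
  obtains \<xi> where "\<And>v. \<xi> \<bullet> v \<le> p v"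
proof -
  have p0: "p 0 = 0" using hom[of 0 0] by simp
  obtain j :: 'a where j: "j \<in> Basis" using nonempty_Basis by blast
  have "0 \<le> L" using lip[of j 0] j by simp
  have "L-lipschitz_on UNIV p" using lip \<open>0 \<le> L\<close> by (intro lipschitz_onI) (auto simp: dist_norm)
  then have p_cont: "continuous_on UNIV p" by (rule lipschitz_on_continuous_on)
  let ?g = "\<lambda>v. p v + (norm v)\<^sup>2 / 2"
  \<comment> \<open>Outside this ball the quadratic term outweighs
    \<open>p y \<ge> - L * norm y\<close>, so the function is at least 0, its value at the
    origin.\<close>
  have "continuous_on (cball 0 (2 * L)) ?g"
    by (intro continuous_intros continuous_on_subset[OF p_cont]) auto
  moreover have "cball (0::'a) (2 * L) \<noteq> {}" using \<open>0 \<le> L\<close> by simp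
  ultimately obtain z where z: "z \<in> cball 0 (2 * L)" "\<And>y. y \<in> cball 0 (2 * L) \<Longrightarrow> ?g z \<le> ?g y"
    using continuous_attains_inf[of "cball 0 (2 * L)" ?g] compact_cball by blast
  have min: "?g z \<le> ?g y" for y
  proof (cases "y \<in> cball 0 (2 * L)")
    case False
    then have "2 * L \<le> norm y" by simp
    then have "2 * L * norm y \<le> norm y * norm y" by (rule mult_right_mono) simp
    then have "L * norm y \<le> (norm y)\<^sup>2 / 2" by (simp add: power2_eq_square field_simps)
    moreover have "- (L * norm y) \<le> p y" using lip[of y 0] p0 by (simp add: abs_le_iff)
    ultimately have "0 \<le> ?g y" by simp
    moreover have "?g z \<le> ?g 0" by (rule z(2)) (use \<open>0 \<le> L\<close> in simp)
    ultimately show ?thesis using p0 by simp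
  qed (rule z(2))
  have "- z \<bullet> w \<le> p w" for w
  proof -
    \<comment> \<open>Perturb the minimiser by \<open>s *\<^sub>R w\<close>, using only
      subadditivity of \<open>p\<close>, and divide by \<open>s\<close>; the quadratic remainder
      vanishes as \<open>s\<close> tends to 0.\<close>
    have "- (p w + z \<bullet> w) \<le> s * ((norm w)\<^sup>2 / 2)" if s: "0 < s" for s
    proof -
      have "?g z \<le> ?g (z + s *\<^sub>R w)" by (rule min)
      also have "p (z + s *\<^sub>R w) \<le> p z + s * p w" using sub[of z "s *\<^sub>R w"] hom[of s w] s by simp
      also have "(norm (z + s *\<^sub>R w))\<^sup>2 = (norm z)\<^sup>2 + 2 * s * (z \<bullet> w) + s\<^sup>2 * (norm w)\<^sup>2"
        unfolding power2_norm_eq_inner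
        by (simp add: inner_add_left inner_add_right inner_commute power2_eq_square algebra_simps)
      finally have "0 \<le> s * (p w + z \<bullet> w + s * ((norm w)\<^sup>2 / 2))"
        by (simp add: field_simps power2_eq_square)
      then have "0 \<le> p w + z \<bullet> w + s * ((norm w)\<^sup>2 / 2)" using s by (simp add: zero_le_mult_iff)
      then show ?thesis by simp
    qed
    then have "\<forall>\<^sub>F s in at_right 0. - (p w + z \<bullet> w) \<le> s * ((norm w)\<^sup>2 / 2)"
      using eventually_at_right_less[of 0] by (rule eventually_mono[rotated]) blast
    moreover have "((\<lambda>s. s * ((norm w)\<^sup>2 / 2)) \<longlongrightarrow> 0) (at_right 0)" by (auto intro!: tendsto_eq_intros)
    ultimately have "- (p w + z \<bullet> w) \<le> 0" by (intro tendsto_lowerbound[of _ 0 "at_right 0"]) auto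
    then show ?thesis by simp
  qed
  then show thesis by (rule that)
qed

text \<open>A mean value inequality with right derivatives only. Adding \<open>(K + e) * s\<close>
  makes every right derivative positive, so the last point at which the function is at least its
  initial value cannot lie before 1.\<close>

lemma right_derivative_lower_bound:
  fixes g :: "real \<Rightarrow> real"
  assumes cont: "continuous_on {0..1} g"
    and lim: "\<And>s. 0 \<le> s \<Longrightarrow> s < 1 \<Longrightarrow> ((\<lambda>l. (g (s + l) - g s) / l) \<longlongrightarrow> d s) (at_right 0)"
    and d: "\<And>s. 0 \<le> s \<Longrightarrow> s < 1 \<Longrightarrow> - K \<le> d s"
  shows "g 0 - K \<le> g 1"
proof (rule field_le_epsilon)
  fix e :: real assume "e > 0"
  define h where "h s = g s + (K + e) * s" for s
  have h_cont: "continuous_on {0..1} h" unfolding h_def by (intro continuous_intros cont)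
  define S where "S = {0..1} \<inter> h -` {h 0..}"
  have "closed S" unfolding S_def by (rule continuous_closed_preimage[OF h_cont]) auto
  moreover have "bounded S" by (rule bounded_subset[OF compact_imp_bounded[OF compact_Icc]]) (auto simp: S_def)
  ultimately have "compact S" by (simp add: compact_eq_bounded_closed)
  moreover have "0 \<in> S" by (simp add: S_def)
  then have "S \<noteq> {}" by blast
  ultimately obtain c where c: "c \<in> S" "\<And>s. s \<in> S \<Longrightarrow> s \<le> c" using compact_attains_sup[of S] by metis
  have "c = 1"
  proof (rule ccontr)
    assume "c \<noteq> 1"
    then have c01: "0 \<le> c" "c < 1" using c(1) by (auto simp: S_def)
    have "((\<lambda>l. (h (c + l) - h c) / l) \<longlongrightarrow> d c + (K + e)) (at_right 0)"
    proof (rule Lim_transform_eventually[OF tendsto_add[OF lim[OF c01] tendsto_const[of "K + e"]]])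
      show "\<forall>\<^sub>F l in at_right 0. (g (c + l) - g c) / l + (K + e) = (h (c + l) - h c) / l"
        using eventually_at_right_less[of 0] by eventually_elim (simp add: h_def field_simps)
    qed
    moreover have "0 < d c + (K + e)" using d[OF c01] \<open>e > 0\<close> by simp
    ultimately have "\<forall>\<^sub>F l in at_right 0. 0 < (h (c + l) - h c) / l" by (rule order_tendstoD)
    moreover have "\<forall>\<^sub>F l in at_right 0. l \<in> {0<..<1 - c}" by (rule eventually_at_right_real) (use c01 in simp)
    ultimately have "\<forall>\<^sub>F l in at_right 0. 0 < (h (c + l) - h c) / l \<and> l \<in> {0<..<1 - c}"
      by (rule eventually_conj)
    then obtain l where l: "0 < (h (c + l) - h c) / l" "l \<in> {0<..<1 - c}"
      using eventually_happens trivial_limit_at_right_real by blast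
    then have "h c < h (c + l)" by (simp add: zero_less_divide_iff)
    then have "c + l \<in> S" using l c(1) c01 by (auto simp: S_def)
    then show False using c(2) l by fastforce
  qed
  then have "h 0 \<le> h 1" using c(1) by (simp add: S_def)
  then show "g 0 - K \<le> g 1 + e" by (simp add: h_def)
qed

section \<open>From bounds on the Clarke gradient to Lipschitz bounds\<close>

lemma locally_lipschitzE:
  assumes "locally_lipschitz f"
  obtains r L where "0 < r" "\<And>y z. y \<in> ball x r \<Longrightarrow> z \<in> ball x r \<Longrightarrow> \<bar>f y - f z\<bar> \<le> L * norm (y - z)"
proof -
  obtain r L where rL: "0 < r" "L-lipschitz_on (ball x r) f"
    using assms unfolding locally_lipschitz_def by blast
  show thesis
    by (rule that[OF rL(1)]) (use lipschitz_onD[OF rL(2)] in \<open>simp add: dist_norm\<close>)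
qed

lemma locally_lipschitz_continuous_on:
  assumes "locally_lipschitz f"
  shows "continuous_on S f"
proof -
  have "isCont f x" for x
  proof -
    obtain r L where rL: "0 < r" "L-lipschitz_on (ball x r) f"
      using assms unfolding locally_lipschitz_def by blast
    then have "continuous_on (ball x r) f" by (intro lipschitz_on_continuous_on)
    then show ?thesis using rL(1) by (simp add: continuous_on_eq_continuous_at)
  qed
  then show ?thesis by (simp add: continuous_at_imp_continuous_on)
qed

lemma clarke_gradient_regular_iff:
  assumes "\<And>v. clarke_deriv f x v = ereal (d x v)"
  shows "\<xi> \<in> clarke_gradient f x \<longleftrightarrow> (\<forall>v. \<xi> \<bullet> v \<le> d x v)"
  using assms by (simp add: clarke_gradient_def)

text \<open>The hypothesis on \<open>F\<close> speaks of all members of the gradient and would say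
  nothing at a point where there are none. The directional derivative is sublinear and Lipschitz,
  hence dominates a linear functional.\<close>

lemma clarke_gradient_nonempty:
  fixes f :: "'a::euclidean_space \<Rightarrow> real"
  assumes f: "locally_lipschitz f"
    and lim: "\<And>x v. ((\<lambda>l. (f (x + l *\<^sub>R v) - f x) / l) \<longlongrightarrow> d x v) (at_right 0)"
    and reg: "\<And>x v. clarke_deriv f x v = ereal (d x v)"
  obtains \<xi> where "\<xi> \<in> clarke_gradient f x"
proof -
  obtain r L where rL: "0 < r" "\<And>y z. y \<in> ball x r \<Longrightarrow> z \<in> ball x r \<Longrightarrow> \<bar>f y - f z\<bar> \<le> L * norm (y - z)"
    using locally_lipschitzE[OF f] by metis
  have "\<bar>d x v - d x w\<bar> \<le> L * norm (v - w)" for v w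
    by (rule quotient_limit_lipschitz[where f = f and x = x and U = "ball x r", OF lim _ _ rL(2)]) (use rL(1) in auto)
  moreover have "d x (s *\<^sub>R v) = s * d x v" if "0 \<le> s" for s v
    by (rule quotient_limit_scale[where f = f and x = x, OF lim that])
  moreover have "d x (v + w) \<le> d x v + d x w" for v w
    by (rule regular_deriv_subadditive[OF lim reg])
  ultimately obtain \<xi> where "\<And>v. \<xi> \<bullet> v \<le> d x v" using sublinear_dominates_linear[of "d x" L] by metis
  then show thesis using clarke_gradient_regular_iff[of f x d, OF reg] that by blast
qed

text \<open>Upper semicontinuity of the generalised derivative controls it from above at the limit only.
  For a regular \<open>f\<close>, however, the set where the derivative in direction \<open>v\<close> lies below
  \<open>- M * norm v\<close> is open, so that it is empty as soon as it misses a dense set; the lower bound on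
  all one-sided derivatives then gives the Lipschitz estimate.\<close>

lemma regular_lipschitz_of_dense:
  fixes f :: "'a::euclidean_space \<Rightarrow> real"
  assumes f: "locally_lipschitz f"
    and lim: "\<And>x v. ((\<lambda>l. (f (x + l *\<^sub>R v) - f x) / l) \<longlongrightarrow> d x v) (at_right 0)"
    and reg: "\<And>x v. clarke_deriv f x v = ereal (d x v)"
    and Q: "\<And>X. open X \<Longrightarrow> X \<noteq> {} \<Longrightarrow> \<exists>q\<in>Q. q \<in> X"
    and M: "\<And>q \<xi>. q \<in> Q \<Longrightarrow> q \<in> ball 0 R \<Longrightarrow> \<xi> \<in> clarke_gradient f q \<Longrightarrow> \<bar>f q\<bar> + norm \<xi> \<le> M"
    and x: "x \<in> ball 0 R"
  shows "\<bar>f x\<bar> \<le> M" and "\<And>y. y \<in> ball 0 R \<Longrightarrow> \<bar>f x - f y\<bar> \<le> M * norm (x - y)"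
proof -
  \<comment> \<open>A single member \<xi> of the gradient at \<open>q\<close> suffices: by
    Cauchy-Schwarz it bounds every directional derivative at \<open>q\<close> from below.\<close>
  have M': "\<bar>f q\<bar> \<le> M" "- (M * norm v) \<le> d q v" if q: "q \<in> Q" "q \<in> ball 0 R" for q v
  proof -
    obtain \<xi> where \<xi>: "\<xi> \<in> clarke_gradient f q" using clarke_gradient_nonempty[OF f lim reg] by blast
    have b: "\<bar>f q\<bar> + norm \<xi> \<le> M" by (rule M[OF q \<xi>])
    then show "\<bar>f q\<bar> \<le> M" using norm_ge_zero[of \<xi>] by linarith
    have "- (M * norm v) \<le> - (norm \<xi> * norm v)" using b by (simp add: mult_right_mono)
    also have "\<dots> \<le> \<xi> \<bullet> v" using Cauchy_Schwarz_ineq2[of \<xi> v] by linarith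
    also have "\<dots> \<le> d q v" using \<xi> clarke_gradient_regular_iff[of f q d, OF reg] by blast
    finally show "- (M * norm v) \<le> d q v" .
  qed
  have lower: "- (M * norm v) \<le> d x v" if "x \<in> ball 0 R" for x v
  proof (rule ccontr)
    assume "\<not> - (M * norm v) \<le> d x v"
    then have "ball 0 R \<inter> {x. d x v < - (M * norm v)} \<noteq> {}" using that by auto
    moreover have "open (ball 0 R \<inter> {x. d x v < - (M * norm v)})"
      by (intro open_Int open_ball regular_deriv_upper_semicontinuous[OF lim reg])
    ultimately obtain q where "q \<in> Q" "q \<in> ball 0 R" "d q v < - (M * norm v)" using Q by blast
    then show False using M'(2)[of q v] by simp
  qed
  have half: "f x - M * norm (y - x) \<le> f y" if xy: "x \<in> ball 0 R" "y \<in> ball 0 R" for x y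
  proof -
    define g where "g s = f (x + s *\<^sub>R (y - x))" for s
    have seg: "x + s *\<^sub>R (y - x) \<in> ball 0 R" if "0 \<le> s" "s \<le> 1" for s
    proof -
      have "x + s *\<^sub>R (y - x) = (1 - s) *\<^sub>R x + s *\<^sub>R y" by (simp add: algebra_simps)
      then show ?thesis using convexD_alt[OF convex_ball xy that] by simp
    qed
    have "g 0 - M * norm (y - x) \<le> g 1"
    proof (rule right_derivative_lower_bound)
      show "continuous_on {0..1} g"
        unfolding g_def
        by (rule continuous_on_compose2[OF locally_lipschitz_continuous_on[OF f, of UNIV]]) (auto intro!: continuous_intros)
      show "((\<lambda>l. (g (s + l) - g s) / l) \<longlongrightarrow> d (x + s *\<^sub>R (y - x)) (y - x)) (at_right 0)" for s
        using lim[of "x + s *\<^sub>R (y - x)" "y - x"] by (simp add: g_def scaleR_left_distrib add.assoc)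
      show "- (M * norm (y - x)) \<le> d (x + s *\<^sub>R (y - x)) (y - x)" if "0 \<le> s" "s < 1" for s
        by (rule lower[OF seg]) (use that in auto)
    qed
    then show ?thesis by (simp add: g_def)
  qed
  show "\<bar>f x - f y\<bar> \<le> M * norm (x - y)" if "y \<in> ball 0 R" for y
    using half[OF x that] half[OF that x] by (simp add: abs_le_iff norm_minus_commute)
  show "\<bar>f x\<bar> \<le> M"
  proof (rule ccontr)
    assume "\<not> \<bar>f x\<bar> \<le> M"
    then have "ball 0 R \<inter> {x. M < \<bar>f x\<bar>} \<noteq> {}" using x by auto
    moreover have "open (ball 0 R \<inter> {x. M < \<bar>f x\<bar>})"
      by (intro open_Int open_ball open_Collect_less continuous_intros locally_lipschitz_continuous_on[OF f])
    ultimately obtain q where "q \<in> Q" "q \<in> ball 0 R" "M < \<bar>f q\<bar>" using Q by blast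
    then show False using M'(1)[of q] by simp
  qed
qed

section \<open>The theorem\<close>

text \<open>Measurability of \<open>f\<close> comes from that of \<open>g\<close> by completeness of
  Lebesgue measure.\<close>

lemma lebesgue_on_cong_negligible:
  fixes f g :: "real \<Rightarrow> real"
  assumes N: "negligible N" and eq: "\<And>t. t \<in> S \<Longrightarrow> t \<notin> N \<Longrightarrow> f t = g t"
    and S: "S \<in> sets lebesgue" and g: "g \<in> borel_measurable (lebesgue_on S)"
  shows "f \<in> borel_measurable (lebesgue_on S)" and "integral\<^sup>L (lebesgue_on S) f = integral\<^sup>L (lebesgue_on S) g"
proof -
  have AE: "AE t in lebesgue_on S. g t = f t"
    by (rule AE_lebesgue_onI[OF N _ S]) (use eq in auto)
  show f: "f \<in> borel_measurable (lebesgue_on S)"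
  proof -
    have "(\<lambda>t. if t \<in> S then g t else 0) \<in> borel_measurable lebesgue"
      using g S by (simp add: borel_measurable_if)
    moreover have "AE t in lebesgue. (if t \<in> S then g t else 0) = (if t \<in> S then f t else 0)"
    proof -
      have "AE t in lebesgue. t \<notin> N" using N by (intro AE_not_in) (simp add: negligible_iff_null_sets)
      then show ?thesis by eventually_elim (use eq in auto)
    qed
    ultimately have "(\<lambda>t. if t \<in> S then f t else 0) \<in> borel_measurable lebesgue"
      by (rule borel_measurable_AE)
    then show ?thesis using S by (simp add: borel_measurable_if)
  qed
  show "integral\<^sup>L (lebesgue_on S) f = integral\<^sup>L (lebesgue_on S) g"
    by (rule integral_cong_AE[OF f g]) (use AE in eventually_elim, simp)
qed

lemma G_function_convex_on:
  assumes "G_function (\<lambda>x. ereal (\<phi> x))"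
  shows "convex_on UNIV \<phi>"
proof (rule convex_onI)
  fix s :: real and x y :: 'a
  assume s: "0 < s" "s < 1"
  have "ereal (\<phi> ((1 - s) *\<^sub>R x + s *\<^sub>R y)) \<le> ereal (1 - s) * ereal (\<phi> x) + ereal s * ereal (\<phi> y)"
    using assms s unfolding G_function_def by force
  then show "\<phi> ((1 - s) *\<^sub>R x + s *\<^sub>R y) \<le> (1 - s) * \<phi> x + s * \<phi> y" by simp
qed simp

lemma N_function_superlinear:
  assumes \<phi>: "N_function \<phi>"
  shows "\<exists>M. \<forall>x. K * norm x - M \<le> \<phi> x"
proof -
  have nonneg: "0 \<le> \<phi> x" for x using \<phi> by (simp add: N_function_def G_function_def)
  have "filterlim (\<lambda>x. \<phi> x / norm x) at_top at_infinity" using \<phi> by (simp add: N_function_def)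
  then have "\<forall>\<^sub>F x in at_infinity. K \<le> \<phi> x / norm x" by (simp add: filterlim_at_top)
  then obtain R where R: "\<And>x. R \<le> norm x \<Longrightarrow> K \<le> \<phi> x / norm x" unfolding eventually_at_infinity by blast
  have "K * norm x - \<bar>K\<bar> * \<bar>R\<bar> \<le> \<phi> x" for x
  proof (cases "R \<le> norm x \<and> x \<noteq> 0")
    case True
    then have "K * norm x \<le> \<phi> x" using R[of x] by (simp add: le_divide_eq)
    moreover have "0 \<le> \<bar>K\<bar> * \<bar>R\<bar>" by simp
    ultimately show ?thesis by linarith
  next
    case False
    then have "norm x \<le> \<bar>R\<bar>" by auto
    have "K * norm x \<le> \<bar>K\<bar> * norm x" by (rule mult_right_mono) auto
    also have "\<dots> \<le> \<bar>K\<bar> * \<bar>R\<bar>" using \<open>norm x \<le> \<bar>R\<bar>\<close> by (rule mult_left_mono) simp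
    finally show ?thesis using nonneg[of x] by linarith
  qed
  then show ?thesis by blast
qed

lemma BO_seminorm_leD:
  assumes "BO_seminorm f \<le> ereal B"
  shows "\<bar>f x - f y\<bar> \<le> B * (1 + norm (x - y))"
proof -
  have "ereal (\<bar>f x - f y\<bar> / (1 + norm (x - y))) \<le> BO_seminorm f"
    unfolding BO_seminorm_def by (rule SUP_upper2[of "(x, y)"]) auto
  then have "\<bar>f x - f y\<bar> / (1 + norm (x - y)) \<le> B" using assms by (metis ereal_less_eq(3) order_trans)
  moreover have "0 < 1 + norm (x - y)" using norm_ge_zero[of "x - y"] by linarith
  ultimately show ?thesis by (simp add: divide_le_eq)
qed

theorem theorem2p5:
  fixes T :: real
    and \<phi> :: "real ^ 'n \<Rightarrow> real"
    and F :: "real \<Rightarrow> real ^ 'n \<Rightarrow> real"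
    and b b1 :: "real \<Rightarrow> real"
    and c :: "real ^ 'n \<Rightarrow> real"
  assumes "T > 0"
    and "\<forall>x. \<phi> differentiable (at x)"
    and "\<forall>x. (\<lambda>t. F t x) \<in> borel_measurable (lebesgue_on {0..T})"
    and "G_function (\<lambda>x. ereal (\<phi> x))"
    and "strictly_convex \<phi>"
    and "Delta2 (\<lambda>x. ereal (\<phi> x))"
    and "Delta2 (conjugate_fun (\<lambda>x. ereal (\<phi> x)))"
    and "N_function \<phi>"
    and "AE t in lebesgue_on {0..T}. locally_lipschitz (F t) \<and> clarke_regular (F t)"
    and "integrable (lebesgue_on {0..T}) b"
    and "\<forall>t\<in>{0..T}. b t \<ge> 0"
    and "\<forall>S. bounded S \<longrightarrow> bounded (c ` S)"
    and "\<forall>x. AE t in lebesgue_on {0..T}. \<forall>\<xi>\<in>clarke_gradient (F t) x.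
           \<bar>F t x\<bar> + norm \<xi> \<le> c x * b t"
    and "filterlim (\<lambda>x. LINT t|lebesgue_on {0..T}. F t x) at_top at_infinity"
    and "integrable (lebesgue_on {0..T}) b1"
    and "AE t in lebesgue_on {0..T}. BO_seminorm (F t) \<le> ereal (b1 t)"
  shows "\<exists>u \<in> W1_orlicz_per T \<phi>.
           (\<forall>v \<in> W1_orlicz_per T \<phi>. action T \<phi> F u \<le> action T \<phi> F v) \<and>
           solves_inclusion T \<phi> F u"
proof -
  have \<phi>_nonneg: "0 \<le> \<phi> x" for x using assms(4) by (simp add: G_function_def)
  have \<phi>_0: "\<phi> 0 = 0" using assms(4) by (simp add: G_function_def zero_ereal_def)
  obtain C2 where C2: "0 < C2" "\<And>x. \<phi> (2 *\<^sub>R x) \<le> C2 * \<phi> x + 1"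
  proof -
    obtain C where C: "0 < C" "\<And>x. ereal (\<phi> (2 *\<^sub>R x)) \<le> ereal C * ereal (\<phi> x) + 1"
      using assms(6) unfolding Delta2_def by blast
    then show thesis by (intro that[of C]) (auto simp: one_ereal_def)
  qed
  \<comment> \<open>For each \<open>x\<close> the gradient bound has its own null set of times. On a
    countable dense set of points one null set serves for all.\<close>
  obtain Q :: "(real ^ 'n) set" where Q: "countable Q" "\<And>X. open X \<Longrightarrow> X \<noteq> {} \<Longrightarrow> \<exists>q\<in>Q. q \<in> X"
    using countable_dense_setE by metis
  have "AE t in lebesgue_on {0..T}. \<forall>q\<in>Q. \<forall>\<xi>\<in>clarke_gradient (F t) q. \<bar>F t q\<bar> + norm \<xi> \<le> c q * b t"
    by (subst AE_ball_countable[OF Q(1)]) (use assms(13) in blast)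
  with assms(9,16) have "AE t in lebesgue_on {0..T}. (locally_lipschitz (F t) \<and> clarke_regular (F t)) \<and>
      BO_seminorm (F t) \<le> ereal (b1 t) \<and>
      (\<forall>q\<in>Q. \<forall>\<xi>\<in>clarke_gradient (F t) q. \<bar>F t q\<bar> + norm \<xi> \<le> c q * b t)"
    by eventually_elim blast
  then obtain N where N: "negligible N" and good: "\<And>t. t \<in> {0..T} \<Longrightarrow> t \<notin> N \<Longrightarrow>
      (locally_lipschitz (F t) \<and> clarke_regular (F t)) \<and> BO_seminorm (F t) \<le> ereal (b1 t) \<and>
      (\<forall>q\<in>Q. \<forall>\<xi>\<in>clarke_gradient (F t) q. \<bar>F t q\<bar> + norm \<xi> \<le> c q * b t)"
    by (rule AE_lebesgue_onE) auto
  \<comment> \<open>The value 0 on \<open>N\<close> is the directional derivative of the modified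
    potential, which vanishes there. Off \<open>N\<close>, regularity makes Clarke's derivative
    finite, so \<open>real_of_ereal\<close> is faithful.\<close>
  define G where "G t x v = (if t \<in> N then 0 else real_of_ereal (clarke_deriv (F t) x v))" for t x v
  have Gd: "((\<lambda>l. (F t (x + l *\<^sub>R v) - F t x) / l) \<longlongrightarrow> G t x v) (at_right 0)"
    "clarke_deriv (F t) x v = ereal (G t x v)" if t: "t \<in> {0..T}" "t \<notin> N" for t x v
  proof -
    obtain d where d: "((\<lambda>l. (F t (x + l *\<^sub>R v) - F t x) / l) \<longlongrightarrow> d) (at_right 0)"
      "clarke_deriv (F t) x v = ereal d"
      using good[OF t] unfolding clarke_regular_def by blast
    then have "G t x v = d" using t(2) by (simp add: G_def)
    then show "((\<lambda>l. (F t (x + l *\<^sub>R v) - F t x) / l) \<longlongrightarrow> G t x v) (at_right 0)"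
      "clarke_deriv (F t) x v = ereal (G t x v)" using d by auto
  qed
  \<comment> \<open>Setting \<open>F\<close> to \<open>0\<close> on the exceptional null set changes neither the action nor the inclusion
    and makes the hypotheses hold for every \<open>t\<close>.\<close>
  define F' where "F' t x = (if t \<in> N then 0 else F t x)" for t x
  have F_eq: "F t x = F' t x" if "t \<notin> N" for t x using that by (simp add: F'_def)
  have sets: "{0..T} \<in> sets lebesgue" by simp
  have F'_meas: "(\<lambda>t. F' t x) \<in> borel_measurable (lebesgue_on {0..T})" for x
    by (rule lebesgue_on_cong_negligible(1)[OF N _ sets assms(3)[rule_format, of x]]) (simp add: F'_def)
  have b_int: "b absolutely_integrable_on {0..T}"
  proof -
    have "b integrable_on {0..T}" by (rule integrable_on_lebesgue_on[OF assms(10) sets])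
    then show ?thesis using assms(11) by (intro nonnegative_absolutely_integrable_1) auto
  qed
  \<comment> \<open>The absolute value is taken because \<open>b1\<close> may be negative on the
    null set \<open>N\<close>, where the modified potential is 0 and still needs a nonnegative
    bound.\<close>
  have b1_int: "(\<lambda>t. \<bar>b1 t\<bar>) absolutely_integrable_on {0..T}"
  proof -
    have "(\<lambda>t. \<bar>b1 t\<bar>) integrable_on {0..T}"
      by (rule integrable_on_lebesgue_on[OF integrable_abs[OF assms(15)] sets])
    then show ?thesis by (intro nonnegative_absolutely_integrable_1) auto
  qed
  interpret regular_periodic_action T \<phi> F' b "\<lambda>t. \<bar>b1 t\<bar>" C2 G
  proof
    show "0 < T" by (rule assms(1))
    show "convex_on UNIV \<phi>" by (rule G_function_convex_on[OF assms(4)])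
    show "\<phi> differentiable (at x)" for x using assms(2) by blast
    show "\<exists>M. \<forall>x. K * norm x - M \<le> \<phi> x" for K by (rule N_function_superlinear[OF assms(8)])
    show "0 \<le> b t" if "t \<in> {0..T}" for t using assms(11) that by blast
    show "\<bar>F' t x - F' t y\<bar> \<le> \<bar>b1 t\<bar> * (1 + norm (x - y))" if t: "t \<in> {0..T}" for t x y
    proof (cases "t \<in> N")
      case False
      have "\<bar>F t x - F t y\<bar> \<le> b1 t * (1 + norm (x - y))"
        by (rule BO_seminorm_leD) (use good[OF t False] in blast)
      also have "\<dots> \<le> \<bar>b1 t\<bar> * (1 + norm (x - y))" by (rule mult_right_mono) auto
      finally show ?thesis using False by (simp add: F'_def)
    qed (simp add: F'_def)
    show "((\<lambda>l. (F' t (x + l *\<^sub>R v) - F' t x) / l) \<longlongrightarrow> G t x v) (at_right 0)" if "t \<in> {0..T}" for t x v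
      using Gd(1)[OF that, of x v] by (cases "t \<in> N") (simp_all add: F'_def G_def)
    have "(LINT t|lebesgue_on {0..T}. F t x) = (LINT t|lebesgue_on {0..T}. F' t x)" for x
      by (rule lebesgue_on_cong_negligible(2)[OF N _ sets F'_meas]) (rule F_eq)
    then show "filterlim (\<lambda>x. LINT t|lebesgue_on {0..T}. F' t x) at_top at_infinity"
      using assms(14) by simp
    show "\<exists>C\<ge>0. \<forall>t\<in>{0..T}. (\<forall>x\<in>ball 0 R. \<bar>F' t x\<bar> \<le> C * b t) \<and>
        (\<forall>x\<in>ball 0 R. \<forall>y\<in>ball 0 R. \<bar>F' t x - F' t y\<bar> \<le> C * b t * norm (x - y))" for R
    proof -
      have "bounded (c ` ball 0 R)" using assms(12) by blast
      then obtain K where K: "\<forall>y\<in>c ` ball 0 R. norm y \<le> K" unfolding bounded_iff by blast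
      \<comment> \<open>The maximum matters when \<open>R\<close> is not positive: the ball is then
        empty and \<open>K\<close> is arbitrary.\<close>
      define C where "C = max K 0"
      have C: "0 \<le> C" by (simp add: C_def)
      have cC: "c x \<le> C" if "x \<in> ball 0 R" for x
      proof -
        have "norm (c x) \<le> K" using K that by blast
        then show ?thesis by (simp add: C_def)
      qed
      have "(\<forall>x\<in>ball 0 R. \<bar>F' t x\<bar> \<le> C * b t) \<and>
        (\<forall>x\<in>ball 0 R. \<forall>y\<in>ball 0 R. \<bar>F' t x - F' t y\<bar> \<le> C * b t * norm (x - y))" if t: "t \<in> {0..T}" for t
      proof (cases "t \<in> N")
        case True
        have "0 \<le> C * b t" using C assms(11) t by simp
        then show ?thesis using True by (simp add: F'_def)
      next
        case False
        have M: "\<bar>F t q\<bar> + norm \<xi> \<le> C * b t" if "q \<in> Q" "q \<in> ball 0 R" "\<xi> \<in> clarke_gradient (F t) q" for q \<xi>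
        proof -
          have "\<bar>F t q\<bar> + norm \<xi> \<le> c q * b t" using good[OF t False] that by blast
          also have "\<dots> \<le> C * b t" using cC[OF that(2)] assms(11) t by (intro mult_right_mono) auto
          finally show ?thesis .
        qed
        have lip: "locally_lipschitz (F t)" using good[OF t False] by blast
        show ?thesis
          using regular_lipschitz_of_dense[where d = "G t" and Q = Q and R = R and M = "C * b t",
              OF lip Gd[OF t False] Q(2) M]
          by (simp only: F_eq[OF False, symmetric]) blast
      qed
      then show ?thesis using C by blast
    qed
  qed (use \<phi>_nonneg \<phi>_0 C2 F'_meas b_int b1_int in auto)
  have action_F: "action T \<phi> F v = action T \<phi> F' v" if "v \<in> W1_orlicz_per T \<phi>" for v
  proof -
    have "v \<in> W1_orlicz T \<phi>" using that by (simp add: W1_orlicz_per_def)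
    then have "continuous_on {0..T} v" by (rule W1_D(2))
    then have "(\<lambda>t. F' t (v t)) \<in> borel_measurable (lebesgue_on {0..T})" by (rule F_comp_measurable)
    then have "(LINT t|lebesgue_on {0..T}. F t (v t)) = (LINT t|lebesgue_on {0..T}. F' t (v t))"
      by (intro lebesgue_on_cong_negligible(2)[OF N _ sets]) (rule F_eq)
    then show ?thesis by (simp add: action_def)
  qed
  obtain u where u: "u \<in> W1_orlicz_per T \<phi>"
    and min: "\<And>v. v \<in> W1_orlicz_per T \<phi> \<Longrightarrow> action T \<phi> F' u \<le> action T \<phi> F' v"
    using minimizer_exists by blast
  have "solves_inclusion T \<phi> F u"
  proof (rule minimizer_solves[OF u min], assumption)
    fix w
    assume w: "AE t in lebesgue_on {0..T}. (u has_vector_derivative w t) (at t within {0..T})"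
      "absolutely_continuous_on {0..T} (\<lambda>t. grad \<phi> (w t))"
      "AE t in lebesgue_on {0..T}. \<exists>d. (\<forall>v. d \<bullet> v \<le> G t (u t) v) \<and>
         ((\<lambda>s. grad \<phi> (w s)) has_vector_derivative d) (at t within {0..T})"
      "w 0 = w T"
    have "AE t in lebesgue_on {0..T}. t \<in> {0..T} \<and> t \<notin> N"
      by (rule AE_lebesgue_onI[OF N]) auto
    with w(3) have "AE t in lebesgue_on {0..T}. \<exists>p\<in>clarke_gradient (F t) (u t).
        ((\<lambda>s. grad \<phi> (w s)) has_vector_derivative p) (at t within {0..T})"
    proof eventually_elim
      case (elim t)
      then have t: "t \<in> {0..T}" "t \<notin> N" by auto
      have "d \<in> clarke_gradient (F t) (u t)" if "\<forall>v. d \<bullet> v \<le> G t (u t) v" for d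
        using clarke_gradient_regular_iff[of "F t" "u t" "G t", OF Gd(2)[OF t]] that by blast
      then show ?case using elim(1) by blast
    qed
    moreover have "u 0 - u T = 0" using u by (simp add: W1_orlicz_per_def)
    ultimately show ?thesis using w unfolding solves_inclusion_def by (intro exI[of _ w]) auto
  qed
  moreover have "\<forall>v\<in>W1_orlicz_per T \<phi>. action T \<phi> F u \<le> action T \<phi> F v"
    using min action_F u by simp
  ultimately show ?thesis using u by blast
qed

end
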